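(* Let $X$ be a linear diffusion on $\mathcal I=(\alpha,\beta)$ as described in the context, and fix $x\in\mathcal I$. Assume (Case (I)): $\alpha>-\infty$, $\alpha$ is attractive and $\beta$ is not (that is, $S(\alpha)=0$ and $S(\beta)=\infty$), and $\lim_{b\to\beta}\mathbb P_x(\tau_b<\infty)\,b^2=0$. Then $V(x)<\infty$. Furthermore: (A) There exist $a^*\in[\alpha,x]$, $b^*,z^*\in[x,\beta)$ and $p^*\in[0,1]$ such that $\tau^*=\xi_{p^*}\tau_{(a^*,b^* )}+(1-\xi_{p^*})\tau_{(\alpha,z^* )}$ is an optimal stopping time for the variance problem, i.e. $V(x)=\mathrm{Var}_x\{X_{\tau^*}\}$. (B) Assume in addition the following: for each $c\in\mathcal I$ let $Z(c)$ denote the set of $z$ maximizing $\frac{z^2-\alpha^2-2c(z-\alpha)}{S(z)}$; for each $c\in\mathcal I$ for which $Z(c)$ has more than one element one has $\mathbb E_{\hat z_i}\{X_{\tau_{(\alpha,\hat z_s)}}\}>c$, where $\hat z_i=\inf Z(c)$ and $\hat z_s=\sup Z(c)$. Then there exist $z_1^*,z_2^*\in[x,\beta)$ and $p^*\in[0,1]$ such that $\tau^*=\xi_{p^*}\tau_{(\alpha,z_1^* )}+(1-\xi_{p^*})\tau_{(\alpha,z_2^* )}$ is an optimal stopping time. (C) Assume in addition (to Case (I)) that $S$ is differentiable and that $z\mapsto\frac{S'(z)}{S(z)}(z-\alpha)$ is non-decreasing. Then $\tau_{(\alpha,z^* )}$ is an optimal stopping time, where $z^*=z^*(x)$ is the unique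 solution on $(x,\beta)$ of $$\frac{S(z)-S(x)}{\frac12 S(z)-S(x)}=\frac{S'(z)}{S(z)}(z-\alpha),$$ and $V(x)=(z^*-\alpha)^2\frac{S(x)}{S(z^* )}\left(1-\frac{S(x)}{S(z^* )}\right)$.
   Context: Setting. $X=(X_t)_{t\ge 0}$ is a regular linear diffusion on a filtered probability space $(\Omega,\mathcal F,\mathbb F,\mathbb P)$, where $\mathbb F$ is the filtration generated by $X$; it evolves on an interval $\mathcal I=(\alpha,\beta)\subseteq\mathbb R$, and $\mathbb P_x,\mathbb E_x,\mathrm{Var}_x$ refer to $X_0=x$. The boundaries may be natural, exit, entrance or killing (killing end points belong to $\mathcal I$); absorbing boundaries are also allowed. On the interior of $\mathcal I$ the diffusion is regular (from any interior point it hits any other interior point with positive probability), it does not die inside the state space, and its scale function $S$ and speed measure $m$ are continuous. $S$ is increasing and continuous and $\mathbb P_x(\tau_b<\tau_a)=\frac{S(x)-S(a)}{S(b)-S(a)}$ for $\alpha<a<x<b<\beta$. Boundary values of $S$ are limits; $S$ is normalized so that $S(\alpha)=0$ or $S(\alpha)=-\infty$. The boundary $\alpha$ (resp. $\beta$) is attractive if $X$ converges to it with positive probability, equivalently $S(\alpha)>-\infty$ (resp. $S(\beta)<\infty$). Stopping times may take the value $\infty$; with $\zeta=\inf\{t\ge0: X_t=\alpha\text{ or }\beta\}$ one sets $X_\infty:=\limsup_{t\to\zeta}X_t$, and for evaluating $X_\tau$ the process is regarded as staying at an end point after reaching it. Notation: $\tau_z=\inf\{t\ge0:X_t=z\}$,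 $\tau_{(z,y)}=\inf\{t\ge0:X_t\notin(z,y)\}$, $\tau_{(\alpha,z)}=\lim_{a\to\alpha}\tau_{(a,z)}$, $\tau_{(z,\beta)}=\lim_{b\to\beta}\tau_{(z,b)}$. Randomized stopping times: let $U$ be uniform on $[0,1]$ and independent of $X$ (enlarging the probability space if necessary); $\mathcal T$ is the class of all stopping times of the filtration $\hat{\mathbb F}_t=\sigma\{U,(X_s)_{0\le s\le t}\}$. $\xi_p$ denotes a Bernoulli variable independent of $X$ with $\mathbb P(\xi_p=1)=p=1-\mathbb P(\xi_p=0)$ (e.g. $\xi_p=\mathbf 1_{\{U<p\}}$), so $\xi_p\tau_1+(1-\xi_p)\tau_2$ equals $\tau_1$ if $\xi_p=1$ and $\tau_2$ if $\xi_p=0$. Variance problem: $V(x)=\sup_{\tau\in\mathcal T}\mathrm{Var}_x\{X_\tau\}$; $\tau^*\in\mathcal T$ is optimal if $V(x)=\mathrm{Var}_x\{X_{\tau^*}\}$. *)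

theory Defs
  imports "HOL-Probability.Probability"
begin

text \<open>
  The process is a map \<open>X :: real \<Rightarrow> 'a \<Rightarrow> ereal\<close>, used at times \<open>t \<ge> 0\<close> only; random times
  take values in \<open>ennreal\<close>. Values are extended reals because an infinite end point may be
  reached in finite time. A path that reaches an end point stays there, whether the end point is
  absorbing or killing (see the locale below).
\<close>

definition interior_states :: "ereal \<Rightarrow> ereal \<Rightarrow> real set" where
  "interior_states \<alpha> \<beta> = {y. \<alpha> < ereal y \<and> ereal y < \<beta>}"


subsection \<open>Filtrations and randomized stopping times\<close>

definition natural_filtration ::
    "'a measure \<Rightarrow> (real \<Rightarrow> 'a \<Rightarrow> ereal) \<Rightarrow> ennreal \<Rightarrow> 'a measure" where
  "natural_filtration M X t =
     sigma (space M) {X s -` A \<inter> space M | s A. 0 \<le> s \<and> ennreal s \<le> t \<and> A \<in> sets borel}"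

definition randomized_filtration ::
    "'a measure \<Rightarrow> (real \<Rightarrow> 'a \<Rightarrow> ereal) \<Rightarrow> ('a \<Rightarrow> real) \<Rightarrow> ennreal \<Rightarrow> 'a measure" where
  "randomized_filtration M X U t =
     sigma (space M)
       ({U -` A \<inter> space M | A. A \<in> sets borel} \<union>
        {X s -` A \<inter> space M | s A. 0 \<le> s \<and> ennreal s \<le> t \<and> A \<in> sets borel})"

definition randomized_stopping_times ::
    "'a measure \<Rightarrow> (real \<Rightarrow> 'a \<Rightarrow> ereal) \<Rightarrow> ('a \<Rightarrow> real) \<Rightarrow> ('a \<Rightarrow> ennreal) set" where
  "randomized_stopping_times M X U = {\<tau>. stopping_time (randomized_filtration M X U) \<tau>}"

text \<open>
  \<open>\<xi>\<^sub>p \<tau>\<^sub>1 + (1 - \<xi>\<^sub>p) \<tau>\<^sub>2\<close> with the Bernoulli variable \<open>\<xi>\<^sub>p = 1\<close> if \<open>U < p\<close>, else \<open>0\<close>.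
\<close>

definition mix_times :: "('a \<Rightarrow> real) \<Rightarrow> real \<Rightarrow> ('a \<Rightarrow> ennreal) \<Rightarrow> ('a \<Rightarrow> ennreal) \<Rightarrow> 'a \<Rightarrow> ennreal" where
  "mix_times U p \<tau>1 \<tau>2 \<omega> = (if U \<omega> < p then \<tau>1 \<omega> else \<tau>2 \<omega>)"


subsection \<open>Hitting and exit times\<close>

definition hit_time :: "(real \<Rightarrow> 'a \<Rightarrow> ereal) \<Rightarrow> ereal \<Rightarrow> 'a \<Rightarrow> ennreal" where
  "hit_time X z \<omega> = (INF t\<in>{t. 0 \<le> t \<and> X t \<omega> = z}. ennreal t)"

definition inner_exit_time :: "(real \<Rightarrow> 'a \<Rightarrow> ereal) \<Rightarrow> ereal \<Rightarrow> ereal \<Rightarrow> 'a \<Rightarrow> ennreal" where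
  "inner_exit_time X a b \<omega> = (INF t\<in>{t. 0 \<le> t \<and> X t \<omega> \<notin> {a<..<b}}. ennreal t)"

text \<open>
  \<open>\<tau>\<^bsub>(a,b)\<^esub>\<close> for \<open>\<alpha> \<le> a\<close>. At the lower end point, \<open>\<tau>\<^bsub>(\<alpha>,b)\<^esub>\<close> is by convention the limit of
  \<open>\<tau>\<^bsub>(a,b)\<^esub>\<close> as \<open>a\<close> decreases to \<open>\<alpha>\<close>.
\<close>

definition exit_time :: "(real \<Rightarrow> 'a \<Rightarrow> ereal) \<Rightarrow> ereal \<Rightarrow> ereal \<Rightarrow> ereal \<Rightarrow> 'a \<Rightarrow> ennreal" where
  "exit_time X \<alpha> a b \<omega> =
     (if a = \<alpha> then Lim (at_right \<alpha>) (\<lambda>a'. inner_exit_time X a' b \<omega>)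
      else inner_exit_time X a b \<omega>)"


subsection \<open>Regular linear diffusions\<close>

definition path_space :: "(real \<Rightarrow> ereal) measure" where
  "path_space = PiM {0..} (\<lambda>_. borel)"

definition path_from :: "(real \<Rightarrow> 'a \<Rightarrow> ereal) \<Rightarrow> real \<Rightarrow> 'a \<Rightarrow> real \<Rightarrow> ereal" where
  "path_from X t \<omega> = (\<lambda>s\<in>{0..}. X (t + s) \<omega>)"

definition path_law ::
    "(real \<Rightarrow> 'a measure) \<Rightarrow> (real \<Rightarrow> 'a \<Rightarrow> ereal) \<Rightarrow> real \<Rightarrow> (real \<Rightarrow> ereal) measure" where
  "path_law P X y = distr (P y) path_space (path_from X 0)"

text \<open>
  The boundary values of the scale function, as limits in the extended reals.
\<close>

definition scale_lower :: "ereal \<Rightarrow> (real \<Rightarrow> real) \<Rightarrow> ereal" where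
  "scale_lower \<alpha> S = Lim (at_right \<alpha>) (\<lambda>y. ereal (S (real_of_ereal y)))"

definition scale_upper :: "ereal \<Rightarrow> (real \<Rightarrow> real) \<Rightarrow> ereal" where
  "scale_upper \<beta> S = Lim (at_left \<beta>) (\<lambda>y. ereal (S (real_of_ereal y)))"

text \<open>
  \<open>P y\<close> is the law on \<open>M\<close> for the starting point \<open>y\<close>, an interior state. The process does not die
  at interior states. At a killing or exit end point the killed path is represented by the path
  frozen at that end point, which generates the same filtration; natural and entrance end points
  are simply never reached. The probability space is already enlarged so as to carry \<open>U\<close>.
\<close>

locale linear_diffusion =
  fixes M :: "'a measure"
    and P :: "real \<Rightarrow> 'a measure"
    and X :: "real \<Rightarrow> 'a \<Rightarrow> ereal"
    and U :: "'a \<Rightarrow> real"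
    and S :: "real \<Rightarrow> real"
    and m :: "real measure"
    and \<alpha> \<beta> :: ereal
  assumes nonempty: "\<alpha> < \<beta>"
    and prob: "\<And>y. y \<in> interior_states \<alpha> \<beta> \<Longrightarrow> P y \<in> space (prob_algebra M)"
    and measurable_X: "\<And>t. 0 \<le> t \<Longrightarrow> X t \<in> M \<rightarrow>\<^sub>M borel"
    and measurable_U: "U \<in> M \<rightarrow>\<^sub>M borel"
    and start: "\<And>y. y \<in> interior_states \<alpha> \<beta> \<Longrightarrow> AE \<omega> in P y. X 0 \<omega> = ereal y"
    and states: "\<And>\<omega> t. \<omega> \<in> space M \<Longrightarrow> 0 \<le> t \<Longrightarrow> X t \<omega> \<in> {\<alpha>..\<beta>}"
    and continuous_paths: "\<And>\<omega>. \<omega> \<in> space M \<Longrightarrow> continuous_on {0..} (\<lambda>t. X t \<omega>)"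
    and stays_at_end_points:
      "\<And>\<omega> s t. \<omega> \<in> space M \<Longrightarrow> 0 \<le> s \<Longrightarrow> s \<le> t \<Longrightarrow> X s \<omega> \<in> {\<alpha>, \<beta>} \<Longrightarrow> X t \<omega> = X s \<omega>"
    \<comment> \<open>strong Markov property with respect to the filtration generated by \<open>X\<close>\<close>
    and kernel:
      "path_law P X \<in> restrict_space borel (interior_states \<alpha> \<beta>) \<rightarrow>\<^sub>M prob_algebra path_space"
    and strong_Markov:
      "\<And>y T A B. y \<in> interior_states \<alpha> \<beta> \<Longrightarrow>
         stopping_time (natural_filtration M X) T \<Longrightarrow>
         A \<in> sets (filtration.pre_sigma (space M) (natural_filtration M X) T) \<Longrightarrow>
         (\<And>\<omega>. \<omega> \<in> A \<Longrightarrow> T \<omega> < \<infinity> \<and> X (enn2real (T \<omega>)) \<omega> \<in> {\<alpha><..<\<beta>}) \<Longrightarrow>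
         B \<in> sets path_space \<Longrightarrow>
         emeasure (P y) {\<omega>\<in>A. path_from X (enn2real (T \<omega>)) \<omega> \<in> B} =
           (\<integral>\<^sup>+\<omega>\<in>A. emeasure (path_law P X (real_of_ereal (X (enn2real (T \<omega>)) \<omega>))) B \<partial>P y)"
    and regular:
      "\<And>y z. y \<in> interior_states \<alpha> \<beta> \<Longrightarrow> z \<in> interior_states \<alpha> \<beta> \<Longrightarrow>
         0 < measure (P y) {\<omega>\<in>space M. hit_time X (ereal z) \<omega> < \<infinity>}"
    and scale_mono: "strict_mono_on (interior_states \<alpha> \<beta>) S"
    and scale_continuous: "continuous_on (interior_states \<alpha> \<beta>) S"
    and scale_hitting:
      "\<And>a y b. a \<in> interior_states \<alpha> \<beta> \<Longrightarrow> b \<in> interior_states \<alpha> \<beta> \<Longrightarrow> a < y \<Longrightarrow> y < b \<Longrightarrow>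
         measure (P y) {\<omega>\<in>space M. hit_time X (ereal b) \<omega> < hit_time X (ereal a) \<omega>} =
           (S y - S a) / (S b - S a)"
    and scale_normalized: "scale_lower \<alpha> S = 0 \<or> scale_lower \<alpha> S = - \<infinity>"
    \<comment> \<open>\<open>m\<close> is the speed measure, characterized through the Green kernel of \<open>X\<close> killed on leaving
        \<open>(a, b)\<close> (normalized so that \<open>S y = y\<close>, \<open>m(dy) = 2 dy\<close> for Brownian motion); it has no
        atoms\<close>
    and speed_sets: "sets m = sets borel"
    and speed_finite: "\<And>a b. a \<in> interior_states \<alpha> \<beta> \<Longrightarrow> b \<in> interior_states \<alpha> \<beta> \<Longrightarrow>
         emeasure m {a..b} < \<infinity>"
    and speed_positive: "\<And>a b. a \<in> interior_states \<alpha> \<beta> \<Longrightarrow> b \<in> interior_states \<alpha> \<beta> \<Longrightarrow>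
         a < b \<Longrightarrow> 0 < emeasure m {a<..<b}"
    and speed_continuous: "\<And>y. y \<in> interior_states \<alpha> \<beta> \<Longrightarrow> emeasure m {y} = 0"
    and speed_exit:
      "\<And>a y b. a \<in> interior_states \<alpha> \<beta> \<Longrightarrow> b \<in> interior_states \<alpha> \<beta> \<Longrightarrow> a < y \<Longrightarrow> y < b \<Longrightarrow>
         (\<integral>\<^sup>+\<omega>. inner_exit_time X (ereal a) (ereal b) \<omega> \<partial>P y) =
           (\<integral>\<^sup>+z\<in>{a<..<b}.
              ennreal ((S (min y z) - S a) * (S b - S (max y z)) / (S b - S a)) \<partial>m)"
    \<comment> \<open>the randomization variable\<close>
    and uniform: "\<And>y. y \<in> interior_states \<alpha> \<beta> \<Longrightarrow>
         distr (P y) borel U = uniform_measure lborel {0..1}"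
    and independent: "\<And>y. y \<in> interior_states \<alpha> \<beta> \<Longrightarrow>
         prob_space.indep_set (P y)
           {U -` A \<inter> space M | A. A \<in> sets borel} (sets (natural_filtration M X \<infinity>))"

text \<open>
  Convergence to an end point at the time \<open>\<zeta>\<close> of reaching it is convergence as \<open>t \<rightarrow> \<infinity>\<close>, since
  paths are continuous and are frozen from \<open>\<zeta>\<close> on. By regularity the starting point is irrelevant.
\<close>

definition attractive ::
    "'a measure \<Rightarrow> (real \<Rightarrow> 'a measure) \<Rightarrow> (real \<Rightarrow> 'a \<Rightarrow> ereal) \<Rightarrow> ereal \<Rightarrow> ereal \<Rightarrow> ereal \<Rightarrow> bool" where
  "attractive M P X \<alpha> \<beta> e \<longleftrightarrow>
     (\<exists>y\<in>interior_states \<alpha> \<beta>. 0 < measure (P y) {\<omega>\<in>space M. ((\<lambda>t. X t \<omega>) \<longlongrightarrow> e) at_top})"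


subsection \<open>The variance problem\<close>

text \<open>
  On \<open>\<tau> = \<infinity>\<close> the value is \<open>limsup\<close> of \<open>X t\<close> as \<open>t \<rightarrow> \<zeta>\<close>, which equals the \<open>limsup\<close> as
  \<open>t \<rightarrow> \<infinity>\<close> because paths are frozen from \<open>\<zeta>\<close> on.
\<close>

definition stopped :: "(real \<Rightarrow> 'a \<Rightarrow> ereal) \<Rightarrow> ('a \<Rightarrow> ennreal) \<Rightarrow> 'a \<Rightarrow> ereal" where
  "stopped X \<tau> \<omega> =
     (if \<tau> \<omega> = \<infinity> then Limsup at_top (\<lambda>t. X t \<omega>) else X (enn2real (\<tau> \<omega>)) \<omega>)"

definition stopped_mean ::
    "(real \<Rightarrow> 'a measure) \<Rightarrow> (real \<Rightarrow> 'a \<Rightarrow> ereal) \<Rightarrow> real \<Rightarrow> ('a \<Rightarrow> ennreal) \<Rightarrow> real" where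
  "stopped_mean P X y \<tau> = (\<integral>\<omega>. real_of_ereal (stopped X \<tau> \<omega>) \<partial>P y)"

text \<open>
  The variance is \<open>\<infinity>\<close> exactly if \<open>X\<^sub>\<tau>\<close> has no finite second moment; this covers the cases where
  \<open>X\<^sub>\<tau>\<close> is infinite with positive probability or not integrable (\<open>stopped_mean\<close> is then a junk
  value, but still a real number).
\<close>

definition stopped_variance ::
    "(real \<Rightarrow> 'a measure) \<Rightarrow> (real \<Rightarrow> 'a \<Rightarrow> ereal) \<Rightarrow> real \<Rightarrow> ('a \<Rightarrow> ennreal) \<Rightarrow> ennreal" where
  "stopped_variance P X y \<tau> =
     (\<integral>\<^sup>+\<omega>. e2ennreal ((stopped X \<tau> \<omega> - ereal (stopped_mean P X y \<tau>))\<^sup>2) \<partial>P y)"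

definition variance_value ::
    "'a measure \<Rightarrow> (real \<Rightarrow> 'a measure) \<Rightarrow> (real \<Rightarrow> 'a \<Rightarrow> ereal) \<Rightarrow> ('a \<Rightarrow> real) \<Rightarrow> real \<Rightarrow> ennreal" where
  "variance_value M P X U y =
     (SUP \<tau>\<in>randomized_stopping_times M X U. stopped_variance P X y \<tau>)"

definition optimal ::
    "'a measure \<Rightarrow> (real \<Rightarrow> 'a measure) \<Rightarrow> (real \<Rightarrow> 'a \<Rightarrow> ereal) \<Rightarrow> ('a \<Rightarrow> real) \<Rightarrow> real \<Rightarrow>
     ('a \<Rightarrow> ennreal) \<Rightarrow> bool" where
  "optimal M P X U y \<tau> \<longleftrightarrow>
     \<tau> \<in> randomized_stopping_times M X U \<and>
     variance_value M P X U y = stopped_variance P X y \<tau>"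

definition maximizers :: "(real \<Rightarrow> real) \<Rightarrow> real \<Rightarrow> ereal \<Rightarrow> real \<Rightarrow> real set" where
  "maximizers S \<alpha> \<beta> c =
     (let f = (\<lambda>z. (z\<^sup>2 - \<alpha>\<^sup>2 - 2 * c * (z - \<alpha>)) / S z)
      in {z \<in> interior_states (ereal \<alpha>) \<beta>. \<forall>w\<in>interior_states (ereal \<alpha>) \<beta>. f w \<le> f z})"

end

theory Submission
  imports Defs
begin


text \<open>
  The scale process \<open>S (X t)\<close>, set to \<open>0\<close> at \<open>\<alpha>\<close>, is a nonnegative supermartingale that converges to \<open>0\<close>, so
  that the law of \<open>X\<^sub>\<tau>\<close> satisfies \<open>\<integral> S d\<mu> \<le> S x\<close> for every randomized stopping time; conversely
  two-point laws \<open>{a, b}\<close> with \<open>\<integral> S d\<mu> = S x\<close> are laws of \<open>X\<close> at exit times. Since the variance is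
  the minimum over \<open>c\<close> of the second moment about \<open>c\<close>, the problem becomes a saddle point problem for
  laws on \<open>[\<alpha>, \<beta>)\<close>: there are \<open>c\<close> and \<open>B > 0\<close> with \<open>(v - c)\<^sup>2 \<le> (\<alpha> - c)\<^sup>2 + B S v\<close> and a law on the
  contact set of this inequality with mean \<open>c\<close>. Every contact point other than \<open>\<alpha>\<close> exceeds \<open>c\<close>, hence a
  two-point law on the contact set with mean at most \<open>c\<close> charges \<open>\<alpha>\<close>, and mixing it with one of mean
  at least \<open>c\<close> gives an optimal stopping time.
\<close>


subsection \<open>A saddle point on the half-line\<close>


text \<open>The obstacle is attainment: mass may escape towards \<beta> along a maximizing sequence
  of laws. The growth hypothesis makes squares negligible against the scale, so that escaped mass
  uses up scale without contributing variance. The constant \<open>c\<close> is the mean of a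
  maximizing law, since the tangent of the variance, a concave functional of the law, is the second
  moment about the mean of that law. The constant \<open>B\<close> is the Lagrange multiplier of the
  scale constraint.

  The diffusion is given only through hitting probabilities, mean exit times and the strong Markov
  property for its own filtration. The supermartingale property therefore has to be read off from
  the probabilities of reaching one level before another, and independence has to carry the Markov
  property over to the filtration that contains \<open>U\<close>. Doing this at deterministic times
  is enough, because randomized stopping times are approximated from above on dyadic grids. Path
  continuity reduces all measurability questions to countably many rational times.\<close>

lemma nonpos_if_le_scaled:
  fixes d e :: real
  assumes "0 \<le> e" and le: "\<And>t. 0 < t \<Longrightarrow> t \<le> 1 \<Longrightarrow> d \<le> t * e"
  shows "d \<le> 0"
proof (rule ccontr)
  assume "\<not> d \<le> 0"
  then have d: "0 < d" by simp
  \<comment> \<open>Any step in \<open>(0, 1]\<close> with \<open>t * e < d\<close> contradicts the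
    bound: for small steps the first-order gain \<open>d\<close> beats the quadratic
    remainder.\<close>
  define t where "t = d / (d + e + 1)"
  have "0 < t" "t \<le> 1" using d assms(1) by (auto simp: t_def field_simps)
  from le[OF this] have "d * (d + e + 1) \<le> d * e"
    using d assms(1) by (simp add: t_def field_simps)
  then have "d * (d + 1) \<le> 0" by (simp add: algebra_simps)
  moreover have "0 < d * (d + 1)" using d by simp
  ultimately show False by simp
qed

text \<open>Complementary slackness for a finite measure. The sign of \<open>f\<close> is asked for
  only where the weight is positive, since atoms of weight 0 may stand for points at infinity, where
  \<open>f\<close> has a meaningless value.\<close>

lemma sum_zero_if_weighted_nonneg:
  fixes f w :: "'b \<Rightarrow> real"
  assumes "finite T" "\<And>i. i \<in> T \<Longrightarrow> 0 \<le> w i" "\<And>i. i \<in> T \<Longrightarrow> 0 < w i \<Longrightarrow> 0 \<le> f i"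
    and "(\<Sum>i\<in>T. w i * f i) \<le> 0" "i \<in> T" "0 < w i"
  shows "f i = 0"
proof -
  have nn: "0 \<le> w j * f j" if "j \<in> T" for j
    using assms(2,3)[OF that] by (cases "w j = 0") auto
  have "(\<Sum>i\<in>T. w i * f i) = 0" using assms(4) sum_nonneg[of T "\<lambda>i. w i * f i"] nn by force
  with sum_nonneg_eq_0_iff[OF assms(1), of "\<lambda>i. w i * f i"] nn assms(5) have "w i * f i = 0" by auto
  with assms(6) show ?thesis by simp
qed

text \<open>
  Dividing the moments of the curve by \<open>1 + u\<close> turns the constraint \<open>\<integral> u \<le> x0\<close> on laws over the
  half-line into a slice of the convex hull of a \<^emph>\<open>compact\<close> curve; its end point \<open>\<theta> = 0\<close> is mass
  escaping to infinity.
\<close>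

lemma saddle_point:
  fixes \<phi> :: "real \<Rightarrow> real" and x0 :: real
  assumes cont: "continuous_on {0..} \<phi>" and mono: "strict_mono_on {0..} \<phi>"
    and lim: "((\<lambda>u. (\<phi> u)\<^sup>2 / (1 + u)) \<longlongrightarrow> 0) at_top" and x0: "0 < x0"
  obtains c B z1 z2 where "0 < B"
    "\<And>u. 0 \<le> u \<Longrightarrow> (\<phi> u - c)\<^sup>2 \<le> (\<phi> 0 - c)\<^sup>2 + B * u"
    "(\<phi> z1 - c)\<^sup>2 = (\<phi> 0 - c)\<^sup>2 + B * z1" "(\<phi> z2 - c)\<^sup>2 = (\<phi> 0 - c)\<^sup>2 + B * z2"
    "0 < z1" "0 < z2"
    "(\<phi> z1 - \<phi> 0) * x0 \<le> (c - \<phi> 0) * z1" "(c - \<phi> 0) * z2 \<le> (\<phi> z2 - \<phi> 0) * x0"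
    "\<phi> 0 < c"
proof -
  \<comment> \<open>Inverse of \<open>\<theta> = 1 / (1 + u)\<close>. Totalized division gives
    \<open>v 0 = -1\<close>, which is harmless because every coordinate of \<open>\<gamma>\<close>
    carries the factor \<open>\<theta>\<close>.\<close>
  define v where "v \<theta> = 1 / \<theta> - 1" for \<theta> :: real
  define \<gamma> where "\<gamma> \<theta> = (\<theta>, \<theta> * \<phi> (v \<theta>), \<theta> * (\<phi> (v \<theta>))\<^sup>2)" for \<theta>
  \<comment> \<open>A convex combination with weights \<open>w\<close> of points of the curve stands
    for the masses \<open>w * \<theta> / \<theta>0\<close>. First coordinate
    \<open>\<theta>0\<close> says that they sum to 1, and then total weight 1 says that the integral
    of \<open>1 + u\<close> is at most \<open>1 / \<theta>0 = 1 + x0\<close>, with a deficit exactly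
    if there is weight at \<open>\<theta> = 0\<close>.\<close>
  define \<theta>0 where "\<theta>0 = 1 / (1 + x0)"
  have t0: "0 < \<theta>0" "\<theta>0 \<le> 1" "v \<theta>0 = x0" using x0 by (auto simp: \<theta>0_def v_def)
  have v_nn: "0 \<le> v \<theta>" if "0 < \<theta>" "\<theta> \<le> 1" for \<theta> using that by (auto simp: v_def)
  have sqz: "((\<lambda>\<theta>. \<theta> * (\<phi> (v \<theta>))\<^sup>2) \<longlongrightarrow> 0) (at_right 0)"
  proof -
    have "filterlim v at_top (at_right 0)" unfolding v_def by real_asymp
    from filterlim_compose[OF lim this]
    have "((\<lambda>\<theta>. (\<phi> (v \<theta>))\<^sup>2 / (1 + v \<theta>)) \<longlongrightarrow> 0) (at_right 0)" .
    then show ?thesis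
      by (rule filterlim_cong[THEN iffD1, OF refl refl, rotated])
         (auto simp: v_def eventually_at_filter)
  qed
  have linz: "((\<lambda>\<theta>. \<theta> * \<phi> (v \<theta>)) \<longlongrightarrow> 0) (at_right 0)"
  proof (rule Lim_null_comparison)
    have "norm (\<theta> * \<phi> (v \<theta>)) \<le> \<theta> + \<theta> * (\<phi> (v \<theta>))\<^sup>2" if "0 < \<theta>" for \<theta>
    proof -
      have "\<bar>\<phi> (v \<theta>)\<bar> \<le> 1 + (\<phi> (v \<theta>))\<^sup>2"
      proof -
        have "0 \<le> (\<bar>\<phi> (v \<theta>)\<bar> - 1)\<^sup>2" by simp
        then have "2 * \<bar>\<phi> (v \<theta>)\<bar> \<le> 1 + (\<phi> (v \<theta>))\<^sup>2" unfolding power2_diff by simp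
        then show ?thesis by simp
      qed
      then have "\<theta> * \<bar>\<phi> (v \<theta>)\<bar> \<le> \<theta> * (1 + (\<phi> (v \<theta>))\<^sup>2)" using that by (intro mult_left_mono) auto
      then show ?thesis using that by (simp add: abs_mult algebra_simps)
    qed
    then show "\<forall>\<^sub>F \<theta> in at_right 0. norm (\<theta> * \<phi> (v \<theta>)) \<le> \<theta> + \<theta> * (\<phi> (v \<theta>))\<^sup>2"
      by (auto simp: eventually_at_filter)
    show "((\<lambda>\<theta>. \<theta> + \<theta> * (\<phi> (v \<theta>))\<^sup>2) \<longlongrightarrow> 0) (at_right 0)"
      using tendsto_add[OF tendsto_ident_at sqz] by simp
  qed
  have v_cont: "continuous_on {0<..1} (\<lambda>\<theta>. \<phi> (v \<theta>))"
    by (rule continuous_on_compose2[OF cont]) (auto simp: v_def intro!: continuous_intros)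
  have ctm: "continuous_on {0..1} \<gamma>"
    unfolding continuous_on_eq_continuous_within
  proof
    fix \<theta> :: real assume th: "\<theta> \<in> {0..1}"
    show "continuous (at \<theta> within {0..1}) \<gamma>"
    proof (cases "\<theta> = 0")
      case True
      have "(\<gamma> \<longlongrightarrow> (0, 0, 0)) (at_right 0)" unfolding \<gamma>_def
        by (intro tendsto_Pair sqz linz tendsto_ident_at)
      then show ?thesis using True by (simp add: continuous_within \<gamma>_def at_within_Icc_at_right)
    next
      case False
      with th have "\<theta> \<in> {0<..1}" by auto
      moreover have "continuous_on {0<..1} \<gamma>" unfolding \<gamma>_def
        by (intro continuous_intros v_cont)
      ultimately have "continuous (at \<theta> within {0<..1}) \<gamma>"
        by (simp add: continuous_on_eq_continuous_within)
      moreover have "at \<theta> within {0<..1} = at \<theta> within {0..1}"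
        by (rule at_within_nhd[of _ "{0<..}"]) (use \<open>\<theta> \<in> {0<..1}\<close> in auto)
      ultimately show ?thesis by (simp add: continuous_within)
    qed
  qed
  define C where "C = convex hull (\<gamma> ` {0..1})"
  have C_compact: "compact C" unfolding C_def
    by (intro compact_convex_hull compact_continuous_image ctm compact_Icc)
  have C_convex: "convex C" unfolding C_def by simp
  have \<gamma>C: "\<gamma> \<theta> \<in> C" if "0 \<le> \<theta>" "\<theta> \<le> 1" for \<theta>
    unfolding C_def by (rule hull_inc) (use that in auto)
  define K where "K = C \<inter> {p. fst p = \<theta>0}"
  have "compact K" unfolding K_def
    by (intro compact_Int_closed C_compact closed_Collect_eq continuous_intros)
  moreover have \<gamma>K: "\<gamma> \<theta>0 \<in> K" using \<gamma>C[of \<theta>0] t0 by (auto simp: K_def \<gamma>_def)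
  \<comment> \<open>The variance of \<phi> under the law that the point stands for.\<close>
  define J where "J p = snd (snd p) / \<theta>0 - (fst (snd p) / \<theta>0)\<^sup>2" for p :: "real \<times> real \<times> real"
  have "continuous_on K J" unfolding J_def using t0 by (intro continuous_intros) auto
  ultimately obtain p where pK: "p \<in> K" and p_max: "\<And>q. q \<in> K \<Longrightarrow> J q \<le> J p"
    using continuous_attains_sup[of K J] \<gamma>K by blast
  define c where "c = fst (snd p) / \<theta>0"
  define M where "M = snd (snd p) / \<theta>0"
  define F where "F = M - c\<^sup>2"
  define g where "g u = (\<phi> u - c)\<^sup>2" for u
  \<comment> \<open>First-order condition at the maximizer \<open>p\<close> along the segment to
    \<open>q\<close>: the linear part of \<open>J\<close> at \<open>p\<close> is second moment minus
    \<open>2 * c\<close> times mean, and the quadratic remainder is removed by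
    \<open>nonpos_if_le_scaled\<close>.\<close>
  have lin: "snd (snd q) / \<theta>0 - 2 * c * (fst (snd q) / \<theta>0) \<le> M - 2 * c\<^sup>2" if qK: "q \<in> K" for q
  proof -
    define M' where "M' = snd (snd q) / \<theta>0"
    define m' where "m' = fst (snd q) / \<theta>0"
    have "(M' - M) - 2 * c * (m' - c) \<le> 0"
    proof (rule nonpos_if_le_scaled[of "(m' - c)\<^sup>2"])
      fix t :: real assume t: "0 < t" "t \<le> 1"
      have "(1 - t) *\<^sub>R p + t *\<^sub>R q \<in> C"
        by (rule convexD[OF C_convex]) (use pK qK t in \<open>auto simp: K_def\<close>)
      then have inK: "(1 - t) *\<^sub>R p + t *\<^sub>R q \<in> K"
        using pK qK by (auto simp: K_def algebra_simps)
      have "J ((1 - t) *\<^sub>R p + t *\<^sub>R q) = ((1 - t) * M + t * M') - ((1 - t) * c + t * m')\<^sup>2"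
        by (simp add: J_def M_def M'_def c_def m'_def add_divide_distrib)
      moreover have "J p = M - c\<^sup>2" by (simp add: J_def M_def c_def)
      ultimately have "((1 - t) * M + t * M') - ((1 - t) * c + t * m')\<^sup>2 \<le> M - c\<^sup>2"
        using p_max[OF inK] by simp
      then have "t * ((M' - M) - 2 * c * (m' - c)) \<le> t * (t * (m' - c)\<^sup>2)"
        by (simp add: power2_eq_square algebra_simps)
      then show "(M' - M) - 2 * c * (m' - c) \<le> t * (m' - c)\<^sup>2" using t by simp
    qed simp
    then show ?thesis by (simp add: M'_def m'_def power2_eq_square algebra_simps)
  qed
  have gx0: "g x0 \<le> F"
  proof -
    have "snd (snd (\<gamma> \<theta>0)) / \<theta>0 = (\<phi> x0)\<^sup>2" "fst (snd (\<gamma> \<theta>0)) / \<theta>0 = \<phi> x0"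
      using t0 by (auto simp: \<gamma>_def)
    with lin[OF \<gamma>K] show ?thesis unfolding g_def F_def power2_diff by (simp add: algebra_simps)
  qed
  \<comment> \<open>The linear condition tested on the law on \<open>{a, b}\<close> with mean
    \<open>x0\<close>. Its masses \<open>ma\<close>, \<open>mb\<close> turn into hull weights
    through the factor \<open>(1 + u) * \<theta>0\<close>, and these sum to 1 exactly because the
    mean is \<open>x0\<close>.\<close>
  have two: "g a * (b - x0) + g b * (x0 - a) \<le> F * (b - a)" if ab: "0 \<le> a" "a < x0" "x0 < b" for a b
  proof -
    define ma where "ma = (b - x0) / (b - a)"
    define mb where "mb = (x0 - a) / (b - a)"
    define wa where "wa = ma * (1 + a) * \<theta>0"
    define wb where "wb = mb * (1 + b) * \<theta>0"
    define q where "q = wa *\<^sub>R \<gamma> (1 / (1 + a)) + wb *\<^sub>R \<gamma> (1 / (1 + b))"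
    have m1: "ma + mb = 1" "ma * a + mb * b = x0" "0 \<le> ma" "0 \<le> mb" using ab
      by (auto simp: ma_def mb_def divide_simps) (auto simp: algebra_simps)
    have "wa + wb = (ma + mb + (ma * a + mb * b)) * \<theta>0"
      by (simp add: wa_def wb_def algebra_simps)
    then have w1: "wa + wb = 1" using x0 unfolding m1 by (simp add: \<theta>0_def)
    have w0: "0 \<le> wa" "0 \<le> wb" using m1 ab t0 by (auto simp: wa_def wb_def)
    have "q \<in> C" unfolding q_def
      by (rule convexD[OF C_convex _ _ w0 w1]) (use ab in \<open>auto intro!: \<gamma>C\<close>)
    have va: "v (1 / (1 + a)) = a" "v (1 / (1 + b)) = b" by (auto simp: v_def)
    have wa: "wa / (1 + a) = ma * \<theta>0" "wb / (1 + b) = mb * \<theta>0" using ab by (auto simp: wa_def wb_def)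
    have fq: "fst q = (ma + mb) * \<theta>0"
      unfolding q_def \<gamma>_def va by (simp add: wa algebra_simps)
    have sq: "fst (snd q) = (ma * \<phi> a + mb * \<phi> b) * \<theta>0"
      "snd (snd q) = (ma * (\<phi> a)\<^sup>2 + mb * (\<phi> b)\<^sup>2) * \<theta>0"
      using wa unfolding q_def \<gamma>_def va
      by (simp_all add: distrib_right) (simp_all add: mult.commute[of _ \<theta>0] mult.assoc flip: times_divide_eq_left)
    have "q \<in> K" using \<open>q \<in> C\<close> fq m1 by (auto simp: K_def)
    from lin[OF this] have "(ma * (\<phi> a)\<^sup>2 + mb * (\<phi> b)\<^sup>2) - 2 * c * (ma * \<phi> a + mb * \<phi> b) \<le> M - 2 * c\<^sup>2"
      using t0 by (simp add: sq)
    then have "ma * g a + mb * g b \<le> F + (ma + mb - 1) * c\<^sup>2"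
      unfolding g_def F_def power2_diff by (simp add: algebra_simps)
    then have "(ma * g a + mb * g b) * (b - a) \<le> F * (b - a)" using m1 ab by simp
    moreover have "ma * (b - a) = b - x0" "mb * (b - a) = x0 - a" using ab by (auto simp: ma_def mb_def)
    ultimately have "g a * (ma * (b - a)) + g b * (mb * (b - a)) \<le> F * (b - a)" by (simp add: algebra_simps)
    then show ?thesis by (simp add: \<open>ma * (b - a) = b - x0\<close> \<open>mb * (b - a) = x0 - a\<close>)
  qed
  \<comment> \<open>By \<open>two\<close>, every slope from \<open>(x0, F)\<close> to a graph point
    on the right is at most every slope on the left. The supremum of the right slopes thus gives a
    line through \<open>(x0, F)\<close> above the graph of \<open>g\<close>.\<close>
  define Sl where "Sl = (\<lambda>b. (g b - F) / (b - x0)) ` {x0<..}"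
  define B where "B = Sup Sl"
  have Sl_ub: "(g b - F) / (b - x0) \<le> (F - g a) / (x0 - a)" if "0 \<le> a" "a < x0" "x0 < b" for a b
    using two[OF that] that by (simp add: divide_simps) (simp add: algebra_simps)
  have bdd: "bdd_above Sl" unfolding Sl_def bdd_above_def using Sl_ub[of 0] x0 by auto
  have up1: "g b \<le> F + B * (b - x0)" if "x0 < b" for b
  proof -
    have "(g b - F) / (b - x0) \<le> B" unfolding B_def
      by (rule cSup_upper[OF _ bdd]) (use that in \<open>auto simp: Sl_def\<close>)
    then show ?thesis using that by (simp add: divide_simps)
  qed
  have up2: "g a \<le> F + B * (a - x0)" if "0 \<le> a" "a < x0" for a
  proof -
    have "B \<le> (F - g a) / (x0 - a)" unfolding B_def
      by (rule cSup_least) (use Sl_ub[of a] that in \<open>auto simp: Sl_def\<close>)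
    then show ?thesis using that by (simp add: divide_simps) (simp add: algebra_simps)
  qed
  define A where "A = F - B * x0"
  have up: "g u \<le> A + B * u" if "0 \<le> u" for u
    using up1[of u] up2[of u] gx0 that by (cases u x0 rule: linorder_cases) (auto simp: A_def algebra_simps)
  \<comment> \<open>A line of negative slope falls below 0 far out, but it lies above the square
    \<open>g\<close>.\<close>
  have B0: "0 \<le> B"
  proof (rule ccontr)
    assume "\<not> 0 \<le> B"
    then have neg: "B < 0" by simp
    define u where "u = max 0 (\<bar>A\<bar> / (- B) + 1)"
    have "\<bar>A\<bar> / (- B) < u" by (simp add: u_def)
    then have "\<bar>A\<bar> < (- B) * u" using neg by (subst (asm) pos_divide_less_eq) (auto simp: mult.commute)
    then have "A + B * u < 0" by simp
    with up[of u] have "g u < 0" by (simp add: u_def)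
    then show False by (simp add: g_def)
  qed
  \<comment> \<open>An explicit convex combination makes the maximizer a law with finitely many
    atoms \<open>U y\<close> of mass \<open>\<mu> y\<close>. Points with \<open>fst y = 0\<close>
    get mass 0; this is the escaped part, and because of it \<open>sumu\<close> below is at first
    only an inequality.\<close>
  obtain V w' where V: "finite V" "V \<subseteq> \<gamma> ` {0..1}" "\<And>y. y \<in> V \<Longrightarrow> 0 \<le> w' y" "sum w' V = 1"
    "(\<Sum>y\<in>V. w' y *\<^sub>R y) = p"
    using pK unfolding K_def C_def convex_hull_explicit by blast
  have V\<gamma>: "y = \<gamma> (fst y)" "0 \<le> fst y" "fst y \<le> 1" if "y \<in> V" for y
    using V(2) that by (auto simp: \<gamma>_def)
  define U where "U y = v (fst y)" for y :: "real \<times> real \<times> real"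
  define \<mu> where "\<mu> y = w' y * fst y / \<theta>0" for y :: "real \<times> real \<times> real"
  have \<mu>0: "0 \<le> \<mu> y" if "y \<in> V" for y using V(3)[OF that] V\<gamma>[OF that] t0 by (auto simp: \<mu>_def)
  have Unn: "0 \<le> U y" if "y \<in> V" "0 < \<mu> y" for y
  proof -
    have "fst y \<noteq> 0" using that(2) by (auto simp: \<mu>_def)
    then show ?thesis using V\<gamma>[OF that(1)] by (auto simp: U_def intro!: v_nn)
  qed
  have p_eq: "p = (\<Sum>y\<in>V. w' y *\<^sub>R \<gamma> (fst y))" using V(5) V\<gamma>(1) by (metis (no_types, lifting) sum.cong)
  have sum1: "(\<Sum>y\<in>V. \<mu> y) = 1"
  proof -
    have "fst p = (\<Sum>y\<in>V. w' y * fst y)" unfolding p_eq by (simp add: fst_sum \<gamma>_def)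
    then have "(\<Sum>y\<in>V. w' y * fst y) / \<theta>0 = 1" using pK t0 by (simp add: K_def)
    then show ?thesis by (simp add: \<mu>_def sum_divide_distrib)
  qed
  have sum\<phi>: "(\<Sum>y\<in>V. \<mu> y * \<phi> (U y)) = c"
    unfolding c_def p_eq by (simp add: fst_sum snd_sum \<gamma>_def \<mu>_def U_def sum_divide_distrib mult_ac)
  have sum\<phi>2: "(\<Sum>y\<in>V. \<mu> y * (\<phi> (U y))\<^sup>2) = M"
    unfolding M_def p_eq by (simp add: fst_sum snd_sum \<gamma>_def \<mu>_def U_def sum_divide_distrib mult_ac)
  have sumu: "(\<Sum>y\<in>V. \<mu> y * U y) \<le> x0"
  proof -
    have "\<mu> y * (1 + U y) \<le> w' y * (1 + x0)" if "y \<in> V" for y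
      using V(3)[OF that] x0 by (cases "fst y = 0") (auto simp: \<mu>_def U_def v_def \<theta>0_def)
    then have "(\<Sum>y\<in>V. \<mu> y * (1 + U y)) \<le> (\<Sum>y\<in>V. w' y * (1 + x0))" by (rule sum_mono)
    also have "\<dots> = 1 + x0" using V(4) by (simp flip: sum_distrib_right)
    finally show ?thesis using sum1 by (simp add: distrib_left sum.distrib)
  qed
  have sumg: "(\<Sum>y\<in>V. \<mu> y * g (U y)) = F"
  proof -
    have "(\<Sum>y\<in>V. \<mu> y * g (U y)) = (\<Sum>y\<in>V. \<mu> y * (\<phi> (U y))\<^sup>2 + c\<^sup>2 * \<mu> y - 2 * c * (\<mu> y * \<phi> (U y)))"
      by (rule sum.cong) (auto simp: g_def power2_diff algebra_simps)
    also have "\<dots> = M + c\<^sup>2 * 1 - 2 * c * c"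
      unfolding sum_subtractf sum.distrib sum_distrib_left[symmetric] sum\<phi> sum\<phi>2 sum1 ..
    finally show ?thesis by (simp add: F_def power2_eq_square)
  qed
  have tight: "(\<Sum>y\<in>V. \<mu> y * (A + B * U y - g (U y))) = B * ((\<Sum>y\<in>V. \<mu> y * U y) - x0)"
  proof -
    have "(\<Sum>y\<in>V. \<mu> y * (A + B * U y - g (U y)))
        = (\<Sum>y\<in>V. A * \<mu> y + B * (\<mu> y * U y) - \<mu> y * g (U y))"
      by (rule sum.cong) (auto simp: algebra_simps)
    also have "\<dots> = A * 1 + B * (\<Sum>y\<in>V. \<mu> y * U y) - F"
      unfolding sum_subtractf sum.distrib sum_distrib_left[symmetric] sumg sum1 ..
    finally show ?thesis by (simp add: A_def algebra_simps)
  qed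
  have tight_le: "(\<Sum>y\<in>V. \<mu> y * (A + B * U y - g (U y))) \<le> 0"
    unfolding tight using B0 sumu by (simp add: mult_nonneg_nonpos)
  \<comment> \<open>The gap between line and graph is nonnegative at the atoms, but its integral is
    \<open>B\<close> times a nonpositive number, so the gap vanishes at every atom.\<close>
  have contact: "g (U y) = A + B * U y" if "y \<in> V" "0 < \<mu> y" for y
    using sum_zero_if_weighted_nonneg[OF V(1) \<mu>0 _ tight_le that] up Unn by fastforce
  \<comment> \<open>As long as \<open>\<phi>\<close> stays at or below \<open>c\<close>,
    \<open>g\<close> strictly decreases while the line does not, so they can only meet at 0.\<close>
  have low: "U y = 0" if y: "y \<in> V" "0 < \<mu> y" "\<phi> (U y) \<le> c" for y
  proof (rule ccontr)
    assume "U y \<noteq> 0"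
    then have "0 < U y" using Unn y by fastforce
    then have "\<phi> 0 < \<phi> (U y)" by (intro strict_mono_onD[OF mono]) auto
    then have "g (U y) < g 0" unfolding g_def using y(3)
      by (simp add: power2_commute[of _ c]) (intro power_strict_mono, auto)
    moreover have "g 0 \<le> A" using up[of 0] by simp
    moreover have "A \<le> A + B * U y" using B0 \<open>0 < U y\<close> by simp
    ultimately show False using contact[OF y(1,2)] by simp
  qed
  \<comment> \<open>Not all atoms can exceed their mean. By \<open>low\<close> the atom found here
    sits at 0, so the intercept of the line is \<open>g 0\<close>.\<close>
  have "\<exists>y\<in>V. 0 < \<mu> y \<and> \<phi> (U y) \<le> c"
  proof (rule ccontr)
    assume "\<not> ?thesis"
    then have gt: "c < \<phi> (U y)" if "y \<in> V" "0 < \<mu> y" for y using that by force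
    have z: "(\<Sum>y\<in>V. \<mu> y * (\<phi> (U y) - c)) \<le> 0"
      using sum\<phi> sum1 by (simp add: right_diff_distrib sum_subtractf flip: sum_distrib_right)
    have "\<exists>y\<in>V. 0 < \<mu> y"
    proof (rule ccontr)
      assume "\<not> ?thesis"
      then have "(\<Sum>y\<in>V. \<mu> y) \<le> 0" by (intro sum_nonpos) force
      then show False using sum1 by simp
    qed
    then obtain y where y: "y \<in> V" "0 < \<mu> y" by blast
    have "\<phi> (U y) - c = 0"
      by (rule sum_zero_if_weighted_nonneg[OF V(1) \<mu>0 _ z y]) (use gt in force)+
    with gt[OF y] show False by simp
  qed
  then obtain y0 where y0: "y0 \<in> V" "0 < \<mu> y0" "\<phi> (U y0) \<le> c" by blast
  have U0: "U y0 = 0" using low y0 by blast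
  have Ag: "A = g 0" using contact[OF y0(1,2)] U0 by simp
  \<comment> \<open>With slope 0 every atom would maximize \<open>g\<close>. Beyond \<open>c\<close>
    the function \<open>g\<close> strictly increases and has no maximizer, so all mass would lie at
    0; then \<open>c = \<phi> 0\<close> and \<open>g\<close> would have maximum 0.\<close>
  have Bpos: "0 < B"
  proof (rule ccontr)
    assume "\<not> 0 < B"
    then have B: "B = 0" using B0 by simp
    have all0: "U y = 0" if y: "y \<in> V" "0 < \<mu> y" for y
    proof (rule ccontr)
      assume n: "U y \<noteq> 0"
      with low[OF y] have gt: "c < \<phi> (U y)" by force
      have "\<phi> (U y) < \<phi> (U y + 1)" using Unn[OF y] by (intro strict_mono_onD[OF mono]) auto
      with gt have "g (U y) < g (U y + 1)" unfolding g_def by (intro power_strict_mono) auto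
      with up[of "U y + 1"] Unn[OF y] contact[OF y] B show False by simp
    qed
    have "(\<Sum>y\<in>V. \<mu> y * \<phi> (U y)) = (\<Sum>y\<in>V. \<mu> y * \<phi> 0)"
      by (rule sum.cong) (use all0 \<mu>0 in \<open>force simp: less_le\<close>)+
    then have "c = \<phi> 0" using sum\<phi> sum1 by (simp flip: sum_distrib_right)
    then have "g 1 \<le> 0" using up[of 1] B Ag by (simp add: g_def)
    moreover have "\<phi> 0 < \<phi> 1" by (intro strict_mono_onD[OF mono]) auto
    ultimately show False using \<open>c = \<phi> 0\<close> by (simp add: g_def)
  qed
  \<comment> \<open>The other half of complementary slackness: a positive multiplier forces the
    constraint to be active, so no mass has escaped.\<close>
  have sumu_eq: "(\<Sum>y\<in>V. \<mu> y * U y) = x0"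
  proof -
    have "0 \<le> (\<Sum>y\<in>V. \<mu> y * (A + B * U y - g (U y)))"
    proof (rule sum_nonneg)
      fix y assume y: "y \<in> V"
      show "0 \<le> \<mu> y * (A + B * U y - g (U y))"
        using \<mu>0[OF y] up[of "U y"] Unn[OF y] by (cases "\<mu> y = 0") auto
    qed
    then have "0 \<le> (\<Sum>y\<in>V. \<mu> y * U y) - x0" unfolding tight using Bpos by (simp add: zero_le_mult_iff)
    with sumu show ?thesis by simp
  qed
  have ex_pos: "\<exists>y\<in>V. 0 < \<mu> y \<and> 0 < U y"
  proof (rule ccontr)
    assume "\<not> ?thesis"
    then have "\<mu> y * U y \<le> 0" if "y \<in> V" for y
      using that \<mu>0[OF that] by (cases "\<mu> y = 0") (auto simp: mult_le_0_iff not_less)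
    then have "(\<Sum>y\<in>V. \<mu> y * U y) \<le> 0" by (intro sum_nonpos) auto
    then show False using sumu_eq x0 by simp
  qed
  \<comment> \<open>For an atom beyond \<open>x0\<close>, the sign of \<open>h\<close> tells whether
    the law on 0 and that atom with mean \<open>x0\<close> gives \<open>\<phi>\<close> a mean below
    or above \<open>c\<close>. The average of \<open>h\<close> is 0 and \<open>h\<close> vanishes at
    0, so both signs, taken weakly, occur among the positive atoms.\<close>
  define h where "h y = (\<phi> (U y) - \<phi> 0) * x0 - (c - \<phi> 0) * U y" for y
  have sumh: "(\<Sum>y\<in>V. \<mu> y * h y) = 0"
  proof -
    have "(\<Sum>y\<in>V. \<mu> y * h y) = (\<Sum>y\<in>V. x0 * (\<mu> y * \<phi> (U y)) - (x0 * \<phi> 0) * \<mu> y - (c - \<phi> 0) * (\<mu> y * U y))"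
      by (rule sum.cong) (auto simp: h_def algebra_simps)
    also have "\<dots> = x0 * c - (x0 * \<phi> 0) * 1 - (c - \<phi> 0) * x0"
      unfolding sum_subtractf sum_distrib_left[symmetric] sum\<phi> sumu_eq sum1 ..
    finally show ?thesis by (simp add: algebra_simps)
  qed
  have "\<exists>y\<in>V. 0 < \<mu> y \<and> 0 < U y \<and> h y \<le> 0"
  proof (rule ccontr)
    assume n: "\<not> ?thesis"
    have nn: "0 \<le> h y" if "y \<in> V" "0 < \<mu> y" for y
      using n that Unn[OF that] by (cases "U y = 0") (auto simp: h_def not_le less_le)
    obtain y where y: "y \<in> V" "0 < \<mu> y" "0 < U y" using ex_pos by blast
    have "h y = 0" using sum_zero_if_weighted_nonneg[of V \<mu> h y] V(1) \<mu>0 nn sumh y by simp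
    with n y show False by auto
  qed
  then obtain y1 where y1: "y1 \<in> V" "0 < \<mu> y1" "0 < U y1" "h y1 \<le> 0" by blast
  have "\<exists>y\<in>V. 0 < \<mu> y \<and> 0 < U y \<and> - h y \<le> 0"
  proof (rule ccontr)
    assume n: "\<not> ?thesis"
    have nn: "0 \<le> - h y" if "y \<in> V" "0 < \<mu> y" for y
      using n that Unn[OF that] by (cases "U y = 0") (auto simp: h_def not_le less_le)
    obtain y where y: "y \<in> V" "0 < \<mu> y" "0 < U y" using ex_pos by blast
    have "- h y = 0" 
      using sum_zero_if_weighted_nonneg[of V \<mu> "\<lambda>y. - h y" y] V(1) \<mu>0 nn sumh y by (simp add: sum_negf)
    with n y show False by auto
  qed
  then obtain y2 where y2: "y2 \<in> V" "0 < \<mu> y2" "0 < U y2" "- h y2 \<le> 0" by blast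
  have "\<phi> 0 < \<phi> (U y1)" using y1 by (intro strict_mono_onD[OF mono]) auto
  then have "0 < (c - \<phi> 0) * U y1"
    using y1(4) x0 mult_pos_pos[of "\<phi> (U y1) - \<phi> 0" x0] unfolding h_def by linarith
  then have c0: "\<phi> 0 < c" using y1(3) by (simp add: zero_less_mult_iff)
  show ?thesis
    using that[of B c "U y1" "U y2"] Bpos up contact y1 y2 Ag c0
    by (simp add: g_def h_def)
qed


subsection \<open>Entry times and events of continuous paths\<close>


text \<open>A functional of a single path that covers hitting times, exit times and passage below a
  level alike; the infimum over no times is \<infinity>.\<close>

definition entry_time :: "ereal set \<Rightarrow> (real \<Rightarrow> ereal) \<Rightarrow> ennreal" where
  "entry_time K w = (INF t\<in>{t. 0 \<le> t \<and> w t \<in> K}. ennreal t)"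

lemma hit_time_eq: "hit_time X z \<omega> = entry_time {z} (\<lambda>t. X t \<omega>)"
  by (simp add: hit_time_def entry_time_def)

lemma inner_exit_time_eq: "inner_exit_time X a b \<omega> = entry_time (- {a<..<b}) (\<lambda>t. X t \<omega>)"
  by (simp add: inner_exit_time_def entry_time_def)

lemma entry_time_le: "0 \<le> t \<Longrightarrow> w t \<in> K \<Longrightarrow> entry_time K w \<le> ennreal t"
  unfolding entry_time_def by (rule INF_lower) auto

lemma entry_time_infinite: "(\<And>t. 0 \<le> t \<Longrightarrow> w t \<notin> K) \<Longrightarrow> entry_time K w = \<infinity>"
  unfolding entry_time_def by (subst arg_cong[where f = "\<lambda>A. Inf (ennreal ` A)" and y = "{}"]) auto

text \<open>The times spent in a closed set are closed by continuity, so a finite infimum is one of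
  them. Thus whether entry has occurred by time \<open>r\<close> is decided by the path up to
  \<open>r\<close>.\<close>

lemma entry_time_attained:
  assumes w: "continuous_on {0..} w" and K: "closed K" and fin: "entry_time K w < \<infinity>"
  obtains t where "0 \<le> t" "w t \<in> K" "entry_time K w = ennreal t" "\<And>s. 0 \<le> s \<Longrightarrow> s < t \<Longrightarrow> w s \<notin> K"
proof -
  define E where "E = {t. 0 \<le> t \<and> w t \<in> K}"
  have "E = {0..} \<inter> w -` K" by (auto simp: E_def)
  then have "closed E" using continuous_closed_preimage[OF w closed_atLeast K] by simp
  have "E \<noteq> {}"
  proof
    assume "E = {}"
    then have "entry_time K w = \<infinity>" by (intro entry_time_infinite) (auto simp: E_def)
    with fin show False by simp
  qed
  have bdd: "bdd_below E" unfolding bdd_below_def E_def by auto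
  define t where "t = Inf E"
  have "t \<in> E" unfolding t_def by (rule closed_contains_Inf) fact+
  moreover have le: "t \<le> s" if "s \<in> E" for s unfolding t_def using bdd that by (intro cInf_lower)
  moreover have "entry_time K w = ennreal t"
    unfolding entry_time_def E_def[symmetric]
    by (rule INF_eqI) (use le \<open>t \<in> E\<close> in \<open>auto intro!: ennreal_leI\<close>)
  ultimately show ?thesis using that[of t] unfolding E_def
    by (metis (mono_tags, lifting) mem_Collect_eq linorder_not_less)
qed

lemma entry_time_le_iff:
  assumes "continuous_on {0..} (w :: real \<Rightarrow> ereal)" "closed K" "0 \<le> r"
  shows "entry_time K w \<le> ennreal r \<longleftrightarrow> (\<exists>s\<in>{0..r}. w s \<in> K)"
proof
  assume le: "entry_time K w \<le> ennreal r"
  then have "entry_time K w < \<infinity>" using ennreal_less_top le_less_trans by (metis infinity_ennreal_def)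
  from entry_time_attained[OF assms(1,2) this] le assms(3) show "\<exists>s\<in>{0..r}. w s \<in> K"
    by (metis atLeastAtMost_iff ennreal_le_iff)
next
  assume "\<exists>s\<in>{0..r}. w s \<in> K"
  then show "entry_time K w \<le> ennreal r"
    by (meson atLeastAtMost_iff ennreal_leI entry_time_le order_trans)
qed

text \<open>
  Nonnegative rational times are written \<open>\<bar>of_rat q\<bar>\<close>, so that quantifiers over them range over the
  countable type \<open>rat\<close>.
\<close>

lemma closed_at_rationals:
  fixes w :: "real \<Rightarrow> 'b::t2_space"
  assumes w: "continuous_on {0..} w" and K: "closed K" and s: "0 \<le> s"
    and q: "\<And>q::rat. \<bar>of_rat q\<bar> \<le> s \<Longrightarrow> w \<bar>of_rat q\<bar> \<in> K"
  shows "w s \<in> K"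
proof -
  \<comment> \<open>Rational approximation from below, so that no time after \<open>s\<close> is
    inspected; adaptedness of the events below rests on this.\<close>
  define f where "f n = real_of_int \<lfloor>s * real (Suc n)\<rfloor> / real (Suc n)" for n
  have f: "0 \<le> f n" "f n \<le> s" "s - 1 / real (Suc n) \<le> f n" for n
  proof -
    have "real_of_int \<lfloor>s * real (Suc n)\<rfloor> \<le> s * real (Suc n)" by simp
    then show "f n \<le> s" unfolding f_def by (simp add: divide_le_eq)
    show "0 \<le> f n" unfolding f_def using s by simp
    have "s * real (Suc n) - 1 \<le> real_of_int \<lfloor>s * real (Suc n)\<rfloor>" by linarith
    then have "(s * real (Suc n) - 1) / real (Suc n) \<le> f n" unfolding f_def by (rule divide_right_mono) simp
    then show "s - 1 / real (Suc n) \<le> f n" by (simp add: diff_divide_distrib del: of_nat_Suc)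
  qed
  have rat: "f n = \<bar>of_rat (of_int \<lfloor>s * real (Suc n)\<rfloor> / of_nat (Suc n))\<bar>" for n
  proof -
    have "f n = of_rat (of_int \<lfloor>s * real (Suc n)\<rfloor> / of_nat (Suc n))"
      by (simp add: f_def of_rat_divide del: of_nat_Suc)
    then show ?thesis using f(1)[of n] by (metis abs_of_nonneg)
  qed
  have "(\<lambda>n. s - 1 / real (Suc n)) \<longlonglongrightarrow> s"
    using tendsto_diff[OF tendsto_const LIMSEQ_inverse_real_of_nat, of s] by (simp add: field_simps)
  then have "f \<longlonglongrightarrow> s"
    by (rule tendsto_sandwich[OF _ _ _ tendsto_const, rotated 2]) (use f in auto)
  then have "(\<lambda>n. w (f n)) \<longlonglongrightarrow> w s"
    by (rule continuous_on_tendsto_compose[OF w]) (use s f in auto)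
  moreover have "w (f n) \<in> K" for n using q f(2) unfolding rat .
  ultimately show ?thesis by (intro Lim_in_closed_set[OF K always_eventually]) auto
qed

text \<open>A rational level \<open>c\<close> between \<open>a\<close> and the minimum over the
  compact time interval turns the strict inequality into a closed one, and closed conditions pass
  from rational times to all times.\<close>

lemma above_iff_rational:
  fixes w :: "real \<Rightarrow> ereal" and r :: real
  assumes w: "continuous_on {0..} w" and r: "0 \<le> r"
  shows "(\<forall>s\<in>{0..r}. a < w s) \<longleftrightarrow>
    (\<exists>c::rat. a < ereal (of_rat c) \<and> (\<forall>q::rat. \<bar>of_rat q\<bar> \<le> r \<longrightarrow> ereal (of_rat c) \<le> w \<bar>of_rat q\<bar>))"
    (is "?L \<longleftrightarrow> ?R")
proof
  assume L: ?L
  have "continuous_on {0..r} w" by (rule continuous_on_subset[OF w]) auto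
  then obtain t where t: "t \<in> {0..r}" "\<And>s. s \<in> {0..r} \<Longrightarrow> w t \<le> w s"
    using continuous_attains_inf[of "{0..r}" w] r
    by (metis atLeastatMost_empty_iff2 compact_Icc linorder_not_less)
  obtain c where "a < ereal (of_rat c)" "ereal (of_rat c) < w t" using ereal_dense3[of a "w t"] L t(1) by auto
  then show ?R using t(2) by (intro exI[of _ c]) (auto simp del: abs_of_rat intro: order.trans[OF less_imp_le])
next
  assume ?R
  then obtain c :: rat where c: "a < ereal (of_rat c)"
    "\<And>q::rat. \<bar>of_rat q\<bar> \<le> r \<Longrightarrow> ereal (of_rat c) \<le> w \<bar>of_rat q\<bar>" by blast
  have "w s \<in> {ereal (of_rat c)..}" if "s \<in> {0..r}" for s
    by (rule closed_at_rationals[OF w]) (use that c(2) in auto)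
  then show ?L using c(1) by (auto intro: less_le_trans)
qed

text \<open>Measurability is asked for only up to time \<open>r\<close>, so that \<open>N\<close>
  may be the \<sigma>-algebra of the past at \<open>r\<close> as well as the full one.\<close>

lemma sets_Collect_above:
  fixes r :: real
  assumes "\<And>s. 0 \<le> s \<Longrightarrow> s \<le> r \<Longrightarrow> Y s \<in> N \<rightarrow>\<^sub>M (borel :: ereal measure)"
    and "\<And>\<omega>. \<omega> \<in> space N \<Longrightarrow> continuous_on {0..} (\<lambda>t. Y t \<omega>)"
  shows "{\<omega>\<in>space N. \<forall>s\<in>{0..r}. a < Y s \<omega>} \<in> sets N"
proof (cases "0 \<le> r")
  case True
  have "Measurable.pred N (\<lambda>\<omega>. \<exists>c::rat. a < ereal (of_rat c) \<and>
      (\<forall>q::rat. \<bar>of_rat q\<bar> \<le> r \<longrightarrow> ereal (of_rat c) \<le> Y \<bar>of_rat q\<bar> \<omega>))"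
  proof (intro pred_intros_countable pred_intros_conj1' pred_intros_imp')
    fix c q :: rat assume "\<bar>of_rat q\<bar> \<le> r"
    then have [measurable]: "Y \<bar>of_rat q\<bar> \<in> N \<rightarrow>\<^sub>M borel" by (intro assms(1)) auto
    show "Measurable.pred N (\<lambda>\<omega>. ereal (of_rat c) \<le> Y \<bar>of_rat q\<bar> \<omega>)" by measurable
  qed
  then have "{\<omega>\<in>space N. \<exists>c::rat. a < ereal (of_rat c) \<and>
      (\<forall>q::rat. \<bar>of_rat q\<bar> \<le> r \<longrightarrow> ereal (of_rat c) \<le> Y \<bar>of_rat q\<bar> \<omega>)} \<in> sets N"
    by (rule predE)
  also have "{\<omega>\<in>space N. \<exists>c::rat. a < ereal (of_rat c) \<and>
      (\<forall>q::rat. \<bar>of_rat q\<bar> \<le> r \<longrightarrow> ereal (of_rat c) \<le> Y \<bar>of_rat q\<bar> \<omega>)}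
      = {\<omega>\<in>space N. \<forall>s\<in>{0..r}. a < Y s \<omega>}"
    by (intro Collect_cong conj_cong refl) (simp only: above_iff_rational[OF assms(2) True])
  finally show ?thesis .
qed simp

lemma sets_Collect_below:
  fixes r :: real
  assumes "\<And>s. 0 \<le> s \<Longrightarrow> s \<le> r \<Longrightarrow> Y s \<in> N \<rightarrow>\<^sub>M (borel :: ereal measure)"
    and "\<And>\<omega>. \<omega> \<in> space N \<Longrightarrow> continuous_on {0..} (\<lambda>t. Y t \<omega>)"
  shows "{\<omega>\<in>space N. \<forall>s\<in>{0..r}. Y s \<omega> < b} \<in> sets N"
proof -
  have "{\<omega>\<in>space N. \<forall>s\<in>{0..r}. - b < - Y s \<omega>} \<in> sets N"
    using assms by (intro sets_Collect_above) (auto intro!: continuous_on_compose2[OF continuous_uminus_ereal])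
  then show ?thesis by (simp add: ereal_uminus_less_reorder)
qed

lemma sets_Collect_between:
  fixes r :: real
  assumes "\<And>s. 0 \<le> s \<Longrightarrow> s \<le> r \<Longrightarrow> Y s \<in> N \<rightarrow>\<^sub>M (borel :: ereal measure)"
    and "\<And>\<omega>. \<omega> \<in> space N \<Longrightarrow> continuous_on {0..} (\<lambda>t. Y t \<omega>)"
  shows "{\<omega>\<in>space N. \<forall>s\<in>{0..r}. Y s \<omega> \<in> {a<..<b}} \<in> sets N"
proof -
  have "{\<omega>\<in>space N. \<forall>s\<in>{0..r}. Y s \<omega> \<in> {a<..<b}} =
    {\<omega>\<in>space N. \<forall>s\<in>{0..r}. a < Y s \<omega>} \<inter> {\<omega>\<in>space N. \<forall>s\<in>{0..r}. Y s \<omega> < b}" by auto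
  then show ?thesis using sets_Collect_above[OF assms] sets_Collect_below[OF assms] by simp
qed

text \<open>Passage to \<open>b\<close> before \<open>a\<close>, in a form that compares no infima
  and is easy to shift in time. For paths bounded below, \<open>a = -\<infinity>\<close> removes the
  lower barrier.\<close>

definition reaches :: "ereal \<Rightarrow> real \<Rightarrow> (real \<Rightarrow> ereal) \<Rightarrow> bool" where
  "reaches a b w \<longleftrightarrow> (\<exists>s\<ge>0. ereal b \<le> w s \<and> (\<forall>u\<in>{0..s}. a < w u))"

text \<open>Unlike \<open>reaches\<close>, this is a measurable property of arbitrary, possibly discontinuous, paths.\<close>

definition reaches_rat :: "ereal \<Rightarrow> real \<Rightarrow> (real \<Rightarrow> ereal) \<Rightarrow> bool" where
  "reaches_rat a b w \<longleftrightarrow> (\<exists>(N::nat) (c::rat). a < ereal (of_rat c) \<and>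
    (\<forall>d::rat. of_rat d < b \<longrightarrow> (\<exists>q::rat. \<bar>of_rat q\<bar> \<le> real N \<and> ereal (of_rat d) \<le> w \<bar>of_rat q\<bar> \<and>
      (\<forall>r::rat. \<bar>of_rat r\<bar> \<le> (\<bar>of_rat q\<bar> :: real) \<longrightarrow> ereal (of_rat c) \<le> w \<bar>of_rat r\<bar>))))"

text \<open>The bound \<open>N\<close> supplies compactness: rational times at which the path comes
  ever closer to \<open>b\<close> from below accumulate at some \<open>s\<close>, where
  \<open>b\<close> is reached by continuity. The common level \<open>c\<close> keeps the path
  strictly above \<open>a\<close> up to and including \<open>s\<close>.\<close>

lemma reaches_iff_rational:
  assumes w: "continuous_on {0..} w"
  shows "reaches a b w \<longleftrightarrow> reaches_rat a b w"
proof
  assume "reaches a b w"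
  then obtain s where s: "0 \<le> s" "ereal b \<le> w s" "\<forall>u\<in>{0..s}. a < w u" by (auto simp: reaches_def)
  obtain N where N: "s \<le> real N" using real_arch_simple by blast
  obtain c :: rat where c: "a < ereal (of_rat c)"
    "\<And>q::rat. \<bar>of_rat q\<bar> \<le> s \<Longrightarrow> ereal (of_rat c) \<le> w \<bar>of_rat q\<bar>"
    using s(3) unfolding above_iff_rational[OF w s(1)] by blast
  have "\<exists>q::rat. \<bar>of_rat q\<bar> \<le> s \<and> ereal (of_rat d) \<le> w \<bar>of_rat q\<bar>" if d: "of_rat d < b" for d :: rat
  proof (rule ccontr)
    assume n: "\<not> ?thesis"
    have "w s \<in> {..ereal (of_rat d)}"
      by (rule closed_at_rationals[OF w])
        (use n s in \<open>auto simp: not_le simp del: abs_of_rat intro: less_imp_le dest: leD\<close>)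
    then have "ereal b \<le> ereal (of_rat d)" by (intro order.trans[OF s(2)]) simp
    with d show False by simp
  qed
  with N c show "reaches_rat a b w" unfolding reaches_rat_def by (intro exI[of _ N] exI[of _ c] conjI) (meson order_trans)+
next
  assume "reaches_rat a b w"
  then obtain N :: nat and c :: rat where c: "a < ereal (of_rat c)" and
    ex: "\<And>d::rat. of_rat d < b \<Longrightarrow> (\<exists>q::rat. \<bar>of_rat q\<bar> \<le> real N \<and> ereal (of_rat d) \<le> w \<bar>of_rat q\<bar> \<and>
      (\<forall>r::rat. \<bar>of_rat r\<bar> \<le> (\<bar>of_rat q\<bar> :: real) \<longrightarrow> ereal (of_rat c) \<le> w \<bar>of_rat r\<bar>))" unfolding reaches_rat_def by blast
  have "\<exists>q::rat. \<bar>of_rat q\<bar> \<le> real N \<and> ereal (b - 1 / real (Suc n)) \<le> w \<bar>of_rat q\<bar> \<and>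
      (\<forall>r::rat. \<bar>of_rat r\<bar> \<le> (\<bar>of_rat q\<bar> :: real) \<longrightarrow> ereal (of_rat c) \<le> w \<bar>of_rat r\<bar>)" for n
  proof -
    have "b - 1 / real (Suc n) < b" by simp
    then obtain d :: rat where d: "b - 1 / real (Suc n) < of_rat d" "of_rat d < b" using of_rat_dense by blast
    then have "ereal (b - 1 / real (Suc n)) \<le> ereal (of_rat d)" by simp
    with ex[OF d(2)] show ?thesis by (meson order_trans)
  qed
  then obtain q :: "nat \<Rightarrow> rat" where q: "\<And>n. \<bar>of_rat (q n)\<bar> \<le> real N"
    "\<And>n. ereal (b - 1 / real (Suc n)) \<le> w \<bar>of_rat (q n)\<bar>"
    "\<And>n r. \<bar>of_rat r\<bar> \<le> (\<bar>of_rat (q n)\<bar> :: real) \<Longrightarrow> ereal (of_rat c) \<le> w \<bar>of_rat r\<bar>" by metis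
  define Q :: "nat \<Rightarrow> real" where "Q n = \<bar>of_rat (q n)\<bar>" for n
  have below: "ereal (of_rat c) \<le> w u" if "0 \<le> u" "u \<le> Q n" for u n
  proof -
    have "w u \<in> {ereal (of_rat c)..}"
      by (rule closed_at_rationals[OF w]) (use that q(3)[of _ n] in \<open>auto simp: Q_def\<close>)
    then show ?thesis by simp
  qed
  have "compact {0..real N}" by simp
  moreover have Q: "Q n \<in> {0..real N}" for n using q(1) by (simp add: Q_def)
  ultimately obtain s r where s: "s \<in> {0..real N}" and r: "strict_mono (r :: nat \<Rightarrow> nat)" and lim: "(Q \<circ> r) \<longlonglongrightarrow> s"
    unfolding compact_def by blast
  have wlim: "(\<lambda>n. w (Q (r n))) \<longlonglongrightarrow> w s"
    by (rule continuous_on_tendsto_compose[OF w lim[unfolded o_def]]) (use s Q in auto)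
  have "(\<lambda>n. b - 1 / real (Suc n)) \<longlonglongrightarrow> b"
    using tendsto_diff[OF tendsto_const LIMSEQ_inverse_real_of_nat, of b] by (simp add: field_simps)
  then have "(\<lambda>n. ereal (b - 1 / real (Suc n))) \<longlonglongrightarrow> ereal b" by simp
  from LIMSEQ_subseq_LIMSEQ[OF this r]
  have "(\<lambda>n. ereal (b - 1 / real (Suc (r n)))) \<longlonglongrightarrow> ereal b" by (simp add: o_def)
  from LIMSEQ_le[OF this wlim] q(2) have 1: "ereal b \<le> w s" by (auto simp: Q_def)
  have 2: "ereal (of_rat c) \<le> w u" if "u \<in> {0..s}" for u
  proof (cases "u = s")
    case True
    show ?thesis unfolding True
    proof (rule LIMSEQ_le_const[OF wlim], intro exI allI impI)
      show "ereal (of_rat c) \<le> w (Q (r n))" for n using below[of "Q (r n)" "r n"] Q[of "r n"] by simp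
    qed
  next
    case False
    with that have "u < s" by simp
    from order_tendstoD(1)[OF lim this] have "\<forall>\<^sub>F n in sequentially. u < Q (r n)" by simp
    then obtain n where "u < Q (r n)" by (meson eventually_sequentially order_refl)
    then show ?thesis using that by (intro below[of u "r n"]) auto
  qed
  have "a < w u" if "u \<in> {0..s}" for u using c 2[OF that] by (rule less_le_trans)
  then show "reaches a b w" unfolding reaches_def using 1 s by (intro exI[of _ s]) auto
qed

lemma sets_Collect_reaches_rat:
  assumes "\<And>s. 0 \<le> s \<Longrightarrow> Y s \<in> N \<rightarrow>\<^sub>M (borel :: ereal measure)"
  shows "{\<omega>\<in>space N. reaches_rat a b (\<lambda>t. Y t \<omega>)} \<in> sets N"
proof -
  have [measurable]: "Y \<bar>of_rat q\<bar> \<in> N \<rightarrow>\<^sub>M borel" for q :: rat by (rule assms(1)) simp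
  have "Measurable.pred N (\<lambda>\<omega>. ereal (of_rat c) \<le> Y \<bar>of_rat q\<bar> \<omega>)" for c q :: rat by measurable
  then have "Measurable.pred N (\<lambda>\<omega>. reaches_rat a b (\<lambda>t. Y t \<omega>))"
    unfolding reaches_rat_def
    by (intro pred_intros_countable pred_intros_conj1' pred_intros_imp' pred_intros_logic(3))
  then show ?thesis by (rule predE)
qed

lemma sets_Collect_reaches:
  assumes "\<And>s. 0 \<le> s \<Longrightarrow> Y s \<in> N \<rightarrow>\<^sub>M (borel :: ereal measure)"
    and "\<And>\<omega>. \<omega> \<in> space N \<Longrightarrow> continuous_on {0..} (\<lambda>t. Y t \<omega>)"
  shows "{\<omega>\<in>space N. reaches a b (\<lambda>t. Y t \<omega>)} \<in> sets N"
proof -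
  have "{\<omega>\<in>space N. reaches a b (\<lambda>t. Y t \<omega>)} = {\<omega>\<in>space N. reaches_rat a b (\<lambda>t. Y t \<omega>)}"
    by (intro Collect_cong conj_cong refl) (simp only: reaches_iff_rational[OF assms(2)])
  then show ?thesis using sets_Collect_reaches_rat[OF assms(1)] by simp
qed

text \<open>Both directions are the intermediate value theorem. This links the hitting time event in
  the assumption on the scale function with the event that is shown to be measurable and used with
  shifted paths.\<close>

lemma hits_first_iff_reaches:
  assumes w: "continuous_on {0..} w" and ab: "ereal a < w 0" "w 0 < ereal b"
  shows "entry_time {ereal b} w < entry_time {ereal a} w \<longleftrightarrow> reaches (ereal a) b w"
proof
  assume lt: "entry_time {ereal b} w < entry_time {ereal a} w"
  then have "entry_time {ereal b} w < \<infinity>" by (simp add: top.not_eq_extremum order_less_le_trans)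
  then obtain t where t: "0 \<le> t" "w t = ereal b" "entry_time {ereal b} w = ennreal t"
    by (rule entry_time_attained[OF w closed_singleton]) auto
  have "ereal a < w u" if u: "u \<in> {0..t}" for u
  proof (rule ccontr)
    assume "\<not> ereal a < w u"
    moreover have "continuous_on {0..u} w" by (rule continuous_on_subset[OF w]) auto
    ultimately obtain u' where "0 \<le> u'" "u' \<le> u" "w u' = ereal a"
      using IVT2'[of w u "ereal a" 0] less_imp_le[OF ab(1)] u by (auto simp: not_less)
    then have "entry_time {ereal a} w \<le> ennreal t"
      using entry_time_le[of u' w "{ereal a}"] u by (auto intro: order_trans ennreal_leI)
    with lt t(3) show False by simp
  qed
  with t show "reaches (ereal a) b w" unfolding reaches_def by (intro exI[of _ t]) auto
next
  assume "reaches (ereal a) b w"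
  then obtain s where s: "0 \<le> s" "ereal b \<le> w s" "\<And>u. 0 \<le> u \<Longrightarrow> u \<le> s \<Longrightarrow> ereal a < w u"
    by (auto simp: reaches_def)
  have "continuous_on {0..s} w" by (rule continuous_on_subset[OF w]) auto
  then obtain s' where s': "0 \<le> s'" "s' \<le> s" "w s' = ereal b"
    using IVT'[of w 0 "ereal b" s] less_imp_le[OF ab(2)] s(1,2) by blast
  have le: "entry_time {ereal b} w \<le> ennreal s'" using s' by (intro entry_time_le) auto
  show "entry_time {ereal b} w < entry_time {ereal a} w"
  proof (cases "entry_time {ereal a} w = \<infinity>")
    case True
    with le show ?thesis by (simp add: le_less_trans)
  next
    case False
    then have "entry_time {ereal a} w < \<infinity>" by (simp add: top.not_eq_extremum)
    then obtain t where t: "0 \<le> t" "w t = ereal a" "entry_time {ereal a} w = ennreal t"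
      by (rule entry_time_attained[OF w closed_singleton]) auto
    have "s < t"
    proof (rule ccontr)
      assume "\<not> s < t"
      then have "ereal a < w t" using t(1) by (intro s(3)) auto
      with t(2) show False by simp
    qed
    then show ?thesis unfolding t(3)
      by (intro le_less_trans[OF le]) (use s' in \<open>simp add: ennreal_less_iff\<close>)
  qed
qed

lemma Limsup_at_top_rational:
  fixes w :: "real \<Rightarrow> ereal"
  assumes w: "continuous_on {0..} w"
  shows "Limsup at_top w = (INF n::nat. SUP q::rat. w (real n + \<bar>of_rat q\<bar>))"
proof (rule antisym)
  show "Limsup at_top w \<le> (INF n::nat. SUP q::rat. w (real n + \<bar>of_rat q\<bar>))"
  proof (rule INF_greatest)
    fix n :: nat
    have "w t \<le> (SUP q::rat. w (real n + \<bar>of_rat q\<bar>))" if "real n \<le> t" for t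
    proof -
      have "continuous_on {0..} (\<lambda>s. w (real n + s))"
        by (rule continuous_on_compose2[OF w]) (auto intro!: continuous_intros)
      then have "w (real n + (t - real n)) \<in> {..(SUP q::rat. w (real n + \<bar>of_rat q\<bar>))}"
        by (rule closed_at_rationals) (use that in \<open>auto intro: SUP_upper\<close>)
      then show ?thesis by simp
    qed
    then show "Limsup at_top w \<le> (SUP q::rat. w (real n + \<bar>of_rat q\<bar>))"
      by (intro Limsup_bounded eventually_at_top_linorderI)
  qed
  show "(INF n::nat. SUP q::rat. w (real n + \<bar>of_rat q\<bar>)) \<le> Limsup at_top w"
  proof (rule dense_ge)
    fix y assume "Limsup at_top w < y"
    then have "\<forall>\<^sub>F t in at_top. w t < y" by (rule Limsup_lessD)
    then obtain T where T: "\<And>t. T \<le> t \<Longrightarrow> w t < y" by (auto simp: eventually_at_top_linorder)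
    obtain n where "T \<le> real n" using real_arch_simple by blast
    then have "(SUP q::rat. w (real n + \<bar>of_rat q\<bar>)) \<le> y"
      by - (rule SUP_least, rule less_imp_le, rule T, simp add: add_increasing2)
    then show "(INF n::nat. SUP q::rat. w (real n + \<bar>of_rat q\<bar>)) \<le> y" by (rule INF_lower2[OF UNIV_I])
  qed
qed

section \<open>Dyadic rounding of random times and measurability of stopped values\<close>

definition grid_time :: "nat \<Rightarrow> real \<Rightarrow> real" where
  "grid_time n t = real (nat \<lceil>t * 2 ^ n\<rceil>) / 2 ^ n"

lemma grid_time_nonneg: "0 \<le> grid_time n t"
  by (simp add: grid_time_def)

text \<open>The equivalence is due to rounding up: at a grid point it is already known whether the
  rounded time has passed.\<close>

lemma grid_time_le_iff: "grid_time n t \<le> real k / 2 ^ n \<longleftrightarrow> t \<le> real k / 2 ^ n"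
proof -
  have "nat \<lceil>t * 2 ^ n\<rceil> \<le> k \<longleftrightarrow> \<lceil>t * 2 ^ n\<rceil> \<le> of_nat k" by (simp add: nat_le_iff)
  also have "\<dots> \<longleftrightarrow> t * 2 ^ n \<le> real k" by (simp add: ceiling_le_iff)
  finally show ?thesis by (simp add: grid_time_def divide_le_cancel pos_le_divide_eq)
qed

lemma grid_time_tendsto:
  assumes "0 \<le> t"
  shows "(\<lambda>n. grid_time n t) \<longlonglongrightarrow> t"
proof (rule tendsto_sandwich[OF _ _ tendsto_const])
  have "0 \<le> \<lceil>t * 2 ^ n\<rceil>" for n
    using assms by (metis ceiling_mono ceiling_zero mult_nonneg_nonneg zero_le_numeral zero_le_power)
  then have e: "grid_time n t = real_of_int \<lceil>t * 2 ^ n\<rceil> / 2 ^ n" for n by (simp add: grid_time_def)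
  show "\<forall>\<^sub>F n in sequentially. t \<le> grid_time n t" unfolding e by (simp add: pos_le_divide_eq)
  show "\<forall>\<^sub>F n in sequentially. grid_time n t \<le> t + (1 / 2) ^ n"
  proof (rule always_eventually, rule allI)
    fix n
    have "real_of_int \<lceil>t * 2 ^ n\<rceil> \<le> t * 2 ^ n + 1" by linarith
    then show "grid_time n t \<le> t + (1 / 2) ^ n" unfolding e by (simp add: field_simps)
  qed
  show "(\<lambda>n. t + (1 / 2) ^ n) \<longlonglongrightarrow> t"
    using tendsto_add[OF tendsto_const LIMSEQ_power_zero[of "1/2 :: real"], of t] by simp
qed

lemma measurable_grid_stopped:
  assumes Y: "\<And>s. 0 \<le> s \<Longrightarrow> Y s \<in> N \<rightarrow>\<^sub>M (borel :: ereal measure)" and T: "T \<in> N \<rightarrow>\<^sub>M (borel :: real measure)"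
  shows "(\<lambda>\<omega>. Y (grid_time n (T \<omega>)) \<omega>) \<in> N \<rightarrow>\<^sub>M borel"
  unfolding grid_time_def
  by (rule measurable_compose_countable[where f = "\<lambda>k \<omega>. Y (real k / 2 ^ n) \<omega>" and g = "\<lambda>\<omega>. nat \<lceil>T \<omega> * 2 ^ n\<rceil>"])
     (use T in \<open>measurable, auto intro: Y\<close>)

lemma measurable_stopped:
  assumes Y: "\<And>s. 0 \<le> s \<Longrightarrow> Y s \<in> N \<rightarrow>\<^sub>M (borel :: ereal measure)"
    and c: "\<And>\<omega>. \<omega> \<in> space N \<Longrightarrow> continuous_on {0..} (\<lambda>t. Y t \<omega>)"
    and \<tau>: "\<tau> \<in> N \<rightarrow>\<^sub>M borel"
  shows "stopped Y \<tau> \<in> N \<rightarrow>\<^sub>M borel"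
proof -
  define Z where "Z \<omega> = (if \<tau> \<omega> = \<infinity> then (INF n::nat. SUP q::rat. Y (real n + \<bar>of_rat q\<bar>) \<omega>)
    else limsup (\<lambda>n. Y (grid_time n (enn2real (\<tau> \<omega>))) \<omega>))" for \<omega>
  have "(\<lambda>\<omega>. Y (grid_time n (enn2real (\<tau> \<omega>))) \<omega>) \<in> N \<rightarrow>\<^sub>M borel" for n
    by (rule measurable_grid_stopped[OF Y]) (use \<tau> in auto)
  moreover have "Y (real n + \<bar>of_rat q\<bar>) \<in> N \<rightarrow>\<^sub>M borel" for n :: nat and q :: rat by (rule Y) simp
  ultimately have "Z \<in> N \<rightarrow>\<^sub>M borel" unfolding Z_def using \<tau>
    by (intro measurable_If borel_measurable_INF borel_measurable_SUP borel_measurable_limsup)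
       (auto simp: pred_def[symmetric])
  moreover have "Z \<omega> = stopped Y \<tau> \<omega>" if "\<omega> \<in> space N" for \<omega>
  proof (cases "\<tau> \<omega> = \<infinity>")
    case True
    then show ?thesis using Limsup_at_top_rational[OF c[OF that]] by (simp add: Z_def stopped_def)
  next
    case False
    have "(\<lambda>n. Y (grid_time n (enn2real (\<tau> \<omega>))) \<omega>) \<longlonglongrightarrow> Y (enn2real (\<tau> \<omega>)) \<omega>"
      by (rule continuous_on_tendsto_compose[OF c[OF that] grid_time_tendsto])
         (auto simp: grid_time_nonneg)
    then show ?thesis using False by (simp add: Z_def stopped_def lim_imp_Limsup)
  qed
  ultimately show ?thesis by (simp cong: measurable_cong)
qed

lemma at_right_ereal_neq_bot: "x < y \<Longrightarrow> at_right (x :: ereal) \<noteq> bot"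
  by (auto simp: trivial_limit_def eventually_at_right dest: dense)

lemma at_left_ereal_neq_bot: "y < x \<Longrightarrow> at_left (x :: ereal) \<noteq> bot"
  by (auto simp: trivial_limit_def eventually_at_left dest: dense)

lemma interior_states_convex:
  "y \<in> interior_states \<alpha> \<beta> \<Longrightarrow> z \<in> interior_states \<alpha> \<beta> \<Longrightarrow> y \<le> u \<Longrightarrow> u \<le> z \<Longrightarrow> u \<in> interior_states \<alpha> \<beta>"
  unfolding interior_states_def
  by (auto intro: less_le_trans[of \<alpha> "ereal y" "ereal u"] le_less_trans[of "ereal u" "ereal z" \<beta>])

text \<open>Otherwise the simplifier rewrites the index \<open>\<infinity>\<close> of the filtrations to \<open>top\<close>.\<close>

declare infinity_ennreal_def [simp del]

lemma ennreal_le_infinity [simp]: "(t :: ennreal) \<le> \<infinity>"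
  by (simp add: infinity_ennreal_def)

lemma ennreal_less_infinity [simp]: "ennreal t < \<infinity>"
  by (simp add: infinity_ennreal_def)

context linear_diffusion
begin

abbreviation I :: "real set" where "I \<equiv> interior_states \<alpha> \<beta>"

abbreviation reach :: "ereal \<Rightarrow> real \<Rightarrow> 'a set" where
  "reach a b \<equiv> {\<omega>\<in>space M. reaches a b (\<lambda>t. X t \<omega>)}"

abbreviation G :: "ennreal \<Rightarrow> 'a measure" where "G \<equiv> randomized_filtration M X U"

abbreviation F :: "ennreal \<Rightarrow> 'a measure" where "F \<equiv> natural_filtration M X"

lemma I_D: "y \<in> I \<Longrightarrow> \<alpha> < ereal y" "y \<in> I \<Longrightarrow> ereal y < \<beta>"
  by (auto simp: interior_states_def)

lemma sets_P [simp]: "y \<in> I \<Longrightarrow> sets (P y) = sets M"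
  using prob[of y] by (simp add: space_prob_algebra)

lemma space_P [simp]: "y \<in> I \<Longrightarrow> space (P y) = space M"
  using sets_P by (rule sets_eq_imp_space_eq)

lemma prob_space_P: "y \<in> I \<Longrightarrow> prob_space (P y)"
  using prob[of y] by (simp add: space_prob_algebra)

lemma S_less: "y \<in> I \<Longrightarrow> z \<in> I \<Longrightarrow> y < z \<Longrightarrow> S y < S z"
  by (rule strict_mono_onD[OF scale_mono])

lemma S_le_iff: "y \<in> I \<Longrightarrow> z \<in> I \<Longrightarrow> S y \<le> S z \<longleftrightarrow> y \<le> z"
  by (rule strict_mono_on_less_eq[OF scale_mono])

lemma I_openness: "y \<in> I \<Longrightarrow> \<exists>z\<in>I. y < z" "y \<in> I \<Longrightarrow> \<exists>z\<in>I. z < y"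
proof -
  assume y: "y \<in> I"
  obtain z where "ereal y < ereal z" "ereal z < \<beta>" using ereal_dense2[OF I_D(2)[OF y]] by blast
  then show "\<exists>z\<in>I. y < z" using I_D[OF y]
    by (intro bexI[of _ z]) (auto simp: interior_states_def intro: less_trans[of \<alpha> "ereal y" "ereal z"])
  obtain z where "\<alpha> < ereal z" "ereal z < ereal y" using ereal_dense2[OF I_D(1)[OF y]] by blast
  then show "\<exists>z\<in>I. z < y" using I_D[OF y]
    by (intro bexI[of _ z]) (auto simp: interior_states_def intro: less_trans[of "ereal z" "ereal y" \<beta>])
qed

lemma X_interior: "\<alpha> < X t \<omega> \<Longrightarrow> X t \<omega> < \<beta> \<Longrightarrow> real_of_ereal (X t \<omega>) \<in> I \<and> ereal (real_of_ereal (X t \<omega>)) = X t \<omega>"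
  by (cases "X t \<omega>") (auto simp: interior_states_def)

subsection \<open>The filtrations\<close>

lemma natural_generator: "{X s -` A \<inter> space M | s A. 0 \<le> s \<and> ennreal s \<le> t \<and> A \<in> sets borel} \<subseteq> sets M"
  using measurable_X by (auto intro: measurable_sets)

lemma randomized_generator: "{U -` A \<inter> space M | A. A \<in> sets borel} \<subseteq> sets M"
  using measurable_U by (auto intro: measurable_sets)

lemma space_F [simp]: "space (F t) = space M"
  by (simp add: natural_filtration_def space_measure_of_conv)

lemma space_G [simp]: "space (G t) = space M"
  by (simp add: randomized_filtration_def space_measure_of_conv)

lemma sets_F: "sets (F t) = sigma_sets (space M) {X s -` A \<inter> space M | s A. 0 \<le> s \<and> ennreal s \<le> t \<and> A \<in> sets borel}"
  unfolding natural_filtration_def by (rule sets_measure_of) auto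

lemma sets_G: "sets (G t) = sigma_sets (space M) ({U -` A \<inter> space M | A. A \<in> sets borel} \<union>
        {X s -` A \<inter> space M | s A. 0 \<le> s \<and> ennreal s \<le> t \<and> A \<in> sets borel})"
  unfolding randomized_filtration_def by (rule sets_measure_of) auto

lemma F_le_G: "sets (F t) \<subseteq> sets (G t)"
  unfolding sets_F sets_G by (rule sigma_sets_mono') auto

lemma G_le_M: "sets (G t) \<subseteq> sets M"
  unfolding sets_G using natural_generator[of t] randomized_generator
  by (intro sets.sigma_sets_subset) auto

lemma F_le_M: "sets (F t) \<subseteq> sets M"
  using F_le_G G_le_M by blast

sublocale F: filtration "space M" F
proof
  show "i \<le> j \<Longrightarrow> sets (F i) \<subseteq> sets (F j)" for i j
    unfolding sets_F by (rule sigma_sets_mono') (auto intro: order_trans)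
qed simp

lemma G_mono: "i \<le> j \<Longrightarrow> sets (G i) \<subseteq> sets (G j)"
  unfolding sets_G by (intro sigma_sets_mono' Un_mono order_refl) (blast intro: order_trans)

lemma X_measurable_F: "0 \<le> s \<Longrightarrow> ennreal s \<le> t \<Longrightarrow> X s \<in> F t \<rightarrow>\<^sub>M borel"
  by (rule measurableI) (auto simp: sets_F)

lemma X_measurable_G: "0 \<le> s \<Longrightarrow> ennreal s \<le> t \<Longrightarrow> X s \<in> G t \<rightarrow>\<^sub>M borel"
  using X_measurable_F measurable_mono[of borel borel "F t" "G t"] F_le_G by auto

lemma U_in_G: "A \<in> sets borel \<Longrightarrow> U -` A \<inter> space M \<in> sets (G t)"
  unfolding sets_G by (rule sigma_sets.Basic) blast

lemma stopping_time_F_imp_G: "stopping_time F T \<Longrightarrow> stopping_time G T"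
  using F_le_G unfolding stopping_time_def pred_def by auto

lemma stopping_time_measurable_F: "stopping_time F T \<Longrightarrow> T \<in> F \<infinity> \<rightarrow>\<^sub>M borel"
  by (rule measurable_stopping_time[of F T]) (use F.sets_F_mono[of _ \<infinity>] in auto)

lemma stopping_time_measurable_G: "stopping_time G T \<Longrightarrow> T \<in> M \<rightarrow>\<^sub>M borel"
  by (rule measurable_stopping_time[of G T]) (use G_le_M in auto)

lemma stopped_measurable_F: "stopping_time F T \<Longrightarrow> stopped X T \<in> F \<infinity> \<rightarrow>\<^sub>M borel"
  by (rule measurable_stopped[OF X_measurable_F continuous_paths stopping_time_measurable_F]) auto

lemma stopped_measurable_M: "stopping_time G T \<Longrightarrow> stopped X T \<in> M \<rightarrow>\<^sub>M borel"
  by (rule measurable_stopped) (auto intro: measurable_X continuous_paths stopping_time_measurable_G)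

section \<open>Events of the shifted path\<close>

lemma path_from_apply: "0 \<le> s \<Longrightarrow> path_from X t \<omega> s = X (t + s) \<omega>"
  by (simp add: path_from_def)

lemma path_from_measurable_F: "0 \<le> t \<Longrightarrow> path_from X t \<in> F \<infinity> \<rightarrow>\<^sub>M path_space"
  unfolding path_from_def path_space_def by (rule measurable_restrict) (auto intro!: X_measurable_F)

lemma path_from_measurable: "0 \<le> t \<Longrightarrow> path_from X t \<in> M \<rightarrow>\<^sub>M path_space"
  unfolding path_from_def path_space_def by (rule measurable_restrict) (auto intro!: measurable_X)

lemma reaches_cong: "(\<And>s. 0 \<le> s \<Longrightarrow> w s = w' s) \<Longrightarrow> reaches a b w \<longleftrightarrow> reaches a b w'"
  by (auto simp: reaches_def)

lemma reaches_path_from: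
  assumes "\<omega> \<in> space M" "0 \<le> t"
  shows "reaches_rat a b (path_from X t \<omega>) \<longleftrightarrow> reaches a b (\<lambda>s. X (t + s) \<omega>)"
proof -
  have c: "continuous_on {0..} (\<lambda>s. X (t + s) \<omega>)"
    by (rule continuous_on_compose2[OF continuous_paths[OF assms(1)]]) (use assms(2) in \<open>auto intro!: continuous_intros\<close>)
  have "continuous_on {0..} (path_from X t \<omega>)"
    using c by (rule continuous_on_cong[THEN iffD1, rotated 2]) (auto simp: path_from_apply)
  then have "reaches_rat a b (path_from X t \<omega>) \<longleftrightarrow> reaches a b (path_from X t \<omega>)"
    by (simp add: reaches_iff_rational)
  also have "\<dots> \<longleftrightarrow> reaches a b (\<lambda>s. X (t + s) \<omega>)"
    by (rule reaches_cong) (simp add: path_from_apply)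
  finally show ?thesis .
qed

text \<open>The Markov property accepts only events of the product \<sigma>-algebra, whose space
  contains discontinuous paths; hence the rational form. On paths of \<open>X\<close> it agrees with
  \<open>reaches\<close>.\<close>

definition reaching_paths :: "ereal \<Rightarrow> real \<Rightarrow> (real \<Rightarrow> ereal) set" where
  "reaching_paths a b = {w\<in>space path_space. reaches_rat a b w}"

lemma reaching_paths_sets: "reaching_paths a b \<in> sets path_space"
  unfolding reaching_paths_def
  by (rule sets_Collect_reaches_rat) (auto simp: path_space_def intro: measurable_component_singleton)

lemma path_from_reaching:
  assumes "\<omega> \<in> space M" "0 \<le> t"
  shows "path_from X t \<omega> \<in> reaching_paths a b \<longleftrightarrow> reaches a b (\<lambda>s. X (t + s) \<omega>)"
  using reaches_path_from[OF assms] measurable_space[OF path_from_measurable[OF assms(2)] assms(1)]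
  by (simp add: reaching_paths_def)

lemma reaches_event: "reach a b \<in> sets M"
  by (rule sets_Collect_reaches) (auto intro: measurable_X continuous_paths)

lemma path_law_reaching:
  assumes "y \<in> I"
  shows "emeasure (path_law P X y) (reaching_paths a b) = emeasure (P y) (reach a b)"
proof -
  have m: "path_from X 0 \<in> P y \<rightarrow>\<^sub>M path_space"
    using path_from_measurable[of 0] assms by (simp cong: measurable_cong_sets)
  have "emeasure (path_law P X y) (reaching_paths a b) = emeasure (P y) (path_from X 0 -` reaching_paths a b \<inter> space (P y))"
    unfolding path_law_def by (rule emeasure_distr[OF m reaching_paths_sets])
  also have "path_from X 0 -` reaching_paths a b \<inter> space (P y) = reach a b"
    using assms path_from_reaching[of _ 0 a b] by auto
  finally show ?thesis .
qed

text \<open>The kernel is measurable on interior states only. The indicator extends it by 0 to all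
  extended reals, where the values of \<open>X\<close> live.\<close>

lemma path_law_measurable:
  assumes "B \<in> sets path_space"
  shows "(\<lambda>v. indicator {\<alpha><..<\<beta>} v * emeasure (path_law P X (real_of_ereal v)) B) \<in> borel_measurable borel"
proof -
  have "(\<lambda>y. emeasure (path_law P X y) B) \<in> borel_measurable (restrict_space borel I)"
    using measurable_emeasure_kernel[OF measurable_prob_algebraD[OF kernel] assms] .
  moreover have "I \<in> sets borel"
  proof -
    have "I = {y. \<alpha> < ereal y} \<inter> {y. ereal y < \<beta>}" by (auto simp: interior_states_def)
    also have "\<dots> \<in> sets borel" by measurable
    finally show ?thesis .
  qed
  ultimately have "(\<lambda>y. emeasure (path_law P X y) B * indicator I y) \<in> borel_measurable borel"
    by (subst (asm) borel_measurable_restrict_space_iff_ennreal) auto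
  then have "(\<lambda>v. emeasure (path_law P X (real_of_ereal v)) B * indicator I (real_of_ereal v)) \<in> borel_measurable borel"
    by measurable
  then have "(\<lambda>v. indicator {\<alpha><..<\<beta>} v * (emeasure (path_law P X (real_of_ereal v)) B * indicator I (real_of_ereal v))) \<in> borel_measurable borel"
    by measurable
  also have "(\<lambda>v. indicator {\<alpha><..<\<beta>} v * (emeasure (path_law P X (real_of_ereal v)) B * indicator I (real_of_ereal v)))
    = (\<lambda>v. indicator {\<alpha><..<\<beta>} v * emeasure (path_law P X (real_of_ereal v)) B)"
  proof
    fix v
    show "indicator {\<alpha><..<\<beta>} v * (emeasure (path_law P X (real_of_ereal v)) B * indicator I (real_of_ereal v))
      = indicator {\<alpha><..<\<beta>} v * emeasure (path_law P X (real_of_ereal v)) B"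
      by (cases v) (auto simp: indicator_def interior_states_def)
  qed
  finally show ?thesis .
qed

text \<open>Sets that are not measurable have measure \<open>0\<close>.\<close>

lemma measure_pos_sets: "y \<in> I \<Longrightarrow> 0 < measure (P y) A \<Longrightarrow> A \<in> sets M"
  using measure_notin_sets[of A "P y"] by force

text \<open>The event in \<open>scale_hitting\<close> agrees almost surely with
  \<open>reach\<close>, because the path starts at \<open>y\<close>. That it is measurable at all
  follows from its positive measure.\<close>

lemma prob_reaches_above:
  assumes a: "a \<in> I" and b: "b \<in> I" and ayb: "a < y" "y < b"
  shows "measure (P y) (reach (ereal a) b) = (S y - S a) / (S b - S a)"
proof -
  have y: "y \<in> I" using interior_states_convex[OF a b] ayb by simp
  let ?H = "{\<omega>\<in>space M. hit_time X (ereal b) \<omega> < hit_time X (ereal a) \<omega>}"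
  have eq: "measure (P y) ?H = (S y - S a) / (S b - S a)" by (rule scale_hitting[OF a b ayb])
  moreover have "0 < (S y - S a) / (S b - S a)"
    using S_less[OF a y ayb(1)] S_less[OF y b ayb(2)] by simp
  ultimately have H: "?H \<in> sets M" by (intro measure_pos_sets[OF y]) simp
  have "AE \<omega> in P y. \<omega> \<in> ?H \<longleftrightarrow> \<omega> \<in> reach (ereal a) b"
    using start[OF y] AE_space
  proof eventually_elim
    case (elim \<omega>)
    then show ?case
      using hits_first_iff_reaches[OF continuous_paths, of \<omega> a b] ayb y by (simp add: hit_time_eq)
  qed
  then have "measure (P y) ?H = measure (P y) (reach (ereal a) b)"
    by (rule measure_eq_AE) (use H reaches_event y in auto)
  with eq show ?thesis by simp
qed

subsection \<open>The Markov property for the randomized filtration\<close>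

lemma subalgebra_F: "y \<in> I \<Longrightarrow> subalgebra (P y) (F t)"
  using F_le_M by (simp add: subalgebra_def)

text \<open>Weighting \<open>P y\<close> by an event of \<open>U\<close> only scales its restriction
  to \<open>F \<infinity>\<close>, by independence; equality of these two measures extends
  independence from events to nonnegative functions.\<close>

lemma nn_integral_indep:
  assumes y: "y \<in> I" and C: "C \<in> sets borel" and Z: "Z \<in> borel_measurable (F \<infinity>)"
  shows "(\<integral>\<^sup>+\<omega>. indicator (U -` C \<inter> space M) \<omega> * Z \<omega> \<partial>P y) = emeasure (P y) (U -` C \<inter> space M) * (\<integral>\<^sup>+\<omega>. Z \<omega> \<partial>P y)"
proof -
  interpret prob_space "P y" by (rule prob_space_P[OF y])
  let ?C = "U -` C \<inter> space M"
  have Cs: "?C \<in> sets (P y)" using U_in_G[OF C] G_le_M y by auto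
  let ?D = "density (P y) (indicator ?C)"
  have sub: "subalgebra ?D (F \<infinity>)" "subalgebra (P y) (F \<infinity>)"
    using F_le_M y by (simp_all add: subalgebra_def)
  have "restr_to_subalg ?D (F \<infinity>) = scale_measure (emeasure (P y) ?C) (restr_to_subalg (P y) (F \<infinity>))"
  proof (rule measure_eqI)
    show "sets (restr_to_subalg ?D (F \<infinity>)) = sets (scale_measure (emeasure (P y) ?C) (restr_to_subalg (P y) (F \<infinity>)))"
      by (simp only: sets_scale_measure sets_restr_to_subalg[OF sub(1)] sets_restr_to_subalg[OF sub(2)])
    fix A assume "A \<in> sets (restr_to_subalg ?D (F \<infinity>))"
    then have A: "A \<in> sets (F \<infinity>)" by (simp only: sets_restr_to_subalg[OF sub(1)])
    then have As: "A \<in> sets (P y)" using F_le_M y by auto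
    have "emeasure (restr_to_subalg ?D (F \<infinity>)) A = emeasure ?D A"
      by (rule emeasure_restr_to_subalg[OF sub(1) A])
    also have "\<dots> = (\<integral>\<^sup>+\<omega>. indicator ?C \<omega> * indicator A \<omega> \<partial>P y)"
      by (rule emeasure_density) (use Cs As in auto)
    also have "\<dots> = (\<integral>\<^sup>+\<omega>. indicator (?C \<inter> A) \<omega> \<partial>P y)" by (simp only: indicator_inter_arith)
    also have "\<dots> = emeasure (P y) (?C \<inter> A)" by (rule nn_integral_indicator) (use Cs As in auto)
    also have "\<dots> = ennreal (prob (?C \<inter> A))" by (rule emeasure_eq_measure)
    also have "prob (?C \<inter> A) = prob ?C * prob A"
      by (rule indep_setD[OF independent[OF y]]) (use C A in auto)
    also have "ennreal \<dots> = emeasure (P y) ?C * emeasure (restr_to_subalg (P y) (F \<infinity>)) A"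
      by (simp only: ennreal_mult measure_nonneg emeasure_eq_measure emeasure_restr_to_subalg[OF sub(2) A])
    finally show "emeasure (restr_to_subalg ?D (F \<infinity>)) A = emeasure (scale_measure (emeasure (P y) ?C) (restr_to_subalg (P y) (F \<infinity>))) A"
      using A by (simp add: emeasure_scale_measure)
  qed
  then have "(\<integral>\<^sup>+\<omega>. Z \<omega> \<partial>restr_to_subalg ?D (F \<infinity>)) = emeasure (P y) ?C * (\<integral>\<^sup>+\<omega>. Z \<omega> \<partial>restr_to_subalg (P y) (F \<infinity>))"
    using Z by (simp add: nn_integral_scale_measure measurable_in_subalg[OF sub(2)])
  then have "(\<integral>\<^sup>+\<omega>. Z \<omega> \<partial>?D) = emeasure (P y) ?C * (\<integral>\<^sup>+\<omega>. Z \<omega> \<partial>P y)"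
    using nn_integral_subalgebra2[OF sub(1) Z] nn_integral_subalgebra2[OF sub(2) Z] by simp
  moreover have "(\<integral>\<^sup>+\<omega>. Z \<omega> \<partial>?D) = (\<integral>\<^sup>+\<omega>. indicator ?C \<omega> * Z \<omega> \<partial>P y)"
    by (rule nn_integral_density) (use Cs measurable_from_subalg[OF sub(2) Z] in auto)
  ultimately show ?thesis by simp
qed

text \<open>The strong Markov property at a constant time, applied to the part of \<open>A\<close>
  where \<open>X t\<close> is interior. Writing it as an equality of integrals of two fixed
  functions over all \<open>A\<close> prepares the passage to \<open>G\<close>.\<close>

lemma markov_natural:
  assumes y: "y \<in> I" and t: "0 \<le> t" and A: "A \<in> sets (F (ennreal t))" and B: "B \<in> sets path_space"
  shows "(\<integral>\<^sup>+\<omega>. indicator A \<omega> * (indicator {\<alpha><..<\<beta>} (X t \<omega>) * indicator B (path_from X t \<omega>)) \<partial>P y) =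
    (\<integral>\<^sup>+\<omega>. indicator A \<omega> * (indicator {\<alpha><..<\<beta>} (X t \<omega>) * emeasure (path_law P X (real_of_ereal (X t \<omega>))) B) \<partial>P y)"
proof -
  define A' where "A' = A \<inter> {\<omega>\<in>space M. X t \<omega> \<in> {\<alpha><..<\<beta>}}"
  have [measurable]: "X t \<in> F (ennreal t) \<rightarrow>\<^sub>M borel" by (rule X_measurable_F) (use t in auto)
  have "{\<omega>\<in>space (F (ennreal t)). X t \<omega> \<in> {\<alpha><..<\<beta>}} \<in> sets (F (ennreal t))" by measurable
  then have A': "A' \<in> sets (F (ennreal t))" using A by (auto simp: A'_def)
  have AM: "A \<subseteq> space M" "A \<in> sets M" "A' \<in> sets M" using F_le_M A A' sets.sets_into_space[OF A] by auto
  have st: "stopping_time F (\<lambda>_. ennreal t)" by (rule stopping_time_const)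
  have "A' \<in> sets (F.pre_sigma (\<lambda>_. ennreal t))"
  proof (rule F.sets_pre_sigmaI[OF st])
    fix s show "{\<omega> \<in> A'. ennreal t \<le> s} \<in> sets (F s)"
      using A' F.sets_F_mono[of "ennreal t" s] by (cases "ennreal t \<le> s") auto
  qed
  from strong_Markov[OF y st this _ B]
  have sM: "emeasure (P y) {\<omega>\<in>A'. path_from X t \<omega> \<in> B} =
      (\<integral>\<^sup>+\<omega>\<in>A'. emeasure (path_law P X (real_of_ereal (X t \<omega>))) B \<partial>P y)"
    using t by (auto simp: A'_def)
  have pB: "{\<omega>\<in>A'. path_from X t \<omega> \<in> B} \<in> sets (P y)"
  proof -
    have "{\<omega>\<in>A'. path_from X t \<omega> \<in> B} = A' \<inter> (path_from X t -` B \<inter> space M)" using AM by (auto simp: A'_def)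
    also have "\<dots> \<in> sets M" using AM measurable_sets[OF path_from_measurable[OF t] B] by auto
    finally show ?thesis using y by simp
  qed
  have "(\<integral>\<^sup>+\<omega>. indicator A \<omega> * (indicator {\<alpha><..<\<beta>} (X t \<omega>) * indicator B (path_from X t \<omega>)) \<partial>P y)
    = (\<integral>\<^sup>+\<omega>. indicator {\<omega>\<in>A'. path_from X t \<omega> \<in> B} \<omega> \<partial>P y)"
    by (rule nn_integral_cong) (use y in \<open>auto simp: A'_def indicator_def\<close>)
  also have "\<dots> = (\<integral>\<^sup>+\<omega>\<in>A'. emeasure (path_law P X (real_of_ereal (X t \<omega>))) B \<partial>P y)"
    using pB sM by simp
  also have "\<dots> = (\<integral>\<^sup>+\<omega>. indicator A \<omega> * (indicator {\<alpha><..<\<beta>} (X t \<omega>) * emeasure (path_law P X (real_of_ereal (X t \<omega>))) B) \<partial>P y)"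
    by (rule nn_integral_cong) (use y in \<open>auto simp: A'_def indicator_def\<close>)
  finally show ?thesis .
qed

text \<open>Intersections of an event of \<open>U\<close> with an event of the past form an
  intersection-stable generator of \<open>G t\<close>. On it both integrals factor by
  \<open>nn_integral_indep\<close>, and two measures that agree there and are finite on the whole
  space coincide.\<close>

lemma integral_eq_on_randomized_filtration:
  assumes y: "y \<in> I" and Z: "Z1 \<in> borel_measurable (F \<infinity>)" "Z2 \<in> borel_measurable (F \<infinity>)"
    and eq: "\<And>A. A \<in> sets (F t) \<Longrightarrow> (\<integral>\<^sup>+\<omega>. indicator A \<omega> * Z1 \<omega> \<partial>P y) = (\<integral>\<^sup>+\<omega>. indicator A \<omega> * Z2 \<omega> \<partial>P y)"
    and fin: "(\<integral>\<^sup>+\<omega>. Z1 \<omega> \<partial>P y) < \<infinity>" and A: "A \<in> sets (G t)"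
  shows "(\<integral>\<^sup>+\<omega>. indicator A \<omega> * Z1 \<omega> \<partial>P y) = (\<integral>\<^sup>+\<omega>. indicator A \<omega> * Z2 \<omega> \<partial>P y)"
proof -
  define E where "E = {(U -` C \<inter> space M) \<inter> A | C A. C \<in> sets borel \<and> A \<in> sets (F t)}"
  have ZP: "Z1 \<in> borel_measurable (P y)" "Z2 \<in> borel_measurable (P y)"
    using Z measurable_from_subalg[OF subalgebra_F[OF y]] by auto
  define N1 where "N1 = restr_to_subalg (density (P y) Z1) (G t)"
  define N2 where "N2 = restr_to_subalg (density (P y) Z2) (G t)"
  have sub: "subalgebra (density (P y) Z1) (G t)" "subalgebra (density (P y) Z2) (G t)"
    using G_le_M y by (simp_all add: subalgebra_def)
  have N: "emeasure N1 A = (\<integral>\<^sup>+\<omega>. indicator A \<omega> * Z1 \<omega> \<partial>P y)"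
    "emeasure N2 A = (\<integral>\<^sup>+\<omega>. indicator A \<omega> * Z2 \<omega> \<partial>P y)" if A: "A \<in> sets (G t)" for A
  proof -
    have "A \<in> sets (P y)" using A G_le_M y by auto
    then show "emeasure N1 A = (\<integral>\<^sup>+\<omega>. indicator A \<omega> * Z1 \<omega> \<partial>P y)"
      "emeasure N2 A = (\<integral>\<^sup>+\<omega>. indicator A \<omega> * Z2 \<omega> \<partial>P y)"
      unfolding N1_def N2_def emeasure_restr_to_subalg[OF sub(1) A] emeasure_restr_to_subalg[OF sub(2) A]
      using ZP by (simp_all add: emeasure_density mult.commute)
  qed
  have FG: "A \<in> sets (F t) \<Longrightarrow> A \<in> sets (G t)" for A using F_le_G by auto
  have E_I: "(U -` C \<inter> space M) \<inter> A \<in> E" if "C \<in> sets borel" "A \<in> sets (F t)" for C A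
    unfolding E_def using that by blast
  have EG: "E \<subseteq> sets (G t)"
  proof
    fix a assume "a \<in> E"
    then obtain C A where a: "a = (U -` C \<inter> space M) \<inter> A" "C \<in> sets borel" "A \<in> sets (F t)"
      unfolding E_def by blast
    then show "a \<in> sets (G t)" using sets.Int[OF U_in_G FG] by simp
  qed
  have Pow: "E \<subseteq> Pow (space M)" using EG sets.space_closed[of "G t"] by auto
  have gen: "sets (G t) = sigma_sets (space M) E"
  proof
    show "sigma_sets (space M) E \<subseteq> sets (G t)"
      using sets.sigma_sets_subset[OF EG] by simp
    have sp: "space M \<in> sets (F t)" using sets.top[of "F t"] by simp
    have UE: "U -` C \<inter> space M \<in> E" if "C \<in> sets borel" for C
      using E_I[OF that sp] by (simp add: Int_assoc)
    have FE: "A \<in> E" if "A \<in> sets (F t)" for A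
      using E_I[OF _ that, of UNIV] sets.sets_into_space[OF that] by (simp add: Int_absorb1)
    show "sets (G t) \<subseteq> sigma_sets (space M) E"
      unfolding sets_G
    proof (intro sigma_sets_mono subsetI)
      fix a assume "a \<in> {U -` A \<inter> space M | A. A \<in> sets borel} \<union>
        {X s -` A \<inter> space M | s A. 0 \<le> s \<and> ennreal s \<le> t \<and> A \<in> sets borel}"
      then have "a \<in> E"
      proof
        assume "a \<in> {U -` A \<inter> space M | A. A \<in> sets borel}"
        then show ?thesis using UE by blast
      next
        assume "a \<in> {X s -` A \<inter> space M | s A. 0 \<le> s \<and> ennreal s \<le> t \<and> A \<in> sets borel}"
        then have "a \<in> sets (F t)" unfolding sets_F by (rule sigma_sets.Basic)
        then show ?thesis by (rule FE)
      qed
      then show "a \<in> sigma_sets (space M) E" by (rule sigma_sets.Basic)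
    qed
  qed
  have "N1 = N2"
  proof (rule measure_eqI_generator_eq[of E "space M"])
    show "Int_stable E"
    proof (rule Int_stableI)
      fix a b assume "a \<in> E" "b \<in> E"
      then obtain C A D B where a: "a = (U -` C \<inter> space M) \<inter> A" "b = (U -` D \<inter> space M) \<inter> B"
        "C \<in> sets borel" "A \<in> sets (F t)" "D \<in> sets borel" "B \<in> sets (F t)" unfolding E_def by blast
      have "a \<inter> b = (U -` (C \<inter> D) \<inter> space M) \<inter> (A \<inter> B)" unfolding a by auto
      then show "a \<inter> b \<in> E" using E_I[of "C \<inter> D" "A \<inter> B"] a by simp
    qed
    show "E \<subseteq> Pow (space M)" by fact
    show "sets N1 = sigma_sets (space M) E" "sets N2 = sigma_sets (space M) E"
      using gen by (simp_all add: N1_def N2_def sets_restr_to_subalg[OF sub(1)] sets_restr_to_subalg[OF sub(2)])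
    fix a assume aE: "a \<in> E"
    then obtain C A where a: "a = (U -` C \<inter> space M) \<inter> A" "C \<in> sets borel" "A \<in> sets (F t)"
      unfolding E_def by blast
    have i: "indicator a \<omega> * Z \<omega> = indicator (U -` C \<inter> space M) \<omega> * (indicator A \<omega> * Z \<omega>)"
      for \<omega> and Z :: "'a \<Rightarrow> ennreal" unfolding a by (auto simp: indicator_def)
    have [measurable]: "A \<in> sets (F \<infinity>)" using a(3) F.sets_F_mono[of t \<infinity>] by auto
    note [measurable] = Z
    show "emeasure N1 a = emeasure N2 a"
    proof -
      have "a \<in> sets (G t)" using aE EG by auto
      note N[OF this]
      moreover have "(\<integral>\<^sup>+\<omega>. indicator a \<omega> * Z1 \<omega> \<partial>P y) = emeasure (P y) (U -` C \<inter> space M) * (\<integral>\<^sup>+\<omega>. indicator A \<omega> * Z1 \<omega> \<partial>P y)"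
        unfolding i by (rule nn_integral_indep[OF y a(2)]) measurable
      moreover have "(\<integral>\<^sup>+\<omega>. indicator a \<omega> * Z2 \<omega> \<partial>P y) = emeasure (P y) (U -` C \<inter> space M) * (\<integral>\<^sup>+\<omega>. indicator A \<omega> * Z2 \<omega> \<partial>P y)"
        unfolding i by (rule nn_integral_indep[OF y a(2)]) measurable
      ultimately show ?thesis using eq[OF a(3)] by simp
    qed
  next
    have sp: "space M \<in> sets (F t)" using sets.top[of "F t"] by simp
    have "space M \<in> E" using E_I[OF _ sp, of UNIV] by simp
    then show "range (\<lambda>_::nat. space M) \<subseteq> E" by auto
    show "(\<Union>i::nat. space M) = space M" by simp
    fix i :: nat
    have "emeasure N1 (space M) \<le> (\<integral>\<^sup>+\<omega>. Z1 \<omega> \<partial>P y)"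
      unfolding N(1)[OF FG[OF sp]] by (rule nn_integral_mono) (auto simp: indicator_def)
    then show "emeasure N1 (space M) \<noteq> \<infinity>" using fin by auto
  qed
  then show ?thesis using N[OF A] by simp
qed

text \<open>Knowledge of \<open>U\<close> does not disturb the Markov property at deterministic
  times.\<close>

lemma markov_randomized:
  assumes y: "y \<in> I" and t: "0 \<le> t" and A: "A \<in> sets (G (ennreal t))" and B: "B \<in> sets path_space"
  shows "(\<integral>\<^sup>+\<omega>. indicator A \<omega> * (indicator {\<alpha><..<\<beta>} (X t \<omega>) * indicator B (path_from X t \<omega>)) \<partial>P y) =
    (\<integral>\<^sup>+\<omega>. indicator A \<omega> * (indicator {\<alpha><..<\<beta>} (X t \<omega>) * emeasure (path_law P X (real_of_ereal (X t \<omega>))) B) \<partial>P y)"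
proof (rule integral_eq_on_randomized_filtration[OF y _ _ markov_natural[OF y t _ B] _ A])
  interpret prob_space "P y" by (rule prob_space_P[OF y])
  have mX: "X t \<in> F \<infinity> \<rightarrow>\<^sub>M borel" by (rule X_measurable_F) (use t in auto)
  have mp: "path_from X t \<in> F \<infinity> \<rightarrow>\<^sub>M path_space" by (rule path_from_measurable_F[OF t])
  show "(\<lambda>\<omega>. indicator {\<alpha><..<\<beta>} (X t \<omega>) * indicator B (path_from X t \<omega>) :: ennreal) \<in> borel_measurable (F \<infinity>)"
    by (rule borel_measurable_times_ennreal[OF measurable_compose[OF mX borel_measurable_indicator]
        measurable_compose[OF mp borel_measurable_indicator]]) (use B in auto)
  show "(\<lambda>\<omega>. indicator {\<alpha><..<\<beta>} (X t \<omega>) * emeasure (path_law P X (real_of_ereal (X t \<omega>))) B) \<in> borel_measurable (F \<infinity>)"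
    by (rule measurable_compose[OF mX path_law_measurable[OF B]])
  have "(\<integral>\<^sup>+\<omega>. indicator {\<alpha><..<\<beta>} (X t \<omega>) * indicator B (path_from X t \<omega>) \<partial>P y) \<le> (\<integral>\<^sup>+\<omega>. 1 \<partial>P y)"
    by (rule nn_integral_mono) (auto simp: indicator_def)
  also have "\<dots> < \<infinity>" by (simp add: emeasure_space_1 infinity_ennreal_def)
  finally show "(\<integral>\<^sup>+\<omega>. indicator {\<alpha><..<\<beta>} (X t \<omega>) * indicator B (path_from X t \<omega>) \<partial>P y) < \<infinity>" .
qed

end

locale lower_attracted_diffusion = linear_diffusion M P X U S m "ereal \<alpha>" \<beta>
  for M :: "'a measure" and P X U S m and \<alpha> :: real and \<beta> +
  assumes scale_lower_0: "scale_lower (ereal \<alpha>) S = 0"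
    and scale_upper_infinity: "scale_upper \<beta> S = \<infinity>"
begin

subsection \<open>The scale function at the boundary\<close>

text \<open>By monotonicity the limit \<open>scale_lower\<close> is the infimum of \<open>S\<close>,
  which is thus 0. It is not attained, since below each interior state there is another one.\<close>

lemma
  shows S_pos: "y \<in> I \<Longrightarrow> 0 < S y" and S_small: "0 < e \<Longrightarrow> \<exists>y\<in>I. S y < e"
proof -
  define f where "f v = ereal (S (real_of_ereal v))" for v
  define L where "L = (INF v\<in>{ereal \<alpha><..<\<beta>}. f v)"
  have Lle: "L \<le> f v" if "v \<in> {ereal \<alpha><..<\<beta>}" for v unfolding L_def using that by (rule INF_lower)
  have realI: "real_of_ereal v \<in> I" "ereal (real_of_ereal v) = v" if "v \<in> {ereal \<alpha><..<\<beta>}" for v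
    using that by (cases v; auto simp: interior_states_def)+
  have "(f \<longlongrightarrow> L) (at_right (ereal \<alpha>))"
  proof (rule order_tendstoI)
    fix l assume "l < L"
    then have "\<forall>v>ereal \<alpha>. v < \<beta> \<longrightarrow> l < f v" using Lle by (auto intro: less_le_trans)
    then show "\<forall>\<^sub>F v in at_right (ereal \<alpha>). l < f v"
      unfolding eventually_at_right[OF nonempty] using nonempty by blast
  next
    fix u assume "L < u"
    then obtain v0 where v0: "v0 \<in> {ereal \<alpha><..<\<beta>}" "f v0 < u" unfolding L_def INF_less_iff by blast
    have "f v < u" if "ereal \<alpha> < v" "v < v0" for v
    proof -
      have v: "v \<in> {ereal \<alpha><..<\<beta>}" using that v0 by auto
      have "real_of_ereal v < real_of_ereal v0"
        using that(2) realI(2)[OF v] realI(2)[OF v0(1)] by (metis less_ereal.simps(1))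
      then have "f v \<le> f v0" unfolding f_def using S_less[OF realI(1)[OF v] realI(1)[OF v0(1)]] by simp
      with v0(2) show ?thesis by simp
    qed
    moreover have "ereal \<alpha> < v0" using v0 by simp
    ultimately show "\<forall>\<^sub>F v in at_right (ereal \<alpha>). f v < u"
      unfolding eventually_at_right[OF \<open>ereal \<alpha> < v0\<close>] by blast
  qed
  then have "scale_lower (ereal \<alpha>) S = L" unfolding scale_lower_def f_def
    by (rule tendsto_Lim[OF at_right_ereal_neq_bot[OF nonempty]])
  then have L0: "L = 0" using scale_lower_0 by simp
  have nn: "0 \<le> S y" if "y \<in> I" for y
    using Lle[of "ereal y"] that L0 by (simp add: interior_states_def f_def)
  show "0 < S y" if y: "y \<in> I" for y
  proof -
    obtain z where "z \<in> I" "z < y" using I_openness(2)[OF y] by blast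
    then show ?thesis using nn[of z] S_less[of z y] y by simp
  qed
  show "\<exists>y\<in>I. S y < e" if "0 < e" for e
  proof -
    have "L < ereal e" using L0 that by simp
    then obtain v0 where v0: "v0 \<in> {ereal \<alpha><..<\<beta>}" "f v0 < ereal e" unfolding L_def INF_less_iff by blast
    then show ?thesis using realI(1)[OF v0(1)] by (auto simp: f_def)
  qed
qed

lemma S_large: "\<exists>y\<in>I. C < S y"
proof -
  define f where "f v = ereal (S (real_of_ereal v))" for v
  define L where "L = (SUP v\<in>{ereal \<alpha><..<\<beta>}. f v)"
  have Lge: "f v \<le> L" if "v \<in> {ereal \<alpha><..<\<beta>}" for v unfolding L_def using that by (rule SUP_upper)
  have realI: "real_of_ereal v \<in> I" "ereal (real_of_ereal v) = v" if "v \<in> {ereal \<alpha><..<\<beta>}" for v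
    using that by (cases v; auto simp: interior_states_def)+
  have "(f \<longlongrightarrow> L) (at_left \<beta>)"
  proof (rule order_tendstoI)
    fix u assume "L < u"
    then have "\<forall>v>ereal \<alpha>. v < \<beta> \<longrightarrow> f v < u" using Lge by (auto intro: le_less_trans)
    then show "\<forall>\<^sub>F v in at_left \<beta>. f v < u"
      unfolding eventually_at_left[OF nonempty] using nonempty by blast
  next
    fix l assume "l < L"
    then obtain v0 where v0: "v0 \<in> {ereal \<alpha><..<\<beta>}" "l < f v0" unfolding L_def less_SUP_iff by blast
    have "l < f v" if "v0 < v" "v < \<beta>" for v
    proof -
      have v: "v \<in> {ereal \<alpha><..<\<beta>}" using that v0 by auto
      have "real_of_ereal v0 < real_of_ereal v"
        using that(1) realI(2)[OF v] realI(2)[OF v0(1)] by (metis less_ereal.simps(1))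
      then have "f v0 \<le> f v" unfolding f_def using S_less[OF realI(1)[OF v0(1)] realI(1)[OF v]] by simp
      with v0(2) show ?thesis by simp
    qed
    moreover have "v0 < \<beta>" using v0 by simp
    ultimately show "\<forall>\<^sub>F v in at_left \<beta>. l < f v"
      unfolding eventually_at_left[OF \<open>v0 < \<beta>\<close>] by blast
  qed
  then have "scale_upper \<beta> S = L" unfolding scale_upper_def f_def
    by (rule tendsto_Lim[OF at_left_ereal_neq_bot[OF nonempty]])
  then have "ereal C < L" using scale_upper_infinity by simp
  then obtain v0 where v0: "v0 \<in> {ereal \<alpha><..<\<beta>}" "ereal C < f v0" unfolding L_def less_SUP_iff by blast
  then show ?thesis using realI(1)[OF v0(1)] by (auto simp: f_def)
qed

lemma S_surj:
  assumes "0 < u"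
  shows "\<exists>y\<in>I. S y = u"
proof -
  obtain a where a: "a \<in> I" "S a < u" using S_small[OF assms] by blast
  obtain b where b: "b \<in> I" "u < S b" using S_large by blast
  have "a \<le> b" using S_le_iff[OF a(1) b(1)] a b by simp
  have sub: "{a..b} \<subseteq> I" using interior_states_convex[OF a(1) b(1)] by auto
  obtain y where "a \<le> y" "y \<le> b" "S y = u"
    using IVT'[of S a u b] a b \<open>a \<le> b\<close> continuous_on_subset[OF scale_continuous sub] by auto
  then show ?thesis using sub by auto
qed

text \<open>A continuous extension to all extended reals, so that limits along paths can be taken at
  the end points too. The value \<infinity> at \<beta> lets a finite expectation exclude
  \<beta>.\<close>

definition ext_scale :: "ereal \<Rightarrow> ennreal" where
  "ext_scale v = (if v \<le> ereal \<alpha> then 0 else if v < \<beta> then ennreal (S (real_of_ereal v)) else \<infinity>)"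

lemma ext_scale_interior: "y \<in> I \<Longrightarrow> ext_scale (ereal y) = ennreal (S y)"
  by (auto simp: ext_scale_def interior_states_def)

lemma ext_scale_inside: "v \<in> {ereal \<alpha><..<\<beta>} \<Longrightarrow> ext_scale v = ennreal (S (real_of_ereal v))"
  by (auto simp: ext_scale_def dest: leD)

lemma interval_subset:
  assumes "a \<in> I" "b \<in> I"
  shows "{ereal a<..<ereal b} \<subseteq> {ereal \<alpha><..<\<beta>}"
proof
  fix v assume "v \<in> {ereal a<..<ereal b}"
  then have "ereal a < v" "v < ereal b" by auto
  then show "v \<in> {ereal \<alpha><..<\<beta>}"
    using less_trans[OF I_D(1)[OF assms(1)]] less_trans[OF _ I_D(2)[OF assms(2)]] by auto
qed

lemma ext_scale_lower [simp]: "ext_scale (ereal \<alpha>) = 0"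
  by (simp add: ext_scale_def)

lemma ext_scale_mono: "v \<le> w \<Longrightarrow> ext_scale v \<le> ext_scale w"
proof -
  assume vw: "v \<le> w"
  show ?thesis
  proof (cases "ereal \<alpha> < v \<and> w < \<beta>")
    case True
    then have "ereal \<alpha> < v" "v < \<beta>" "ereal \<alpha> < w" "w < \<beta>" using vw by auto
    then obtain y z where "v = ereal y" "w = ereal z" "y \<in> I" "z \<in> I"
      by (cases v; cases w; auto simp: interior_states_def)
    then show ?thesis using vw S_le_iff[of y z] by (auto simp: ext_scale_interior intro!: ennreal_leI)
  next
    case False
    then have "v \<le> ereal \<alpha> \<or> ereal \<alpha> < w \<and> \<beta> \<le> w"
      using vw nonempty by (auto simp: not_less)
    then show ?thesis
      by (auto simp: ext_scale_def)
  qed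
qed

text \<open>A monotone map onto the whole of \<open>ennreal\<close> has no jumps; surjectivity comes
  from \<open>S_surj\<close>.\<close>

lemma ext_scale_continuous: "continuous_on UNIV ext_scale"
proof (rule continuous_onI_mono)
  have "u \<in> range ext_scale" for u
  proof (cases u)
    case (real r)
    show ?thesis
    proof (cases "r = 0")
      case True
      then have "u = ext_scale (ereal \<alpha>)" using real by simp
      then show ?thesis by blast
    next
      case False
      then obtain y where "y \<in> I" "S y = r" using S_surj[of r] real by auto
      then have "u = ext_scale (ereal y)" using real by (simp add: ext_scale_interior)
      then show ?thesis by blast
    qed
  next
    case top
    have "ext_scale \<infinity> = \<infinity>" by (auto simp: ext_scale_def)
    then show ?thesis using top by (metis infinity_ennreal_def rangeI)
  qed
  then have "range ext_scale = UNIV" by blast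
  then show "open (range ext_scale)" by simp
qed (rule ext_scale_mono)

lemma ext_scale_measurable [measurable]: "ext_scale \<in> borel \<rightarrow>\<^sub>M borel"
  by (rule borel_measurable_continuous_onI[OF ext_scale_continuous])

lemma exhausting_states:
  obtains a b :: "nat \<Rightarrow> real" where "\<And>n. a n \<in> I" "\<And>n. b n \<in> I" "\<And>n. a n < b n"
    "(\<lambda>n. S (a n)) \<longlonglongrightarrow> 0" "filterlim (\<lambda>n. S (b n)) at_top sequentially"
    "\<And>v. v \<in> I \<Longrightarrow> \<forall>\<^sub>F n in sequentially. a n < v \<and> v < b n"
proof -
  have "\<exists>y\<in>I. S y < 1 / real (Suc n)" for n by (rule S_small) simp
  then obtain a where a: "\<And>n. a n \<in> I" "\<And>n. S (a n) < 1 / real (Suc n)" by metis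
  have "\<exists>y\<in>I. real (Suc n) < S y" for n by (rule S_large)
  then obtain b where b: "\<And>n. b n \<in> I" "\<And>n. real (Suc n) < S (b n)" by metis
  have "S (a n) < S (b n)" for n
  proof -
    have "1 / real (Suc n) \<le> 1" "1 \<le> real (Suc n)" by simp_all
    then show ?thesis using a(2)[of n] b(2)[of n] by linarith
  qed
  then have ab: "a n < b n" for n using S_le_iff[OF b(1) a(1), of n n] by (simp add: not_le[symmetric])
  have la: "(\<lambda>n. S (a n)) \<longlonglongrightarrow> 0"
    by (rule tendsto_sandwich[OF _ _ tendsto_const LIMSEQ_Suc[OF lim_const_over_n[of 1]]])
       (use a S_pos in \<open>auto intro!: always_eventually less_imp_le simp del: of_nat_Suc\<close>)
  have lb: "filterlim (\<lambda>n. S (b n)) at_top sequentially"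
  proof (rule filterlim_at_top_mono[OF filterlim_real_sequentially])
    show "\<forall>\<^sub>F n in sequentially. real n \<le> S (b n)"
    proof (rule always_eventually, rule allI)
      show "real n \<le> S (b n)" for n using b(2)[of n] by simp
    qed
  qed
  have "\<forall>\<^sub>F n in sequentially. a n < v \<and> v < b n" if v: "v \<in> I" for v
  proof -
    have "\<forall>\<^sub>F n in sequentially. S (a n) < S v" by (rule order_tendstoD(2)[OF la S_pos[OF v]])
    moreover have "\<forall>\<^sub>F n in sequentially. S v < S (b n)"
      using lb by (simp add: filterlim_at_top_dense)
    ultimately show ?thesis
    proof eventually_elim
      case (elim n)
      then show ?case using S_le_iff[OF v a(1), of n] S_le_iff[OF b(1) v, of n] by (simp add: not_le[symmetric])
    qed
  qed
  with a(1) b(1) ab la lb show ?thesis using that by blast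
qed

lemma measurable_P: "y \<in> I \<Longrightarrow> measurable (P y) N = measurable M N"
  by (rule measurable_cong_sets) auto

lemma X_ge_lower: "\<omega> \<in> space M \<Longrightarrow> 0 \<le> t \<Longrightarrow> ereal \<alpha> \<le> X t \<omega>"
  using states[of \<omega> t] by auto

lemma X_above_before:
  assumes "\<omega> \<in> space M" "0 \<le> u" "u \<le> s" "X s \<omega> \<noteq> ereal \<alpha>"
  shows "ereal \<alpha> < X u \<omega>"
  using stays_at_end_points[OF assms(1-3)] assms(4) X_ge_lower[OF assms(1,2)] by (auto simp: less_le)

text \<open>The lower barrier decreases to \<alpha>, where \<open>S\<close> tends to 0. A path that
  reaches \<open>b\<close> has not touched \<alpha> before, since it would have stayed there; by
  compactness it then stays above some \<open>a n\<close>, so the events with barrier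
  \<open>a n\<close> exhaust the limit event.\<close>

lemma prob_reaches:
  assumes y: "y \<in> I" and b: "b \<in> I" and yb: "y < b"
  shows "measure (P y) (reach (-\<infinity>) b) = S y / S b"
proof -
  interpret prob_space "P y" by (rule prob_space_P[OF y])
  \<comment> \<open>The shift by 2 avoids division by 0 and the value
    \<open>a 0 = y\<close>.\<close>
  define a where "a n = \<alpha> + (y - \<alpha>) / real (n + 2)" for n
  have \<alpha>y: "\<alpha> < y" using y by (simp add: interior_states_def)
  have ay: "\<alpha> < a n" "a n < y" for n
  proof -
    have "(y - \<alpha>) / real (n + 2) < (y - \<alpha>) / 1" by (rule divide_strict_left_mono) (use \<alpha>y in auto)
    then show "\<alpha> < a n" "a n < y" using \<alpha>y by (auto simp: a_def)
  qed
  have aI: "a n \<in> I" for n using ay[of n] y less_trans[of "ereal (a n)" "ereal y" \<beta>] by (auto simp: interior_states_def)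
  have dec: "a n \<le> a k" if "k \<le> n" for k n
    unfolding a_def using that \<alpha>y by (intro add_left_mono divide_left_mono) auto
  have "(\<lambda>n. \<alpha> + (y - \<alpha>) / real (n + 2)) \<longlonglongrightarrow> \<alpha> + 0"
    by (intro tendsto_add tendsto_const LIMSEQ_ignore_initial_segment[OF lim_const_over_n])
  then have a_lim: "a \<longlonglongrightarrow> \<alpha>" by (simp add: a_def[abs_def])
  have Sa: "(\<lambda>n. S (a n)) \<longlonglongrightarrow> 0"
  proof (rule order_tendstoI)
    show "\<forall>\<^sub>F n in sequentially. l < S (a n)" if "l < 0" for l
      using S_pos[OF aI] that by (intro always_eventually) (auto intro: less_trans)
    fix e :: real assume "0 < e"
    then obtain z where z: "z \<in> I" "S z < e" using S_small by blast
    then have "\<alpha> < z" by (simp add: interior_states_def)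
    from order_tendstoD(2)[OF a_lim this] show "\<forall>\<^sub>F n in sequentially. S (a n) < e"
      by eventually_elim (use S_less[OF aI z(1)] z(2) in force)
  qed
  define A where "A n = {\<omega>\<in>space M. reaches (ereal (a n)) b (\<lambda>t. X t \<omega>)}" for n
  have "incseq A"
  proof (rule incseq_SucI)
    fix n show "A n \<subseteq> A (Suc n)" unfolding A_def reaches_def
      using dec[of n "Suc n"] by (auto 4 4 intro: le_less_trans[of "ereal (a (Suc n))" "ereal (a n)"])
  qed
  then have "(\<lambda>n. prob (A n)) \<longlonglongrightarrow> prob (\<Union>n. A n)"
    by (rule finite_Lim_measure_incseq[rotated]) (auto simp: A_def y reaches_event)
  moreover have "(\<Union>n. A n) = reach (-\<infinity>) b"
  proof (intro equalityI subsetI)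
    fix \<omega> assume "\<omega> \<in> (\<Union>n. A n)"
    then show "\<omega> \<in> reach (-\<infinity>) b"
      unfolding A_def reaches_def by (auto 4 4 intro: le_less_trans[of "-\<infinity>"])
  next
    fix \<omega> assume "\<omega> \<in> reach (-\<infinity>) b"
    then obtain s where \<omega>: "\<omega> \<in> space M" and s: "0 \<le> s" "ereal b \<le> X s \<omega>" by (auto simp: reaches_def)
    have "X s \<omega> \<noteq> ereal \<alpha>" using s(2) I_D(1)[OF b] by auto
    then have above: "\<forall>u\<in>{0..s}. ereal \<alpha> < X u \<omega>" using X_above_before[OF \<omega>] by auto
    then obtain c :: rat where c: "ereal \<alpha> < ereal (of_rat c)"
      "\<And>q::rat. \<bar>of_rat q\<bar> \<le> s \<Longrightarrow> ereal (of_rat c) \<le> X \<bar>of_rat q\<bar> \<omega>"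
      unfolding above_iff_rational[OF continuous_paths[OF \<omega>] s(1)] by blast
    have "\<alpha> < of_rat c" using c(1) by simp
    from order_tendstoD(2)[OF a_lim this] obtain n where n: "a n < of_rat c" by (auto simp: eventually_sequentially)
    have "\<forall>u\<in>{0..s}. ereal (a n) < X u \<omega>"
      unfolding above_iff_rational[OF continuous_paths[OF \<omega>] s(1)] using c(2) n by (intro exI[of _ c]) auto
    then have "\<omega> \<in> A n" unfolding A_def reaches_def using \<omega> s by auto
    then show "\<omega> \<in> (\<Union>n. A n)" by blast
  qed
  ultimately have "(\<lambda>n. prob (A n)) \<longlonglongrightarrow> prob (reach (-\<infinity>) b)" by simp
  moreover have "(\<lambda>n. prob (A n)) \<longlonglongrightarrow> (S y - 0) / (S b - 0)"
    unfolding A_def prob_reaches_above[OF aI b ay(2) yb]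
    by (intro tendsto_intros Sa) (use S_pos[OF b] in simp)
  ultimately show ?thesis using LIMSEQ_unique by fastforce
qed

text \<open>A path at \<beta> has passed every level \<open>b n\<close>, which has probability
  \<open>S y / S (b n)\<close>; this tends to 0 because the scale is unbounded.\<close>

lemma AE_below_upper:
  assumes y: "y \<in> I"
  shows "AE \<omega> in P y. \<forall>t\<ge>0. X t \<omega> < \<beta>"
proof -
  interpret prob_space "P y" by (rule prob_space_P[OF y])
  define R where "R b = reach (-\<infinity>) b" for b
  obtain a b where ab: "\<And>n::nat. b n \<in> I" "filterlim (\<lambda>n. S (b n)) at_top sequentially"
    "\<And>v. v \<in> I \<Longrightarrow> \<forall>\<^sub>F n in sequentially. a n < v \<and> v < b n" by (rule exhausting_states) blast
  define N where "N = (\<Inter>n. R (b n))"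
  have Rs: "R b \<in> events" for b using reaches_event y by (simp add: R_def)
  have Ns: "N \<in> events" unfolding N_def using Rs by blast
  have "(\<lambda>n. S y / S (b n)) \<longlonglongrightarrow> 0"
    by (intro real_tendsto_divide_at_top[OF tendsto_const] ab)
  moreover have "\<forall>\<^sub>F n in sequentially. prob N \<le> S y / S (b n)"
    using ab(3)[OF y]
  proof eventually_elim
    case (elim n)
    have "prob N \<le> prob (R (b n))" by (rule finite_measure_mono) (auto simp: N_def Rs)
    also have "\<dots> = S y / S (b n)" unfolding R_def by (rule prob_reaches[OF y ab(1)]) (use elim in simp)
    finally show ?case .
  qed
  ultimately have "prob N \<le> 0" by (intro tendsto_le[OF _ _ tendsto_const]) auto
  then have "N \<in> null_sets (P y)" using Ns by (simp add: null_sets_def emeasure_eq_measure measure_le_0_iff)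
  moreover have "\<omega> \<in> N" if \<omega>: "\<omega> \<in> space M" and n: "\<not> (\<forall>t\<ge>0. X t \<omega> < \<beta>)" for \<omega>
  proof -
    from n obtain t where t: "0 \<le> t" "X t \<omega> = \<beta>" using states[OF \<omega>] by (auto simp: not_less intro: antisym)
    have "-\<infinity> < X u \<omega>" if "u \<in> {0..t}" for u
    proof -
      have "ereal \<alpha> < X u \<omega>" using X_above_before[OF \<omega>, of u t] that t nonempty by auto
      then show ?thesis by (cases "X u \<omega>") auto
    qed
    then have "reaches (-\<infinity>) (b n) (\<lambda>t. X t \<omega>)" for n
      unfolding reaches_def using t I_D(2)[OF ab(1), of n] by (intro exI[of _ t]) (auto intro: less_imp_le)
    then show ?thesis using \<omega> by (simp add: N_def R_def)
  qed
  ultimately show ?thesis using y by (intro AE_I'[of N]) auto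
qed

subsection \<open>The scale process is a supermartingale\<close>

lemma path_law_reaching_interior:
  assumes "a \<in> I" "b \<in> I" "a < y" "y < b"
  shows "emeasure (path_law P X y) (reaching_paths (ereal a) b) = ennreal ((S y - S a) / (S b - S a))"
proof -
  have y: "y \<in> I" using interior_states_convex[OF assms(1,2)] assms by simp
  interpret prob_space "P y" by (rule prob_space_P[OF y])
  show ?thesis using prob_reaches_above[OF assms] by (simp add: path_law_reaching[OF y] emeasure_eq_measure)
qed

text \<open>
  A path that stays in \<open>(a, b)\<close> on \<open>[t, t + h]\<close> and reaches \<open>b\<close> before \<open>a\<close> after that reaches \<open>b\<close> before \<open>a\<close>
  after \<open>t\<close>, and the probability of reaching \<open>b\<close> before \<open>a\<close> is affine in the scale function.
\<close>

lemma scale_increment_le: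
  assumes y: "y \<in> I" and t: "0 \<le> t" and h: "0 \<le> h" and A: "A \<in> sets (G (ennreal t))"
    and a: "a \<in> I" and b: "b \<in> I" and ab: "a < b"
  shows "(\<integral>\<^sup>+\<omega>. indicator (A \<inter> {\<omega>\<in>space M. \<forall>s\<in>{0..h}. X (t + s) \<omega> \<in> {ereal a<..<ereal b}}) \<omega> *
      (ext_scale (X (t + h) \<omega>) - ennreal (S a)) \<partial>P y) \<le> (\<integral>\<^sup>+\<omega>. indicator A \<omega> * ext_scale (X t \<omega>) \<partial>P y)"
proof -
  let ?B = "reaching_paths (ereal a) b"
  define d where "d = S b - S a"
  have d: "0 < d" using S_less[OF a b ab] by (simp add: d_def)
  define D where "D = {\<omega>\<in>space M. \<forall>s\<in>{0..h}. X (t + s) \<omega> \<in> {ereal a<..<ereal b}}"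
  define D0 where "D0 = {\<omega>\<in>space M. X t \<omega> \<in> {ereal a<..<ereal b}}"
  have "{\<omega>\<in>space (G (ennreal (t + h))). \<forall>s\<in>{0..h}. X (t + s) \<omega> \<in> {ereal a<..<ereal b}} \<in> sets (G (ennreal (t + h)))"
  proof (rule sets_Collect_between)
    fix s assume "0 \<le> s" "s \<le> h"
    then show "X (t + s) \<in> G (ennreal (t + h)) \<rightarrow>\<^sub>M borel" using t by (intro X_measurable_G) (auto intro!: ennreal_leI)
  next
    fix \<omega> assume "\<omega> \<in> space (G (ennreal (t + h)))"
    then have "\<omega> \<in> space M" by simp
    then show "continuous_on {0..} (\<lambda>s. X (t + s) \<omega>)"
      by (intro continuous_on_compose2[OF continuous_paths]) (use t in \<open>auto intro!: continuous_intros\<close>)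
  qed
  then have D: "D \<in> sets (G (ennreal (t + h)))" by (simp add: D_def)
  have mX: "X t \<in> G (ennreal t) \<rightarrow>\<^sub>M borel" by (rule X_measurable_G) (use t in auto)
  have D0: "D0 \<in> sets (G (ennreal t))"
    using measurable_sets[OF mX, of "{ereal a<..<ereal b}"] by (simp add: D0_def vimage_def Int_def conj_commute)
  have A1: "A \<inter> D \<in> sets (G (ennreal (t + h)))"
    using A D G_mono[of "ennreal t" "ennreal (t + h)"] t h by (auto intro!: ennreal_leI)
  have A0: "A \<inter> D0 \<in> sets (G (ennreal t))" using A D0 by auto
  have pl: "emeasure (path_law P X (real_of_ereal v)) ?B = ennreal (1 / d) * (ext_scale v - ennreal (S a))"
    and v_in: "v \<in> {ereal \<alpha><..<\<beta>}"
    if v: "v \<in> {ereal a<..<ereal b}" for v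
  proof -
    show v': "v \<in> {ereal \<alpha><..<\<beta>}" using v interval_subset[OF a b] by blast
    have "emeasure (path_law P X (real_of_ereal v)) ?B = ennreal ((S (real_of_ereal v) - S a) / d)"
      using path_law_reaching_interior[OF a b, of "real_of_ereal v"] v by (cases v) (auto simp: d_def)
    also have "\<dots> = ennreal (1 / d) * ennreal (S (real_of_ereal v) - S a)" using d by (simp flip: ennreal_mult')
    finally show "emeasure (path_law P X (real_of_ereal v)) ?B = ennreal (1 / d) * (ext_scale v - ennreal (S a))"
      using S_pos[OF a] by (simp add: ext_scale_inside[OF v'] ennreal_minus)
  qed
  have t_h: "0 \<le> t + h" using t h by simp
  have [measurable]: "A \<in> sets (P y)" "A \<inter> D \<in> sets (P y)" "X t \<in> P y \<rightarrow>\<^sub>M borel" "X (t + h) \<in> P y \<rightarrow>\<^sub>M borel"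
    using A A1 G_le_M measurable_X[OF t] measurable_X[OF t_h] y by (auto simp: measurable_P)
  have "ennreal (1 / d) * (\<integral>\<^sup>+\<omega>. indicator (A \<inter> D) \<omega> * (ext_scale (X (t + h) \<omega>) - ennreal (S a)) \<partial>P y)
    = (\<integral>\<^sup>+\<omega>. ennreal (1 / d) * (indicator (A \<inter> D) \<omega> * (ext_scale (X (t + h) \<omega>) - ennreal (S a))) \<partial>P y)"
    by (rule nn_integral_cmult[symmetric]) measurable
  also have "\<dots> = (\<integral>\<^sup>+\<omega>. indicator (A \<inter> D) \<omega> * (indicator {ereal \<alpha><..<\<beta>} (X (t + h) \<omega>) * emeasure (path_law P X (real_of_ereal (X (t + h) \<omega>))) ?B) \<partial>P y)"
  proof (rule nn_integral_cong)
    fix \<omega>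
    show "ennreal (1 / d) * (indicator (A \<inter> D) \<omega> * (ext_scale (X (t + h) \<omega>) - ennreal (S a)))
      = indicator (A \<inter> D) \<omega> * (indicator {ereal \<alpha><..<\<beta>} (X (t + h) \<omega>) * emeasure (path_law P X (real_of_ereal (X (t + h) \<omega>))) ?B)"
    proof (cases "\<omega> \<in> A \<inter> D")
      case True
      then have v: "X (t + h) \<omega> \<in> {ereal a<..<ereal b}" using h by (auto simp: D_def)
      show ?thesis using True v_in[OF v] by (simp add: pl[OF v])
    qed simp
  qed
  also have "\<dots> = (\<integral>\<^sup>+\<omega>. indicator (A \<inter> D) \<omega> * (indicator {ereal \<alpha><..<\<beta>} (X (t + h) \<omega>) * indicator ?B (path_from X (t + h) \<omega>)) \<partial>P y)"
    by (rule markov_randomized[OF y t_h A1 reaching_paths_sets, symmetric])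
  also have "\<dots> \<le> (\<integral>\<^sup>+\<omega>. indicator (A \<inter> D0) \<omega> * (indicator {ereal \<alpha><..<\<beta>} (X t \<omega>) * indicator ?B (path_from X t \<omega>)) \<partial>P y)"
  proof (rule nn_integral_mono)
    fix \<omega> assume "\<omega> \<in> space (P y)"
    then have \<omega>: "\<omega> \<in> space M" using y by simp
    show "indicator (A \<inter> D) \<omega> * (indicator {ereal \<alpha><..<\<beta>} (X (t + h) \<omega>) * indicator ?B (path_from X (t + h) \<omega>))
      \<le> indicator (A \<inter> D0) \<omega> * (indicator {ereal \<alpha><..<\<beta>} (X t \<omega>) * (indicator ?B (path_from X t \<omega>) :: ennreal))"
    proof (cases "\<omega> \<in> A \<inter> D \<and> path_from X (t + h) \<omega> \<in> ?B")
      case True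
      then have stay: "\<And>s. 0 \<le> s \<Longrightarrow> s \<le> h \<Longrightarrow> X (t + s) \<omega> \<in> {ereal a<..<ereal b}" by (auto simp: D_def)
      have "X t \<omega> \<in> {ereal a<..<ereal b}" using stay[of 0] h by simp
      moreover have "reaches (ereal a) b (\<lambda>s. X (t + s) \<omega>)"
      proof -
        have "reaches (ereal a) b (\<lambda>s. X (t + h + s) \<omega>)" using True path_from_reaching[OF \<omega> t_h] by simp
        then obtain s where s: "0 \<le> s" "ereal b \<le> X (t + h + s) \<omega>" "\<And>u. u \<in> {0..s} \<Longrightarrow> ereal a < X (t + h + u) \<omega>"
          by (auto simp: reaches_def)
        have "ereal a < X (t + u) \<omega>" if "u \<in> {0..h + s}" for u
          using stay[of u] s(3)[of "u - h"] that by (cases "u \<le> h") auto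
        then show ?thesis unfolding reaches_def using s h by (intro exI[of _ "h + s"]) (auto simp: add.assoc)
      qed
      ultimately show ?thesis using True path_from_reaching[OF \<omega> t] \<omega> v_in by (auto simp: D0_def indicator_def)
    qed (auto simp: indicator_def)
  qed
  also have "\<dots> = (\<integral>\<^sup>+\<omega>. indicator (A \<inter> D0) \<omega> * (indicator {ereal \<alpha><..<\<beta>} (X t \<omega>) * emeasure (path_law P X (real_of_ereal (X t \<omega>))) ?B) \<partial>P y)"
    by (rule markov_randomized[OF y t A0 reaching_paths_sets])
  also have "\<dots> \<le> (\<integral>\<^sup>+\<omega>. ennreal (1 / d) * (indicator A \<omega> * ext_scale (X t \<omega>)) \<partial>P y)"
  proof (rule nn_integral_mono)
    fix \<omega>
    show "indicator (A \<inter> D0) \<omega> * (indicator {ereal \<alpha><..<\<beta>} (X t \<omega>) * emeasure (path_law P X (real_of_ereal (X t \<omega>))) ?B)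
      \<le> ennreal (1 / d) * (indicator A \<omega> * ext_scale (X t \<omega>))"
    proof (cases "\<omega> \<in> A \<inter> D0")
      case True
      then have v: "X t \<omega> \<in> {ereal a<..<ereal b}" by (auto simp: D0_def)
      show ?thesis using True v_in[OF v] by (simp add: pl[OF v] diff_le_self_ennreal mult_left_mono)
    qed simp
  qed
  also have "\<dots> = ennreal (1 / d) * (\<integral>\<^sup>+\<omega>. indicator A \<omega> * ext_scale (X t \<omega>) \<partial>P y)"
    by (rule nn_integral_cmult) measurable
  finally show ?thesis unfolding D_def[symmetric] using d by (simp add: ennreal_mult_le_mult_iff)
qed

text \<open>If \<open>X (t + h)\<close> is interior, so is the whole compact piece of path over
  \<open>[t, t + h]\<close>, because end points are never left. It then lies in
  \<open>(a n, b n)\<close> for large \<open>n\<close>, and Fatou's lemma removes the localization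
  and the term \<open>S (a n)\<close>. At \<alpha> the scale vanishes and nothing is to be
  shown.\<close>

lemma scale_supermartingale:
  assumes y: "y \<in> I" and t: "0 \<le> t" and h: "0 \<le> h" and A: "A \<in> sets (G (ennreal t))"
  shows "(\<integral>\<^sup>+\<omega>. indicator A \<omega> * ext_scale (X (t + h) \<omega>) \<partial>P y) \<le> (\<integral>\<^sup>+\<omega>. indicator A \<omega> * ext_scale (X t \<omega>) \<partial>P y)"
proof -
  obtain a b :: "nat \<Rightarrow> real" where ab: "\<And>n. a n \<in> I" "\<And>n. b n \<in> I" "\<And>n. a n < b n"
    "(\<lambda>n. S (a n)) \<longlonglongrightarrow> 0" "\<And>v. v \<in> I \<Longrightarrow> \<forall>\<^sub>F n in sequentially. a n < v \<and> v < b n"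
    by (rule exhausting_states) blast
  define f where "f n \<omega> = indicator (A \<inter> {\<omega>\<in>space M. \<forall>s\<in>{0..h}. X (t + s) \<omega> \<in> {ereal (a n)<..<ereal (b n)}}) \<omega> *
      (ext_scale (X (t + h) \<omega>) - ennreal (S (a n)))" for n \<omega>
  have meas: "f n \<in> borel_measurable (P y)" for n
  proof -
    have "{\<omega>\<in>space M. \<forall>s\<in>{0..h}. X (t + s) \<omega> \<in> {ereal (a n)<..<ereal (b n)}} \<in> sets M"
      by (rule sets_Collect_between)
         (use t in \<open>auto intro!: measurable_X continuous_on_compose2[OF continuous_paths] continuous_intros\<close>)
    then have [measurable]: "A \<inter> {\<omega>\<in>space M. \<forall>s\<in>{0..h}. X (t + s) \<omega> \<in> {ereal (a n)<..<ereal (b n)}} \<in> sets (P y)"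
      using A G_le_M y by auto
    have [measurable]: "X (t + h) \<in> P y \<rightarrow>\<^sub>M borel" using measurable_X[of "t + h"] t h y by (simp add: measurable_P)
    show ?thesis unfolding f_def by measurable
  qed
  have "(\<integral>\<^sup>+\<omega>. indicator A \<omega> * ext_scale (X (t + h) \<omega>) \<partial>P y) \<le> (\<integral>\<^sup>+\<omega>. liminf (\<lambda>n. f n \<omega>) \<partial>P y)"
  proof (rule nn_integral_mono_AE)
    show "AE \<omega> in P y. indicator A \<omega> * ext_scale (X (t + h) \<omega>) \<le> liminf (\<lambda>n. f n \<omega>)"
      using AE_below_upper[OF y] AE_space
    proof eventually_elim
      case (elim \<omega>)
      then have \<omega>: "\<omega> \<in> space M" using y by simp
      show ?case
      proof (cases "\<omega> \<in> A \<and> X (t + h) \<omega> \<noteq> ereal \<alpha>")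
        case False
        then show ?thesis by auto
      next
        case True
        have "X (t + h) \<omega> < \<beta>" using elim t h by simp
        then have in_I: "ereal \<alpha> < X (t + s) \<omega>" "X (t + s) \<omega> < \<beta>" if "s \<in> {0..h}" for s
          using X_above_before[OF \<omega>, of "t + s" "t + h"] True elim(1) that t by auto
        have cont: "continuous_on {0..h} (\<lambda>s. X (t + s) \<omega>)"
          by (rule continuous_on_compose2[OF continuous_paths[OF \<omega>]]) (use t in \<open>auto intro!: continuous_intros\<close>)
        have ne: "{0..h} \<noteq> {}" using h by simp
        obtain s1 where s1: "s1 \<in> {0..h}" "\<forall>s\<in>{0..h}. X (t + s1) \<omega> \<le> X (t + s) \<omega>"
          using continuous_attains_inf[OF compact_Icc ne cont] by blast
        obtain s2 where s2: "s2 \<in> {0..h}" "\<forall>s\<in>{0..h}. X (t + s) \<omega> \<le> X (t + s2) \<omega>"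
          using continuous_attains_sup[OF compact_Icc ne cont] by blast
        obtain v1 where v1: "v1 \<in> I" "X (t + s1) \<omega> = ereal v1"
          using X_interior[OF in_I[OF s1(1)]] by metis
        obtain v2 where v2: "v2 \<in> I" "X (t + s2) \<omega> = ereal v2"
          using X_interior[OF in_I[OF s2(1)]] by metis
        have "\<forall>\<^sub>F n in sequentially. f n \<omega> = ext_scale (X (t + h) \<omega>) - ennreal (S (a n))"
          using ab(5)[OF v1(1)] ab(5)[OF v2(1)]
        proof eventually_elim
          case (elim n)
          have "X (t + s) \<omega> \<in> {ereal (a n)<..<ereal (b n)}" if "s \<in> {0..h}" for s
          proof -
            have "ereal (a n) < X (t + s) \<omega>" using s1(2) that elim v1(2) by (auto intro: less_le_trans[of _ "ereal v1"])
            moreover have "X (t + s) \<omega> < ereal (b n)" using s2(2) that elim v2(2) by (auto intro: le_less_trans[of _ "ereal v2"])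
            ultimately show ?thesis by simp
          qed
          then show ?case using True \<omega> by (simp add: f_def)
        qed
        moreover have "(\<lambda>n. ext_scale (X (t + h) \<omega>) - ennreal (S (a n))) \<longlonglongrightarrow> ext_scale (X (t + h) \<omega>) - 0"
        proof (rule tendsto_diff_ennreal[OF tendsto_const])
          show "(\<lambda>n. ennreal (S (a n))) \<longlonglongrightarrow> 0" using tendsto_ennrealI[OF ab(4)] by simp
        qed (use ext_scale_inside[of "X (t + h) \<omega>"] in_I[of h] h in auto)
        ultimately have "(\<lambda>n. f n \<omega>) \<longlonglongrightarrow> ext_scale (X (t + h) \<omega>)"
          by (simp add: tendsto_cong)
        then have "liminf (\<lambda>n. f n \<omega>) = ext_scale (X (t + h) \<omega>)" by (rule lim_imp_Liminf[rotated]) simp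
        then show ?thesis by (simp add: indicator_def)
      qed
    qed
  qed
  also have "\<dots> \<le> liminf (\<lambda>n. \<integral>\<^sup>+\<omega>. f n \<omega> \<partial>P y)" by (rule nn_integral_liminf[OF meas])
  also have "\<dots> \<le> (\<integral>\<^sup>+\<omega>. indicator A \<omega> * ext_scale (X t \<omega>) \<partial>P y)"
  proof -
    have "liminf (\<lambda>n. \<integral>\<^sup>+\<omega>. f n \<omega> \<partial>P y) \<le> liminf (\<lambda>n::nat. \<integral>\<^sup>+\<omega>. indicator A \<omega> * ext_scale (X t \<omega>) \<partial>P y)"
      by (intro Liminf_mono always_eventually allI)
         (use scale_increment_le[OF y t h A ab(1-3)] in \<open>simp add: f_def\<close>)
    then show ?thesis by (simp add: Liminf_const)
  qed
  finally show ?thesis .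
qed

end

context linear_diffusion
begin

subsection \<open>Entry times are stopping times\<close>

text \<open>Since entry into a closed set is attained, not having entered by \<open>r\<close> is the
  event of avoiding the set on all of \<open>[0, r]\<close>.\<close>

lemma stopping_time_entry_time:
  assumes K: "closed K"
    and avoid: "\<And>r. {\<omega>\<in>space M. \<forall>s\<in>{0..r}. X s \<omega> \<notin> K} \<in> sets (F (ennreal r))"
  shows "stopping_time F (\<lambda>\<omega>. entry_time K (\<lambda>t. X t \<omega>))"
proof
  fix t :: ennreal
  show "Measurable.pred (F t) (\<lambda>\<omega>. entry_time K (\<lambda>t. X t \<omega>) \<le> t)"
  proof (cases t)
    case (real r)
    have "{\<omega>\<in>space M. entry_time K (\<lambda>t. X t \<omega>) \<le> t} = space M - {\<omega>\<in>space M. \<forall>s\<in>{0..r}. X s \<omega> \<notin> K}"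
      using entry_time_le_iff[OF continuous_paths K] real by blast
    then show ?thesis using sets.compl_sets[OF avoid[of r]] real by (simp add: pred_def)
  qed (simp add: top_greatest)
qed

lemma stopping_time_inner_exit_time: "stopping_time F (inner_exit_time X a b)"
  unfolding inner_exit_time_eq[abs_def]
proof (rule stopping_time_entry_time)
  show "{\<omega>\<in>space M. \<forall>s\<in>{0..r}. X s \<omega> \<notin> - {a<..<b}} \<in> sets (F (ennreal r))" for r
    using sets_Collect_between[of r X "F (ennreal r)" a b]
    by (auto intro!: X_measurable_F continuous_paths ennreal_leI)
qed (simp add: closed_def)

definition lower_time :: "real \<Rightarrow> 'a \<Rightarrow> ennreal" where
  "lower_time c \<omega> = entry_time {..ereal c} (\<lambda>t. X t \<omega>)"

lemma stopping_time_lower_time: "stopping_time F (lower_time c)"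
  unfolding lower_time_def[abs_def]
proof (rule stopping_time_entry_time)
  show "{\<omega>\<in>space M. \<forall>s\<in>{0..r}. X s \<omega> \<notin> {..ereal c}} \<in> sets (F (ennreal r))" for r
    using sets_Collect_above[of r X "F (ennreal r)" "ereal c"]
    by (auto simp: not_le intro!: X_measurable_F continuous_paths ennreal_leI)
qed simp

text \<open>The Green kernel is at most \<open>S b - S a\<close> and the speed measure of
  \<open>[a, b]\<close> is finite, so the mean exit time is finite.\<close>

lemma AE_exit_finite:
  assumes a: "a \<in> I" and b: "b \<in> I" and ayb: "a < y" "y < b"
  shows "AE \<omega> in P y. inner_exit_time X (ereal a) (ereal b) \<omega> < \<infinity>"
proof -
  have y: "y \<in> I" using interior_states_convex[OF a b] ayb by simp
  have "(\<integral>\<^sup>+\<omega>. inner_exit_time X (ereal a) (ereal b) \<omega> \<partial>P y)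
    = (\<integral>\<^sup>+z\<in>{a<..<b}. ennreal ((S (min y z) - S a) * (S b - S (max y z)) / (S b - S a)) \<partial>m)"
    by (rule speed_exit[OF a b ayb])
  also have "\<dots> \<le> (\<integral>\<^sup>+z. ennreal (S b - S a) * indicator {a..b} z \<partial>m)"
  proof (rule nn_integral_mono)
    fix z
    show "ennreal ((S (min y z) - S a) * (S b - S (max y z)) / (S b - S a)) * indicator {a<..<b} z
      \<le> ennreal (S b - S a) * indicator {a..b} z"
    proof (cases "z \<in> {a<..<b}")
      case True
      have I: "min y z \<in> I" "max y z \<in> I" using interior_states_convex[OF a b] True ayb by (auto simp: min_def max_def)
      have d: "0 < S b - S a" using S_less[OF a b] ayb by simp
      have l: "0 \<le> S (min y z) - S a" "S (min y z) - S a \<le> S b - S a" "0 \<le> S b - S (max y z)" "S b - S (max y z) \<le> S b - S a"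
        using S_le_iff[OF a I(1)] S_le_iff[OF I(1) b] S_le_iff[OF a I(2)] S_le_iff[OF I(2) b] True ayb by auto
      have "(S (min y z) - S a) * (S b - S (max y z)) \<le> (S b - S a) * (S b - S a)"
        using l d by (intro mult_mono) auto
      then have "(S (min y z) - S a) * (S b - S (max y z)) / (S b - S a) \<le> S b - S a"
        using d by (simp add: pos_divide_le_eq)
      then show ?thesis using True by (simp add: ennreal_leI)
    qed simp
  qed
  also have "\<dots> = ennreal (S b - S a) * emeasure m {a..b}"
    by (rule nn_integral_cmult_indicator) (simp add: speed_sets)
  also have "\<dots> < \<infinity>" using speed_finite[OF a b] by (simp add: ennreal_mult_less_top infinity_ennreal_def)
  finally have fin: "(\<integral>\<^sup>+\<omega>. inner_exit_time X (ereal a) (ereal b) \<omega> \<partial>P y) \<noteq> \<infinity>" by simp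
  have "inner_exit_time X (ereal a) (ereal b) \<in> borel_measurable (P y)"
    using measurable_from_subalg[OF subalgebra_F[OF y] stopping_time_measurable_F[OF stopping_time_inner_exit_time]] .
  from nn_integral_noteq_infinite[OF this fin] show ?thesis
    by eventually_elim (simp add: top.not_eq_extremum infinity_ennreal_def)
qed

end

context lower_attracted_diffusion
begin

subsection \<open>Convergence to the lower end point\<close>

text \<open>A path that stays above \<open>c\<close> must leave each \<open>(c, b n)\<close> at the
  top, and the probability of ever reaching \<open>b n\<close> tends to 0.\<close>

lemma AE_lower_time_finite:
  assumes y: "y \<in> I" and c: "c \<in> I" and cy: "c < y"
  shows "AE \<omega> in P y. lower_time c \<omega> < \<infinity>"
proof -
  interpret prob_space "P y" by (rule prob_space_P[OF y])
  obtain a b :: "nat \<Rightarrow> real" where ab: "\<And>n. b n \<in> I" "filterlim (\<lambda>n. S (b n)) at_top sequentially"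
    "\<And>v. v \<in> I \<Longrightarrow> \<forall>\<^sub>F n in sequentially. a n < v \<and> v < b n" by (rule exhausting_states) blast
  define N where "N = {\<omega>\<in>space M. \<not> lower_time c \<omega> < \<infinity>}"
  have [measurable]: "lower_time c \<in> borel_measurable (P y)"
    using measurable_from_subalg[OF subalgebra_F[OF y] stopping_time_measurable_F[OF stopping_time_lower_time]] .
  have "{\<omega>\<in>space (P y). \<not> lower_time c \<omega> < \<infinity>} \<in> events" by measurable
  then have Ns: "N \<in> events" using y by (simp add: N_def)
  have "\<forall>\<^sub>F n in sequentially. prob N \<le> S y / S (b n)"
    using ab(3)[OF y]
  proof eventually_elim
    case (elim n)
    then have yb: "y < b n" by simp
    have "AE \<omega> in P y. \<omega> \<in> N \<longrightarrow> \<omega> \<in> reach (-\<infinity>) (b n)"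
      using AE_exit_finite[OF c ab(1) cy yb] AE_space
    proof eventually_elim
      case (elim \<omega>)
      then have \<omega>: "\<omega> \<in> space M" using y by simp
      show ?case
      proof
        assume "\<omega> \<in> N"
        then have inf: "\<not> lower_time c \<omega> < \<infinity>" by (simp add: N_def)
        have above: "ereal c < X s \<omega>" if "0 \<le> s" for s
          using entry_time_le[of s "\<lambda>t. X t \<omega>" "{..ereal c}"] inf that
          by (auto simp: lower_time_def not_less infinity_ennreal_def top_unique not_le[symmetric])
        obtain t where t: "0 \<le> t" "X t \<omega> \<in> - {ereal c<..<ereal (b n)}"
          using entry_time_attained[OF continuous_paths[OF \<omega>], of "- {ereal c<..<ereal (b n)}"] elim(1)
          by (auto simp: inner_exit_time_eq closed_def)
        have "-\<infinity> < X u \<omega>" if "0 \<le> u" for u using above[OF that] by (cases "X u \<omega>") auto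
        then have "reaches (-\<infinity>) (b n) (\<lambda>t. X t \<omega>)"
          unfolding reaches_def using t above[OF t(1)] by (intro exI[of _ t]) auto
        then show "\<omega> \<in> reach (-\<infinity>) (b n)" using \<omega> by simp
      qed
    qed
    then have "prob N \<le> prob (reach (-\<infinity>) (b n))"
      by (rule finite_measure_mono_AE) (use reaches_event y in auto)
    also have "\<dots> = S y / S (b n)" by (rule prob_reaches[OF y ab(1)]) (use elim in simp)
    finally show ?case .
  qed
  moreover have "(\<lambda>n. S y / S (b n)) \<longlonglongrightarrow> 0"
    by (intro real_tendsto_divide_at_top[OF tendsto_const] ab)
  ultimately have "prob N \<le> 0" by (intro tendsto_le[OF _ _ tendsto_const]) auto
  then have "N \<in> null_sets (P y)" using Ns by (simp add: null_sets_def emeasure_eq_measure measure_le_0_iff)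
  then show ?thesis by (rule AE_I') (auto simp: N_def y)
qed

text \<open>Strong Markov property at the first passage to \<open>c\<close>: returning from there to
  \<open>b\<close> has probability \<open>S c / S b\<close>, and a path that does not return stays
  below \<open>b\<close> from that passage on. The event is kept abstract because only its
  probability matters as \<open>c\<close> tends to \<alpha>.\<close>

lemma prob_reaches_after_lower_time:
  assumes y: "y \<in> I" and c: "c \<in> I" and b: "b \<in> I" and cy: "c < y" and cb: "c < b"
  obtains E where "E \<in> sets (P y)" "measure (P y) E = S c / S b"
    "AE \<omega> in P y. \<omega> \<in> E \<or> (\<forall>\<^sub>F t in at_top. X t \<omega> < ereal b)"
proof -
  interpret prob_space "P y" by (rule prob_space_P[OF y])
  \<comment> \<open>Starting above \<open>c\<close>, which holds almost surely, makes the path equal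
    to \<open>c\<close> at the passage time, not merely at most \<open>c\<close>.\<close>
  define A where "A = {\<omega>\<in>space M. ereal c < X 0 \<omega> \<and> lower_time c \<omega> < \<infinity>}"
  let ?T = "lower_time c"
  define B where "B = reaching_paths (-\<infinity>) b"
  define E where "E = {\<omega>\<in>A. path_from X (enn2real (?T \<omega>)) \<omega> \<in> B}"
  have X0: "AE \<omega> in P y. X 0 \<omega> = ereal y" by (rule start[OF y])
  have onA: "?T \<omega> < \<infinity>" "X (enn2real (?T \<omega>)) \<omega> = ereal c" if "\<omega> \<in> A" for \<omega>
  proof -
    have \<omega>: "\<omega> \<in> space M" "ereal c < X 0 \<omega>" "?T \<omega> < \<infinity>" using that by (auto simp: A_def)
    then show "?T \<omega> < \<infinity>" by simp
    obtain t where t: "0 \<le> t" "X t \<omega> \<in> {..ereal c}" "?T \<omega> = ennreal t" "\<And>s. 0 \<le> s \<Longrightarrow> s < t \<Longrightarrow> X s \<omega> \<notin> {..ereal c}"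
      using entry_time_attained[OF continuous_paths[OF \<omega>(1)], of "{..ereal c}"] \<omega>(3) by (auto simp: lower_time_def)
    have "continuous_on {0..t} (\<lambda>t. X t \<omega>)" by (rule continuous_on_subset[OF continuous_paths[OF \<omega>(1)]]) auto
    from IVT2'[OF _ _ t(1) this, of "ereal c"] obtain s where "0 \<le> s" "s \<le> t" "X s \<omega> = ereal c"
      using t(2) less_imp_le[OF \<omega>(2)] by auto
    then have "s = t" using t(4)[of s] by (cases "s < t") auto
    then show "X (enn2real (?T \<omega>)) \<omega> = ereal c" using \<open>X s \<omega> = ereal c\<close> t by simp
  qed
  have st: "stopping_time F ?T" by (rule stopping_time_lower_time)
  have "A \<in> sets (F.pre_sigma ?T)"
  proof (rule F.sets_pre_sigmaI[OF st])
    fix t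
    have [measurable]: "Measurable.pred (F t) (\<lambda>\<omega>. ?T \<omega> \<le> t)" by (rule stopping_timeD[OF st])
    have [measurable]: "X 0 \<in> F t \<rightarrow>\<^sub>M borel" by (rule X_measurable_F) auto
    \<comment> \<open>For finite \<open>t\<close> the bound on the passage time implies that it is
      finite; for \<open>t = \<infinity>\<close> the bound is void and finiteness has to be
      expressed separately.\<close>
    show "{\<omega> \<in> A. ?T \<omega> \<le> t} \<in> sets (F t)"
    proof (cases "t = \<infinity>")
      case False
      then have "{\<omega> \<in> A. ?T \<omega> \<le> t} = {\<omega>\<in>space (F t). ereal c < X 0 \<omega> \<and> ?T \<omega> \<le> t}"
        by (auto simp: A_def infinity_ennreal_def top.not_eq_extremum)
      also have "\<dots> \<in> sets (F t)" by measurable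
      finally show ?thesis .
    next
      case True
      have [measurable]: "?T \<in> F t \<rightarrow>\<^sub>M borel" unfolding True by (rule stopping_time_measurable_F[OF st])
      have "{\<omega> \<in> A. ?T \<omega> \<le> t} = {\<omega>\<in>space (F t). ereal c < X 0 \<omega> \<and> ?T \<omega> < \<infinity>}"
        using True by (auto simp: A_def)
      also have "\<dots> \<in> sets (F t)" by measurable
      finally show ?thesis .
    qed
  qed
  from strong_Markov[OF y st this _ reaching_paths_sets, of "-\<infinity>" b] onA I_D[OF c]
  have "emeasure (P y) E = (\<integral>\<^sup>+\<omega>\<in>A. emeasure (path_law P X (real_of_ereal (X (enn2real (?T \<omega>)) \<omega>))) B \<partial>P y)"
    by (simp add: E_def B_def)
  also have "\<dots> = (\<integral>\<^sup>+\<omega>. emeasure (path_law P X c) B \<partial>P y)"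
  proof (rule nn_integral_cong_AE)
    show "AE \<omega> in P y. emeasure (path_law P X (real_of_ereal (X (enn2real (?T \<omega>)) \<omega>))) B * indicator A \<omega> = emeasure (path_law P X c) B"
      using X0 AE_lower_time_finite[OF y c cy] AE_space
      by eventually_elim (use onA(2) y cy in \<open>auto simp: A_def indicator_def\<close>)
  qed
  also have "\<dots> = ennreal (S c / S b)"
  proof -
    interpret c: prob_space "P c" by (rule prob_space_P[OF c])
    show ?thesis using prob_reaches[OF c b cb]
      by (simp add: B_def path_law_reaching[OF c] c.emeasure_eq_measure emeasure_space_1)
  qed
  finally have eE: "emeasure (P y) E = ennreal (S c / S b)" .
  have pos: "0 < S c / S b" using S_pos[OF c] S_pos[OF b] by simp
  show ?thesis
  proof (rule that[of E])
    \<comment> \<open>A set outside the \<sigma>-algebra has measure 0 by default, so a nonzero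
      measure proves measurability.\<close>
    have "emeasure (P y) E \<noteq> 0" unfolding eE using S_pos[OF c] S_pos[OF b] by simp
    then show "E \<in> events" by (rule emeasure_neq_0_sets)
    show "prob E = S c / S b" using eE pos by (simp add: measure_def)
    show "AE \<omega> in P y. \<omega> \<in> E \<or> (\<forall>\<^sub>F t in at_top. X t \<omega> < ereal b)"
      using X0 AE_lower_time_finite[OF y c cy] AE_space
    proof eventually_elim
      case (elim \<omega>)
      then have \<omega>: "\<omega> \<in> space M" "\<omega> \<in> A" using y cy by (auto simp: A_def)
      show ?case
      proof (cases "\<omega> \<in> E")
        case False
        define t where "t = enn2real (?T \<omega>)"
        have t: "0 \<le> t" by (simp add: t_def)
        have nr: "\<not> reaches (-\<infinity>) b (\<lambda>s. X (t + s) \<omega>)"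
          using False \<omega> path_from_reaching[OF \<omega>(1) t] by (simp add: E_def B_def t_def)
        have "X s \<omega> < ereal b" if "t \<le> s" for s
        proof (rule ccontr)
          assume n: "\<not> X s \<omega> < ereal b"
          have "-\<infinity> < X (t + u) \<omega>" if "0 \<le> u" for u
            using X_ge_lower[OF \<omega>(1), of "t + u"] t that by (cases "X (t + u) \<omega>") auto
          then have "reaches (-\<infinity>) b (\<lambda>s. X (t + s) \<omega>)"
            unfolding reaches_def using n that by (intro exI[of _ "s - t"]) (auto simp: not_less)
          with nr show False by simp
        qed
        then show ?thesis by (auto simp: eventually_at_top_linorder)
      qed simp
    qed
  qed
qed

text \<open>The paths that fail to stay below \<open>b\<close> eventually lie, up to null sets, in
  all the events obtained for \<open>c = a n\<close>, whose probabilities tend to 0 with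
  \<open>S (a n)\<close>.\<close>

lemma AE_eventually_below:
  assumes y: "y \<in> I" and b: "b \<in> I"
  shows "AE \<omega> in P y. \<forall>\<^sub>F t in at_top. X t \<omega> < ereal b"
proof -
  interpret prob_space "P y" by (rule prob_space_P[OF y])
  obtain a b' :: "nat \<Rightarrow> real" where a: "\<And>n. a n \<in> I" "(\<lambda>n. S (a n)) \<longlonglongrightarrow> 0"
    "\<And>v. v \<in> I \<Longrightarrow> \<forall>\<^sub>F n in sequentially. a n < v \<and> v < b' n" by (rule exhausting_states) blast
  have "\<forall>\<^sub>F n in sequentially. a n < y \<and> a n < b" using a(3)[OF y] a(3)[OF b] by eventually_elim simp
  then obtain n0 where n0: "\<And>n. n0 \<le> n \<Longrightarrow> a n < y \<and> a n < b" by (auto simp: eventually_sequentially)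
  have "\<exists>E. E \<in> events \<and> prob E = S (a (n + n0)) / S b \<and>
    (AE \<omega> in P y. \<omega> \<in> E \<or> (\<forall>\<^sub>F t in at_top. X t \<omega> < ereal b))" for n
  proof -
    have "a (n + n0) < y" "a (n + n0) < b" using n0[of "n + n0"] by auto
    from prob_reaches_after_lower_time[OF y a(1) b this] show ?thesis by blast
  qed
  then have "\<exists>E. \<forall>n. E n \<in> events \<and> prob (E n) = S (a (n + n0)) / S b \<and>
    (AE \<omega> in P y. \<omega> \<in> E n \<or> (\<forall>\<^sub>F t in at_top. X t \<omega> < ereal b))"
    by (intro choice allI)
  then obtain E where E: "\<And>n. E n \<in> events" "\<And>n. prob (E n) = S (a (n + n0)) / S b"
    "\<And>n. AE \<omega> in P y. \<omega> \<in> E n \<or> (\<forall>\<^sub>F t in at_top. X t \<omega> < ereal b)" by blast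
  define N where "N = (\<Inter>n. E n)"
  have Ns: "N \<in> events" unfolding N_def using E(1) by blast
  have "(\<lambda>n. S (a (n + n0)) / S b) \<longlonglongrightarrow> 0 / S b"
    by (intro tendsto_divide LIMSEQ_ignore_initial_segment[OF a(2)] tendsto_const) (use S_pos[OF b] in simp)
  moreover have "prob N \<le> S (a (n + n0)) / S b" for n
    unfolding E(2)[symmetric] by (rule finite_measure_mono) (auto simp: N_def E)
  ultimately have "prob N \<le> 0" by (intro LIMSEQ_le_const) auto
  then have "N \<in> null_sets (P y)" using Ns by (simp add: null_sets_def emeasure_eq_measure measure_le_0_iff)
  then have "AE \<omega> in P y. \<omega> \<notin> N" by (rule AE_not_in)
  moreover have "AE \<omega> in P y. \<forall>n. \<omega> \<in> E n \<or> (\<forall>\<^sub>F t in at_top. X t \<omega> < ereal b)"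
    unfolding AE_all_countable using E(3) by blast
  ultimately show ?thesis by eventually_elim (auto simp: N_def)
qed

lemma AE_tendsto_lower:
  assumes y: "y \<in> I"
  shows "AE \<omega> in P y. ((\<lambda>t. X t \<omega>) \<longlongrightarrow> ereal \<alpha>) at_top"
proof -
  obtain a b' :: "nat \<Rightarrow> real" where a: "\<And>n. a n \<in> I"
    "\<And>v. v \<in> I \<Longrightarrow> \<forall>\<^sub>F n in sequentially. a n < v \<and> v < b' n" by (rule exhausting_states) blast
  have "AE \<omega> in P y. \<forall>n. \<forall>\<^sub>F t in at_top. X t \<omega> < ereal (a n)"
    using AE_eventually_below[OF y a(1)] by (simp add: AE_all_countable)
  then show ?thesis using AE_space
  proof eventually_elim
    case (elim \<omega>)
    then have \<omega>: "\<omega> \<in> space M" using y by simp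
    show ?case
    proof (rule order_tendstoI)
      fix l assume "l < ereal \<alpha>"
      then show "\<forall>\<^sub>F t in at_top. l < X t \<omega>"
        using X_ge_lower[OF \<omega>] by (intro eventually_at_top_linorderI[of 0]) (auto intro: less_le_trans)
    next
      fix u assume "ereal \<alpha> < u"
      then have "ereal \<alpha> < min u \<beta>" using nonempty by simp
      then obtain v where v: "ereal \<alpha> < ereal v" "ereal v < min u \<beta>" using ereal_dense2 by blast
      then have "v \<in> I" by (auto simp: interior_states_def)
      from a(2)[OF this] obtain n where n: "a n < v" by (auto simp: eventually_sequentially)
      show "\<forall>\<^sub>F t in at_top. X t \<omega> < u"
        using elim(1)[rule_format, of n]
      proof eventually_elim
        case (elim t)
        also have "ereal (a n) < ereal v" using n by simp
        also have "ereal v < u" using v by simp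
        finally show ?case .
      qed
    qed
  qed
qed

end

context lower_attracted_diffusion
begin

subsection \<open>Optional stopping\<close>

text \<open>
  The minimum of \<open>k / 2 ^ n\<close> and the grid point following \<open>\<tau>\<close>. The case distinction is needed because
  \<open>enn2real\<close> sends \<open>\<infinity>\<close> to \<open>0\<close>.
\<close>

definition step_time :: "('a \<Rightarrow> ennreal) \<Rightarrow> nat \<Rightarrow> nat \<Rightarrow> 'a \<Rightarrow> real" where
  "step_time \<tau> n k \<omega> = (if \<tau> \<omega> \<le> ennreal (real k / 2 ^ n) then grid_time n (enn2real (\<tau> \<omega>)) else real k / 2 ^ n)"

text \<open>If \<tau> lies beyond the \<open>k\<close>-th grid point, rounding up gives at least the
  next one, and the cap gives at most that.\<close>

lemma step_time_Suc:
  assumes "\<not> \<tau> \<omega> \<le> ennreal (real k / 2 ^ n)"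
  shows "step_time \<tau> n (Suc k) \<omega> = real (Suc k) / 2 ^ n"
proof (cases "\<tau> \<omega> \<le> ennreal (real (Suc k) / 2 ^ n)")
  case True
  then have "\<tau> \<omega> \<noteq> top" by (auto simp: top_unique)
  then obtain r where r: "0 \<le> r" "\<tau> \<omega> = ennreal r" by (cases "\<tau> \<omega>") auto
  have "r \<le> real (Suc k) / 2 ^ n" using True r by (subst (asm) r(2), subst (asm) ennreal_le_iff) auto
  then have "grid_time n r \<le> real (Suc k) / 2 ^ n" by (simp only: grid_time_le_iff)
  moreover have "\<not> r \<le> real k / 2 ^ n" using assms r by (auto intro: ennreal_leI)
  then have "\<not> grid_time n r \<le> real k / 2 ^ n" by (simp only: grid_time_le_iff not_False_eq_True)
  moreover obtain N where "grid_time n r = real N / 2 ^ n" by (simp add: grid_time_def)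
  ultimately have "N \<le> Suc k" "\<not> N \<le> k" by (simp_all add: divide_le_cancel del: of_nat_Suc)
  then have "grid_time n r = real (Suc k) / 2 ^ n" using \<open>grid_time n r = real N / 2 ^ n\<close> by (simp add: le_Suc_eq)
  then show ?thesis using True r by (simp add: step_time_def)
qed (simp add: step_time_def)

lemma step_time_Suc_stopped:
  assumes "\<tau> \<omega> \<le> ennreal (real k / 2 ^ n)"
  shows "step_time \<tau> n (Suc k) \<omega> = step_time \<tau> n k \<omega>"
proof -
  have "ennreal (real k / 2 ^ n) \<le> ennreal (real (Suc k) / 2 ^ n)"
    by (intro ennreal_leI divide_right_mono) auto
  then have "\<tau> \<omega> \<le> ennreal (real (Suc k) / 2 ^ n)" using assms by (rule order_trans[rotated])
  then show ?thesis using assms by (simp add: step_time_def)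
qed

lemma measurable_step_stopped:
  assumes "stopping_time G \<tau>"
  shows "(\<lambda>\<omega>. X (step_time \<tau> n k \<omega>) \<omega>) \<in> M \<rightarrow>\<^sub>M borel"
proof -
  have [measurable]: "\<tau> \<in> M \<rightarrow>\<^sub>M borel" by (rule stopping_time_measurable_G[OF assms])
  have [measurable]: "(\<lambda>\<omega>. X (grid_time n (enn2real (\<tau> \<omega>))) \<omega>) \<in> M \<rightarrow>\<^sub>M borel"
    by (rule measurable_grid_stopped[OF measurable_X]) auto
  have [measurable]: "X (real k / 2 ^ n) \<in> M \<rightarrow>\<^sub>M borel" by (rule measurable_X) simp
  have "(\<lambda>\<omega>. if \<tau> \<omega> \<le> ennreal (real k / 2 ^ n) then X (grid_time n (enn2real (\<tau> \<omega>))) \<omega> else X (real k / 2 ^ n) \<omega>) \<in> M \<rightarrow>\<^sub>M borel"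
    by measurable
  also have "(\<lambda>\<omega>. if \<tau> \<omega> \<le> ennreal (real k / 2 ^ n) then X (grid_time n (enn2real (\<tau> \<omega>))) \<omega> else X (real k / 2 ^ n) \<omega>)
    = (\<lambda>\<omega>. X (step_time \<tau> n k \<omega>) \<omega>)" by (auto simp: step_time_def)
  finally show ?thesis .
qed

text \<open>Discrete optional stopping: passing from \<open>k\<close> to \<open>k + 1\<close> moves
  only the paths with \<tau> beyond the \<open>k\<close>-th grid point, an event known at that
  point, where the supermartingale inequality applies.\<close>

lemma step_stopped_scale:
  assumes y: "y \<in> I" and \<tau>: "stopping_time G \<tau>"
  shows "(\<integral>\<^sup>+\<omega>. ext_scale (X (step_time \<tau> n k \<omega>) \<omega>) \<partial>P y) \<le> ennreal (S y)"
proof (induction k)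
  case 0
  interpret prob_space "P y" by (rule prob_space_P[OF y])
  have "step_time \<tau> n 0 \<omega> = 0" for \<omega> by (simp add: step_time_def grid_time_def)
  then have "(\<integral>\<^sup>+\<omega>. ext_scale (X (step_time \<tau> n 0 \<omega>) \<omega>) \<partial>P y) = (\<integral>\<^sup>+\<omega>. ennreal (S y) \<partial>P y)"
    using start[OF y] by (intro nn_integral_cong_AE) (auto simp: ext_scale_interior[OF y])
  then show ?case by (simp add: emeasure_space_1)
next
  case (Suc k)
  define D where "D = {\<omega>\<in>space M. ennreal (real k / 2 ^ n) < \<tau> \<omega>}"
  have DG: "D \<in> sets (G (ennreal (real k / 2 ^ n)))"
    using stopping_timeD2[OF \<tau>, of "ennreal (real k / 2 ^ n)"] by (simp add: pred_def D_def)
  have Ds: "D \<in> sets (P y)" using DG G_le_M y by auto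
  note [measurable] = Ds
  have m: "(\<lambda>\<omega>. X (step_time \<tau> n k \<omega>) \<omega>) \<in> P y \<rightarrow>\<^sub>M borel"
    "X (real (Suc k) / 2 ^ n) \<in> P y \<rightarrow>\<^sub>M borel" "X (real k / 2 ^ n) \<in> P y \<rightarrow>\<^sub>M borel"
    using measurable_step_stopped[OF \<tau>] measurable_X[of "real (Suc k) / 2 ^ n"] measurable_X[of "real k / 2 ^ n"] y
    by (auto simp only: measurable_P) auto
  note [measurable] = m
  have "(\<integral>\<^sup>+\<omega>. ext_scale (X (step_time \<tau> n (Suc k) \<omega>) \<omega>) \<partial>P y)
    = (\<integral>\<^sup>+\<omega>. indicator (space (P y) - D) \<omega> * ext_scale (X (step_time \<tau> n k \<omega>) \<omega>)
        + indicator D \<omega> * ext_scale (X (real (Suc k) / 2 ^ n) \<omega>) \<partial>P y)"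
  proof (rule nn_integral_cong)
    fix \<omega> assume "\<omega> \<in> space (P y)"
    then have "\<omega> \<in> space M" using y by simp
    then show "ext_scale (X (step_time \<tau> n (Suc k) \<omega>) \<omega>) = indicator (space (P y) - D) \<omega> * ext_scale (X (step_time \<tau> n k \<omega>) \<omega>)
        + indicator D \<omega> * ext_scale (X (real (Suc k) / 2 ^ n) \<omega>)"
      using step_time_Suc[of \<tau> \<omega> k n] step_time_Suc_stopped[of \<tau> \<omega> k n] y
      by (cases "\<omega> \<in> D") (auto simp: D_def not_le[symmetric] simp del: of_nat_Suc)
  qed
  also have "\<dots> = (\<integral>\<^sup>+\<omega>. indicator (space (P y) - D) \<omega> * ext_scale (X (step_time \<tau> n k \<omega>) \<omega>) \<partial>P y)
        + (\<integral>\<^sup>+\<omega>. indicator D \<omega> * ext_scale (X (real (Suc k) / 2 ^ n) \<omega>) \<partial>P y)"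
    by (rule nn_integral_add) measurable
  also have "\<dots> \<le> (\<integral>\<^sup>+\<omega>. indicator (space (P y) - D) \<omega> * ext_scale (X (step_time \<tau> n k \<omega>) \<omega>) \<partial>P y)
        + (\<integral>\<^sup>+\<omega>. indicator D \<omega> * ext_scale (X (real k / 2 ^ n) \<omega>) \<partial>P y)"
  proof (rule add_left_mono)
    have "real k / 2 ^ n + 1 / 2 ^ n = real (Suc k) / 2 ^ n" by (simp add: add_divide_distrib)
    with scale_supermartingale[OF y _ _ DG, of "1 / 2 ^ n"]
    show "(\<integral>\<^sup>+\<omega>. indicator D \<omega> * ext_scale (X (real (Suc k) / 2 ^ n) \<omega>) \<partial>P y)
      \<le> (\<integral>\<^sup>+\<omega>. indicator D \<omega> * ext_scale (X (real k / 2 ^ n) \<omega>) \<partial>P y)" by simp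
  qed
  also have "\<dots> = (\<integral>\<^sup>+\<omega>. indicator (space (P y) - D) \<omega> * ext_scale (X (step_time \<tau> n k \<omega>) \<omega>)
        + indicator D \<omega> * ext_scale (X (real k / 2 ^ n) \<omega>) \<partial>P y)"
    by (rule nn_integral_add[symmetric]) measurable
  also have "\<dots> = (\<integral>\<^sup>+\<omega>. ext_scale (X (step_time \<tau> n k \<omega>) \<omega>) \<partial>P y)"
  proof (rule nn_integral_cong)
    fix \<omega> assume "\<omega> \<in> space (P y)"
    then show "indicator (space (P y) - D) \<omega> * ext_scale (X (step_time \<tau> n k \<omega>) \<omega>)
        + indicator D \<omega> * ext_scale (X (real k / 2 ^ n) \<omega>) = ext_scale (X (step_time \<tau> n k \<omega>) \<omega>)"
      using y by (cases "\<omega> \<in> D") (auto simp: D_def step_time_def)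
  qed
  finally show ?case using Suc.IH by simp
qed

text \<open>The values at the rounded and capped times converge to the stopped value and Fatou's
  lemma applies. Where \<tau> is infinite, this uses that \<open>X\<close> converges to \<alpha>,
  which is then also the limsup that defines the stopped value.\<close>

lemma stopped_scale_le:
  assumes y: "y \<in> I" and \<tau>: "stopping_time G \<tau>"
  shows "(\<integral>\<^sup>+\<omega>. ext_scale (stopped X \<tau> \<omega>) \<partial>P y) \<le> ennreal (S y)"
proof -
  \<comment> \<open>With \<open>n * 2 ^ n\<close> steps of length \<open>1 / 2 ^ n\<close> the time
    horizon is \<open>n\<close>, so mesh and horizon improve together.\<close>
  define r where "r n \<omega> = step_time \<tau> n (n * 2 ^ n) \<omega>" for n \<omega>
  have r_eq: "r n \<omega> = (if \<tau> \<omega> \<le> ennreal (real n) then grid_time n (enn2real (\<tau> \<omega>)) else real n)" for n \<omega>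
    by (simp add: r_def step_time_def)
  have r_nn: "0 \<le> r n \<omega>" for n \<omega> by (simp add: r_eq grid_time_nonneg)
  have "(\<integral>\<^sup>+\<omega>. ext_scale (stopped X \<tau> \<omega>) \<partial>P y) \<le> (\<integral>\<^sup>+\<omega>. liminf (\<lambda>n. ext_scale (X (r n \<omega>) \<omega>)) \<partial>P y)"
  proof (rule nn_integral_mono_AE)
    show "AE \<omega> in P y. ext_scale (stopped X \<tau> \<omega>) \<le> liminf (\<lambda>n. ext_scale (X (r n \<omega>) \<omega>))"
      using AE_tendsto_lower[OF y] AE_space
    proof eventually_elim
      case (elim \<omega>)
      then have \<omega>: "\<omega> \<in> space M" using y by simp
      have "(\<lambda>n. X (r n \<omega>) \<omega>) \<longlonglongrightarrow> stopped X \<tau> \<omega>"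
      proof (cases "\<tau> \<omega> = \<infinity>")
        case True
        then have "\<not> \<tau> \<omega> \<le> ennreal (real n)" for n by (simp add: infinity_ennreal_def top_unique)
        then have "r n \<omega> = real n" for n by (simp add: r_eq)
        moreover have "stopped X \<tau> \<omega> = ereal \<alpha>" using True lim_imp_Limsup[OF _ elim(1)] by (simp add: stopped_def)
        ultimately show ?thesis using filterlim_compose[OF elim(1) filterlim_real_sequentially] by simp
      next
        case False
        define t where "t = enn2real (\<tau> \<omega>)"
        have t: "0 \<le> t" "\<tau> \<omega> = ennreal t" using False by (auto simp: t_def infinity_ennreal_def top.not_eq_extremum)
        obtain N where N: "t \<le> real N" using real_arch_simple by blast
        have "\<forall>\<^sub>F n in sequentially. grid_time n t = r n \<omega>"
          unfolding eventually_sequentially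
        proof (intro exI[of _ N] allI impI)
          fix n assume "N \<le> n"
          then have "\<tau> \<omega> \<le> ennreal (real n)" unfolding t(2) using N by (intro ennreal_leI) linarith
          then show "grid_time n t = r n \<omega>" by (simp add: r_eq t_def)
        qed
        then have "(\<lambda>n. r n \<omega>) \<longlonglongrightarrow> t" using grid_time_tendsto[OF t(1)] by (simp add: tendsto_cong)
        then have "(\<lambda>n. X (r n \<omega>) \<omega>) \<longlonglongrightarrow> X t \<omega>"
          by (rule continuous_on_tendsto_compose[OF continuous_paths[OF \<omega>]]) (use t r_nn in auto)
        then show ?thesis using False by (simp add: stopped_def t_def)
      qed
      then have "(\<lambda>n. ext_scale (X (r n \<omega>) \<omega>)) \<longlonglongrightarrow> ext_scale (stopped X \<tau> \<omega>)"
        by (rule continuous_on_tendsto_compose[OF ext_scale_continuous]) auto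
      then have "liminf (\<lambda>n. ext_scale (X (r n \<omega>) \<omega>)) = ext_scale (stopped X \<tau> \<omega>)"
        by (rule lim_imp_Liminf[rotated]) simp
      then show ?case by simp
    qed
  qed
  also have "\<dots> \<le> liminf (\<lambda>n. \<integral>\<^sup>+\<omega>. ext_scale (X (r n \<omega>) \<omega>) \<partial>P y)"
  proof (rule nn_integral_liminf)
    fix n show "(\<lambda>\<omega>. ext_scale (X (r n \<omega>) \<omega>)) \<in> borel_measurable (P y)"
      unfolding r_def measurable_P[OF y]
      by (rule measurable_compose[OF measurable_step_stopped[OF \<tau>] ext_scale_measurable])
  qed
  also have "\<dots> \<le> liminf (\<lambda>n::nat. ennreal (S y))"
    by (intro Liminf_mono always_eventually allI) (simp add: r_def step_stopped_scale[OF y \<tau>])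
  finally show ?thesis by (simp add: Liminf_const)
qed

end

section \<open>Exits from an interval and mixtures by independent randomization\<close>

lemma exit_attained:
  fixes a b :: ereal
  assumes w: "continuous_on {0..} w" and w0: "a < w 0" "w 0 < b" and fin: "entry_time (- {a<..<b}) w < \<infinity>"
  obtains t where "0 \<le> t" "entry_time (- {a<..<b}) w = ennreal t" "w t = a \<or> w t = b"
    "\<forall>s\<in>{0..<t}. w s \<in> {a<..<b}"
proof -
  have "closed (- {a<..<b})" by (simp add: closed_def)
  from entry_time_attained[OF w this fin]
  obtain t where t: "0 \<le> t" "w t \<in> - {a<..<b}" "entry_time (- {a<..<b}) w = ennreal t"
    "\<And>s. 0 \<le> s \<Longrightarrow> s < t \<Longrightarrow> w s \<notin> - {a<..<b}" by blast
  have c: "continuous_on {0..t} w" by (rule continuous_on_subset[OF w]) auto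
  have inside: "w s \<in> {a<..<b}" if "0 \<le> s" "s < t" for s using t(4)[OF that] by simp
  have "w t \<le> a \<or> b \<le> w t" using t(2) by auto
  then have "w t = a \<or> w t = b"
  proof
    assume "w t \<le> a"
    from IVT2'[OF this less_imp_le[OF w0(1)] t(1) c] obtain s where s: "0 \<le> s" "s \<le> t" "w s = a" by blast
    have "\<not> s < t"
    proof
      assume "s < t"
      from inside[OF s(1) this] s(3) show False by simp
    qed
    then have "s = t" using s(2) by linarith
    then show ?thesis using s by simp
  next
    assume "b \<le> w t"
    from IVT'[OF less_imp_le[OF w0(2)] this t(1) c] obtain s where s: "0 \<le> s" "s \<le> t" "w s = b" by blast
    have "\<not> s < t"
    proof
      assume "s < t"
      from inside[OF s(1) this] s(3) show False by simp
    qed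
    then have "s = t" using s(2) by linarith
    then show ?thesis using s by simp
  qed
  then show ?thesis using t(1,3) inside by (intro that[of t]) auto
qed

text \<open>Identifies the event of leaving at the upper end with the event whose probability is
  known from the scale function. With \<open>a = \<alpha>\<close> the exit may never occur, hence
  the explicit finiteness.\<close>

lemma reaches_iff_exit:
  assumes w: "continuous_on {0..} w" and w0: "a < w 0" "w 0 < ereal b"
  shows "reaches a b w \<longleftrightarrow> entry_time (- {a<..<ereal b}) w < \<infinity> \<and> w (enn2real (entry_time (- {a<..<ereal b}) w)) = ereal b"
proof
  assume "reaches a b w"
  then obtain s where s: "0 \<le> s" "ereal b \<le> w s" "\<And>u. 0 \<le> u \<Longrightarrow> u \<le> s \<Longrightarrow> a < w u" by (auto simp: reaches_def)
  have le: "entry_time (- {a<..<ereal b}) w \<le> ennreal s" using s by (intro entry_time_le) auto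
  then have fin: "entry_time (- {a<..<ereal b}) w < \<infinity>" by (rule le_less_trans) simp
  obtain t where t: "0 \<le> t" "entry_time (- {a<..<ereal b}) w = ennreal t"
    "w t = a \<or> w t = ereal b" "\<forall>s\<in>{0..<t}. w s \<in> {a<..<ereal b}"
    by (rule exit_attained[OF w w0 fin])
  have "t \<le> s" using le t s by simp
  then have "w t = ereal b" using s(3)[OF t(1)] t(3) by auto
  then show "entry_time (- {a<..<ereal b}) w < \<infinity> \<and> w (enn2real (entry_time (- {a<..<ereal b}) w)) = ereal b"
    using fin t by simp
next
  assume r: "entry_time (- {a<..<ereal b}) w < \<infinity> \<and> w (enn2real (entry_time (- {a<..<ereal b}) w)) = ereal b"
  then have fin: "entry_time (- {a<..<ereal b}) w < \<infinity>" by simp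
  obtain t where t: "0 \<le> t" "entry_time (- {a<..<ereal b}) w = ennreal t"
    "w t = a \<or> w t = ereal b" "\<forall>s\<in>{0..<t}. w s \<in> {a<..<ereal b}"
    by (rule exit_attained[OF w w0 fin])
  have wt: "w t = ereal b" using r t by simp
  have "a < w u" if "u \<in> {0..t}" for u
  proof (cases "u = t")
    case True
    then show ?thesis using wt w0 by simp
  next
    case False
    then show ?thesis using t(4) that by auto
  qed
  then show "reaches a b w" unfolding reaches_def using t wt by (intro exI[of _ t]) auto
qed

context linear_diffusion
begin

lemma emeasure_U_less:
  assumes y: "y \<in> I" and p: "0 \<le> p" "p \<le> 1"
  shows "emeasure (P y) (U -` {..<p} \<inter> space M) = ennreal p"
    and "emeasure (P y) (U -` {p..} \<inter> space M) = ennreal (1 - p)"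
proof -
  interpret prob_space "P y" by (rule prob_space_P[OF y])
  have mU: "U \<in> P y \<rightarrow>\<^sub>M borel" using measurable_U measurable_cong_sets[OF sets_P[OF y] refl] by blast
  have U: "emeasure (P y) (U -` A \<inter> space M) = emeasure lborel ({0..1} \<inter> A)" if "A \<in> sets borel" for A
  proof -
    have "emeasure (P y) (U -` A \<inter> space M) = emeasure (distr (P y) borel U) A"
      using emeasure_distr[OF mU that] y by simp
    also have "\<dots> = emeasure lborel ({0..1} \<inter> A) / emeasure lborel {0..1::real}"
      unfolding uniform[OF y] using that by (intro emeasure_uniform_measure) auto
    finally show ?thesis by (simp add: divide_ennreal_def)
  qed
  have "{0..1} \<inter> {..<p} = {0..<p}" using p by auto
  then show "emeasure (P y) (U -` {..<p} \<inter> space M) = ennreal p" using U[of "{..<p}"] p by simp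
  have "{0..1} \<inter> {p..} = {p..1}" using p by auto
  then show "emeasure (P y) (U -` {p..} \<inter> space M) = ennreal (1 - p)" using U[of "{p..}"] p by simp
qed

lemma stopping_time_mix:
  assumes "stopping_time F T1" "stopping_time F T2"
  shows "stopping_time G (mix_times U p T1 T2)"
proof
  fix t
  have U: "U \<in> G t \<rightarrow>\<^sub>M borel" by (rule measurableI) (auto simp: U_in_G)
  note [measurable] = U stopping_timeD[OF stopping_time_F_imp_G[OF assms(1)], of t]
    stopping_timeD[OF stopping_time_F_imp_G[OF assms(2)], of t]
  have "Measurable.pred (G t) (\<lambda>\<omega>. (U \<omega> < p \<and> T1 \<omega> \<le> t) \<or> (\<not> U \<omega> < p \<and> T2 \<omega> \<le> t))" by measurable
  also have "(\<lambda>\<omega>. (U \<omega> < p \<and> T1 \<omega> \<le> t) \<or> (\<not> U \<omega> < p \<and> T2 \<omega> \<le> t)) = (\<lambda>\<omega>. mix_times U p T1 T2 \<omega> \<le> t)"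
    by (auto simp: mix_times_def)
  finally show "Measurable.pred (G t) (\<lambda>\<omega>. mix_times U p T1 T2 \<omega> \<le> t)" .
qed

text \<open>Both components are stopping times of the natural filtration, hence independent of
  \<open>U\<close>, and the integral splits along \<open>U < p\<close>.\<close>

lemma nn_integral_stopped_mix:
  assumes y: "y \<in> I" and p: "0 \<le> p" "p \<le> 1" and T: "stopping_time F T1" "stopping_time F T2"
    and f: "f \<in> borel_measurable borel"
  shows "(\<integral>\<^sup>+\<omega>. f (stopped X (mix_times U p T1 T2) \<omega>) \<partial>P y) =
    ennreal p * (\<integral>\<^sup>+\<omega>. f (stopped X T1 \<omega>) \<partial>P y) + ennreal (1 - p) * (\<integral>\<^sup>+\<omega>. f (stopped X T2 \<omega>) \<partial>P y)"
proof -
  let ?C = "U -` {..<p} \<inter> space M" and ?D = "U -` {p..} \<inter> space M"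
  have Z: "(\<lambda>\<omega>. f (stopped X T1 \<omega>)) \<in> borel_measurable (F \<infinity>)" "(\<lambda>\<omega>. f (stopped X T2 \<omega>)) \<in> borel_measurable (F \<infinity>)"
    using measurable_compose[OF stopped_measurable_F f] T by auto
  have [measurable]: "?C \<in> sets (P y)" "?D \<in> sets (P y)"
    using U_in_G[of "{..<p}" 0] U_in_G[of "{p..}" 0] G_le_M[of 0] y by auto
  note [measurable] = Z[THEN measurable_from_subalg[OF subalgebra_F[OF y]]]
  have "(\<integral>\<^sup>+\<omega>. f (stopped X (mix_times U p T1 T2) \<omega>) \<partial>P y)
    = (\<integral>\<^sup>+\<omega>. indicator ?C \<omega> * f (stopped X T1 \<omega>) + indicator ?D \<omega> * f (stopped X T2 \<omega>) \<partial>P y)"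
    by (rule nn_integral_cong) (use y in \<open>auto simp: stopped_def mix_times_def indicator_def\<close>)
  also have "\<dots> = (\<integral>\<^sup>+\<omega>. indicator ?C \<omega> * f (stopped X T1 \<omega>) \<partial>P y) + (\<integral>\<^sup>+\<omega>. indicator ?D \<omega> * f (stopped X T2 \<omega>) \<partial>P y)"
    by (rule nn_integral_add) measurable
  also have "\<dots> = ennreal p * (\<integral>\<^sup>+\<omega>. f (stopped X T1 \<omega>) \<partial>P y) + ennreal (1 - p) * (\<integral>\<^sup>+\<omega>. f (stopped X T2 \<omega>) \<partial>P y)"
    using nn_integral_indep[OF y _ Z(1), of "{..<p}"] nn_integral_indep[OF y _ Z(2), of "{p..}"]
    by (simp add: emeasure_U_less[OF y p])
  finally show ?thesis .
qed

end

context lower_attracted_diffusion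
begin

subsection \<open>Two-point laws\<close>

text \<open>The weight \<open>q\<close> belongs to \<open>b\<close>. Testing against nonnegative
  functions avoids integrability, \<open>a = b\<close> covers stopping at once, and the natural
  filtration is required so that mixing with \<open>U\<close> is possible.\<close>

definition two_point_law :: "real \<Rightarrow> ('a \<Rightarrow> ennreal) \<Rightarrow> real \<Rightarrow> real \<Rightarrow> real \<Rightarrow> bool" where
  "two_point_law y T a b q \<longleftrightarrow> stopping_time F T \<and> 0 \<le> q \<and> q \<le> 1 \<and>
    (\<forall>f::ereal \<Rightarrow> ennreal. f \<in> borel_measurable borel \<longrightarrow>
      (\<integral>\<^sup>+\<omega>. f (stopped X T \<omega>) \<partial>P y) = ennreal (1 - q) * f (ereal a) + ennreal q * f (ereal b))"

lemma two_point_law_cong: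
  assumes y: "y \<in> I" and eq: "\<And>\<omega>. \<omega> \<in> space M \<Longrightarrow> T \<omega> = T' \<omega>" and T: "two_point_law y T' a b q"
  shows "two_point_law y T a b q"
proof -
  have "stopping_time F T" using T stopping_time_cong[of F T T'] eq by (simp add: two_point_law_def)
  moreover have "(\<integral>\<^sup>+\<omega>. f (stopped X T \<omega>) \<partial>P y) = (\<integral>\<^sup>+\<omega>. f (stopped X T' \<omega>) \<partial>P y)" for f :: "ereal \<Rightarrow> ennreal"
    by (rule nn_integral_cong) (use y eq in \<open>simp add: stopped_def\<close>)
  ultimately show ?thesis using T by (simp add: two_point_law_def)
qed

lemma stopped_measurable_P: "y \<in> I \<Longrightarrow> stopping_time F T \<Longrightarrow> stopped X T \<in> P y \<rightarrow>\<^sub>M borel"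
  by (simp add: measurable_P stopped_measurable_M stopping_time_F_imp_G)

lemma two_point_lawI:
  assumes y: "y \<in> I" and T: "stopping_time F T" and ab: "a \<noteq> b"
    and AE: "AE \<omega> in P y. stopped X T \<omega> = ereal a \<or> stopped X T \<omega> = ereal b"
    and q: "measure (P y) {\<omega>\<in>space M. stopped X T \<omega> = ereal b} = q"
  shows "two_point_law y T a b q"
  unfolding two_point_law_def
proof (intro conjI allI impI)
  interpret prob_space "P y" by (rule prob_space_P[OF y])
  note [measurable] = stopped_measurable_P[OF y T]
  let ?E = "{\<omega>\<in>space M. stopped X T \<omega> = ereal b}"
  have "{\<omega>\<in>space (P y). stopped X T \<omega> = ereal b} \<in> events" by measurable
  then have E[measurable]: "?E \<in> events" using y by simp
  have [measurable]: "space (P y) - ?E \<in> events" by auto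
  show "stopping_time F T" by fact
  show "0 \<le> q" "q \<le> 1" using q by auto
  fix f :: "ereal \<Rightarrow> ennreal" assume "f \<in> borel_measurable borel"
  have "(\<integral>\<^sup>+\<omega>. f (stopped X T \<omega>) \<partial>P y) = (\<integral>\<^sup>+\<omega>. f (ereal a) * indicator (space (P y) - ?E) \<omega> + f (ereal b) * indicator ?E \<omega> \<partial>P y)"
  proof (rule nn_integral_cong_AE)
    show "AE \<omega> in P y. f (stopped X T \<omega>) = f (ereal a) * indicator (space (P y) - ?E) \<omega> + f (ereal b) * indicator ?E \<omega>"
      using AE AE_space by eventually_elim (use ab y in \<open>auto simp: indicator_def\<close>)
  qed
  also have "\<dots> = f (ereal a) * emeasure (P y) (space (P y) - ?E) + f (ereal b) * emeasure (P y) ?E"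
    by (subst nn_integral_add) (auto simp: nn_integral_cmult_indicator E)
  also have "emeasure (P y) (space (P y) - ?E) = ennreal (1 - q)"
    using prob_compl[OF E] q by (simp add: emeasure_eq_measure)
  also have "emeasure (P y) ?E = ennreal q" using q by (simp add: emeasure_eq_measure)
  finally show "(\<integral>\<^sup>+\<omega>. f (stopped X T \<omega>) \<partial>P y) = ennreal (1 - q) * f (ereal a) + ennreal q * f (ereal b)"
    by (simp add: mult.commute)
qed

lemma two_point_law_trivial:
  assumes y: "y \<in> I" and out: "ereal y \<notin> {a<..<b}"
  shows "two_point_law y (inner_exit_time X a b) y y 0"
  unfolding two_point_law_def
proof (intro conjI allI impI)
  interpret prob_space "P y" by (rule prob_space_P[OF y])
  fix f :: "ereal \<Rightarrow> ennreal"
  have "(\<integral>\<^sup>+\<omega>. f (stopped X (inner_exit_time X a b) \<omega>) \<partial>P y) = (\<integral>\<^sup>+\<omega>. f (ereal y) \<partial>P y)"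
  proof (rule nn_integral_cong_AE)
    show "AE \<omega> in P y. f (stopped X (inner_exit_time X a b) \<omega>) = f (ereal y)"
      using start[OF y]
    proof eventually_elim
      case (elim \<omega>)
      have "inner_exit_time X a b \<omega> = 0"
        using entry_time_le[of 0 "\<lambda>t. X t \<omega>" "- {a<..<b}"] elim out by (simp add: inner_exit_time_eq)
      then show ?case using elim by (simp add: stopped_def infinity_ennreal_def)
    qed
  qed
  then show "(\<integral>\<^sup>+\<omega>. f (stopped X (inner_exit_time X a b) \<omega>) \<partial>P y) = ennreal (1 - 0) * f (ereal y) + ennreal 0 * f (ereal y)"
    by (simp add: emeasure_space_1)
qed (simp_all add: stopping_time_inner_exit_time)

definition scale0 :: "real \<Rightarrow> real" where
  "scale0 y = (if y = \<alpha> then 0 else S y)"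

text \<open>For interior \<open>a\<close> the exit is almost surely finite. For
  \<open>a = \<alpha>\<close> it may be infinite, but then the path converges to \<alpha> and the
  stopped value is again the lower end.\<close>

lemma two_point_law_inner_exit:
  assumes y: "y \<in> I" and b: "b \<in> I" and a: "\<alpha> \<le> a" and ay: "a < y" and yb: "y < b"
  shows "two_point_law y (inner_exit_time X (ereal a) (ereal b)) a b ((S y - scale0 a) / (S b - scale0 a))"
proof (rule two_point_lawI[OF y stopping_time_inner_exit_time])
  interpret prob_space "P y" by (rule prob_space_P[OF y])
  let ?T = "inner_exit_time X (ereal a) (ereal b)"
  have aI: "a \<in> I" if "a \<noteq> \<alpha>"
    using a ay y that by (auto simp: interior_states_def intro: less_trans[of "ereal a" "ereal y"])
  show "a \<noteq> b" using ay yb by simp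
  have fin: "AE \<omega> in P y. ?T \<omega> < \<infinity> \<or> a = \<alpha>"
  proof (cases "a = \<alpha>")
    case False
    then show ?thesis using AE_exit_finite[OF aI b ay yb] by auto
  qed simp
  have AE: "AE \<omega> in P y. (stopped X ?T \<omega> = ereal a \<or> stopped X ?T \<omega> = ereal b) \<and>
      (stopped X ?T \<omega> = ereal b \<longleftrightarrow> reaches (ereal a) b (\<lambda>t. X t \<omega>))"
    using fin start[OF y] AE_tendsto_lower[OF y] AE_space
  proof eventually_elim
    case (elim \<omega>)
    then have \<omega>: "\<omega> \<in> space M" using y by simp
    have w0: "ereal a < X 0 \<omega>" "X 0 \<omega> < ereal b" using elim(2) ay yb by auto
    note r = reaches_iff_exit[OF continuous_paths[OF \<omega>] w0]
    show ?case
    proof (cases "?T \<omega> < \<infinity>")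
      case True
      obtain t where t: "0 \<le> t" "?T \<omega> = ennreal t" "X t \<omega> = ereal a \<or> X t \<omega> = ereal b"
        using exit_attained[OF continuous_paths[OF \<omega>] w0, of thesis] True unfolding inner_exit_time_eq by metis
      then show ?thesis using r True by (auto simp: stopped_def inner_exit_time_eq[symmetric] infinity_ennreal_def)
    next
      case False
      then have inf: "?T \<omega> = \<infinity>" by (metis infinity_ennreal_def top.not_eq_extremum)
      have "stopped X ?T \<omega> = ereal \<alpha>" using inf lim_imp_Limsup[OF _ elim(3)] by (simp add: stopped_def)
      then show ?thesis using False elim(1) r ay yb by (auto simp: inner_exit_time_eq[symmetric])
    qed
  qed
  then show "AE \<omega> in P y. stopped X ?T \<omega> = ereal a \<or> stopped X ?T \<omega> = ereal b" by auto
  have "prob {\<omega>\<in>space M. stopped X ?T \<omega> = ereal b} = prob (reach (ereal a) b)"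
  proof (rule measure_eq_AE)
    show "AE \<omega> in P y. \<omega> \<in> {\<omega>\<in>space M. stopped X ?T \<omega> = ereal b} \<longleftrightarrow> \<omega> \<in> reach (ereal a) b"
      using AE by eventually_elim auto
    have [measurable]: "stopped X ?T \<in> P y \<rightarrow>\<^sub>M borel" by (rule stopped_measurable_P[OF y stopping_time_inner_exit_time])
    have "{\<omega>\<in>space (P y). stopped X ?T \<omega> = ereal b} \<in> events" by measurable
    then show "{\<omega>\<in>space M. stopped X ?T \<omega> = ereal b} \<in> events" using y by simp
    show "reach (ereal a) b \<in> events" using reaches_event y by simp
  qed
  also have "\<dots> = (S y - scale0 a) / (S b - scale0 a)"
  proof (cases "a = \<alpha>")
    case True
    have "reaches (ereal \<alpha>) b (\<lambda>t. X t \<omega>) \<longleftrightarrow> reaches (-\<infinity>) b (\<lambda>t. X t \<omega>)" if \<omega>: "\<omega> \<in> space M" for \<omega>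
    proof
      assume "reaches (-\<infinity>) b (\<lambda>t. X t \<omega>)"
      then obtain s where s: "0 \<le> s" "ereal b \<le> X s \<omega>" by (auto simp: reaches_def)
      have "X s \<omega> \<noteq> ereal \<alpha>" using s(2) I_D(1)[OF b] by auto
      then show "reaches (ereal \<alpha>) b (\<lambda>t. X t \<omega>)"
        unfolding reaches_def using s X_above_before[OF \<omega>, of _ s] by (intro exI[of _ s]) auto
    next
      assume "reaches (ereal \<alpha>) b (\<lambda>t. X t \<omega>)"
      then obtain s where s: "0 \<le> s" "ereal b \<le> X s \<omega>" "\<forall>u\<in>{0..s}. ereal \<alpha> < X u \<omega>" by (auto simp: reaches_def)
      have "-\<infinity> < X u \<omega>" if "u \<in> {0..s}" for u
        by (rule less_trans[of _ "ereal \<alpha>"]) (use s(3) that in auto)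
      then show "reaches (-\<infinity>) b (\<lambda>t. X t \<omega>)" unfolding reaches_def using s by blast
    qed
    then have "reach (ereal a) b = reach (-\<infinity>) b"
      unfolding True by (intro Collect_cong conj_cong refl)
    then show ?thesis using prob_reaches[OF y b yb] True by (simp add: scale0_def)
  next
    case False
    then show ?thesis using prob_reaches_above[OF aI b ay yb] by (simp add: scale0_def)
  qed
  finally show "prob {\<omega>\<in>space M. stopped X ?T \<omega> = ereal b} = (S y - scale0 a) / (S b - scale0 a)" .
qed

text \<open>The exit times from smaller intervals cannot exceed the one from the interval down to
  \<alpha>. Conversely, before that exit the path stays above some rational
  \<open>c > \<alpha>\<close> on each compact time interval, so every barrier below \<open>c\<close>
  is still untouched.\<close>

lemma exit_time_lower:
  assumes \<omega>: "\<omega> \<in> space M" and z: "\<alpha> < z"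
  shows "exit_time X (ereal \<alpha>) (ereal \<alpha>) (ereal z) \<omega> = inner_exit_time X (ereal \<alpha>) (ereal z) \<omega>"
proof -
  define w where "w t = X t \<omega>" for t
  have w: "continuous_on {0..} w" using continuous_paths[OF \<omega>] by (simp add: w_def)
  define L where "L = entry_time (- {ereal \<alpha><..<ereal z}) w"
  have cl: "closed (- {a<..<b})" for a b :: ereal by (simp add: closed_def)
  have nonbot: "at_right (ereal \<alpha>) \<noteq> bot" by (rule at_right_ereal_neq_bot[of _ \<infinity>]) simp
  have mono: "entry_time (- {a<..<ereal z}) w \<le> L" if "ereal \<alpha> < a" for a
    unfolding L_def entry_time_def by (rule INF_superset_mono) (use that in \<open>auto intro: less_trans\<close>)
  have "((\<lambda>a. entry_time (- {a<..<ereal z}) w) \<longlongrightarrow> L) (at_right (ereal \<alpha>))"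
  proof (rule order_tendstoI)
    fix u assume "L < u"
    then have "\<forall>a>ereal \<alpha>. entry_time (- {a<..<ereal z}) w < u" using mono by (auto intro: le_less_trans)
    then show "\<forall>\<^sub>F a in at_right (ereal \<alpha>). entry_time (- {a<..<ereal z}) w < u"
      by (auto simp: eventually_at_filter)
  next
    fix l assume "l < L"
    then obtain l' where l': "l < l'" "l' < L" using dense by blast
    then have "l' \<noteq> top" by auto
    then obtain r where r: "0 \<le> r" "l' = ennreal r" by (cases l') auto
    have "\<not> L \<le> ennreal r" using l' r by simp
    then have inside: "\<forall>s\<in>{0..r}. w s \<in> {ereal \<alpha><..<ereal z}"
      unfolding L_def entry_time_le_iff[OF w cl r(1)] by auto
    then have "\<forall>s\<in>{0..r}. ereal \<alpha> < w s" by auto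
    then obtain c :: rat where c: "ereal \<alpha> < ereal (of_rat c)"
      "\<forall>q::rat. \<bar>of_rat q\<bar> \<le> r \<longrightarrow> ereal (of_rat c) \<le> w \<bar>of_rat q\<bar>"
      unfolding above_iff_rational[OF w r(1)] by blast
    have "l < entry_time (- {a<..<ereal z}) w" if a: "a < ereal (of_rat c)" for a
    proof -
      have "\<forall>s\<in>{0..r}. a < w s" unfolding above_iff_rational[OF w r(1)] using c(2) a by blast
      then have "\<not> entry_time (- {a<..<ereal z}) w \<le> ennreal r"
        unfolding entry_time_le_iff[OF w cl r(1)] using inside by auto
      then show ?thesis using l' r by (auto simp: not_le)
    qed
    then show "\<forall>\<^sub>F a in at_right (ereal \<alpha>). l < entry_time (- {a<..<ereal z}) w"
      unfolding eventually_at_right[OF c(1)] using c(1) by blast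
  qed
  from tendsto_Lim[OF nonbot this] show ?thesis
    by (simp add: exit_time_def inner_exit_time_eq w_def[symmetric] L_def)
qed

lemma exit_time_eq_inner:
  assumes "\<omega> \<in> space M" "\<alpha> < z"
  shows "exit_time X (ereal \<alpha>) (ereal a) (ereal z) \<omega> = inner_exit_time X (ereal a) (ereal z) \<omega>"
  using exit_time_lower[OF assms] by (cases "a = \<alpha>") (auto simp: exit_time_def)

lemma two_point_law_exit:
  assumes "y \<in> I" "b \<in> I" "\<alpha> \<le> a" "a < y" "y < b"
  shows "two_point_law y (exit_time X (ereal \<alpha>) (ereal a) (ereal b)) a b ((S y - scale0 a) / (S b - scale0 a))"
  by (rule two_point_law_cong[OF assms(1) exit_time_eq_inner two_point_law_inner_exit[OF assms]])
     (use assms in \<open>auto simp: interior_states_def\<close>)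

lemma two_point_law_exit_trivial:
  assumes "y \<in> I"
  shows "two_point_law y (exit_time X (ereal \<alpha>) (ereal a) (ereal y)) y y 0"
  by (rule two_point_law_cong[OF assms exit_time_eq_inner two_point_law_trivial[OF assms]])
     (use assms in \<open>auto simp: interior_states_def\<close>)

subsection \<open>Mean and variance of stopped values\<close>

text \<open>The scale of the stopped value has finite expectation, which rules out \<beta>, the only
  place where a value could be infinite.\<close>

lemma AE_stopped_real:
  assumes y: "y \<in> I" and \<tau>: "stopping_time G \<tau>"
  shows "AE \<omega> in P y. stopped X \<tau> \<omega> = ereal (real_of_ereal (stopped X \<tau> \<omega>)) \<and>
    \<alpha> \<le> real_of_ereal (stopped X \<tau> \<omega>) \<and> ereal (real_of_ereal (stopped X \<tau> \<omega>)) < \<beta>"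
proof -
  have "(\<lambda>\<omega>. ext_scale (stopped X \<tau> \<omega>)) \<in> borel_measurable (P y)"
    unfolding measurable_P[OF y] by (rule measurable_compose[OF stopped_measurable_M[OF \<tau>] ext_scale_measurable])
  moreover have "(\<integral>\<^sup>+\<omega>. ext_scale (stopped X \<tau> \<omega>) \<partial>P y) \<noteq> \<infinity>"
    using stopped_scale_le[OF y \<tau>] le_less_trans[OF _ ennreal_less_infinity] by fastforce
  ultimately have "AE \<omega> in P y. ext_scale (stopped X \<tau> \<omega>) \<noteq> \<infinity>" by (rule nn_integral_noteq_infinite)
  then show ?thesis using AE_space
  proof eventually_elim
    case (elim \<omega>)
    then have \<omega>: "\<omega> \<in> space M" using y by simp
    have "ereal \<alpha> \<le> Limsup at_top (\<lambda>t. X t \<omega>)"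
      by (rule le_Limsup) (use X_ge_lower[OF \<omega>] in \<open>auto intro!: eventually_at_top_linorderI[of 0]\<close>)
    then have "ereal \<alpha> \<le> stopped X \<tau> \<omega>" using X_ge_lower[OF \<omega>] by (simp add: stopped_def)
    moreover have "stopped X \<tau> \<omega> < \<beta>" using elim(1) nonempty by (auto simp: ext_scale_def split: if_splits)
    ultimately show ?case by (cases "stopped X \<tau> \<omega>") auto
  qed
qed

text \<open>Subtracting \<alpha> makes the value nonnegative almost surely, so that its nonnegative
  integral yields both integrability and the mean.\<close>

lemma stopped_mean_eqI:
  assumes y: "y \<in> I" and \<tau>: "stopping_time G \<tau>" and v: "\<alpha> \<le> v"
    and nn: "(\<integral>\<^sup>+\<omega>. ennreal (real_of_ereal (stopped X \<tau> \<omega>) - \<alpha>) \<partial>P y) = ennreal (v - \<alpha>)"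
  shows "stopped_mean P X y \<tau> = v"
proof -
  interpret prob_space "P y" by (rule prob_space_P[OF y])
  define Z where "Z \<omega> = real_of_ereal (stopped X \<tau> \<omega>)" for \<omega>
  have "stopped X \<tau> \<in> P y \<rightarrow>\<^sub>M borel" using stopped_measurable_M[OF \<tau>] by (simp add: measurable_P[OF y])
  then have [measurable]: "Z \<in> borel_measurable (P y)" unfolding Z_def by measurable
  have nn0: "AE \<omega> in P y. 0 \<le> Z \<omega> - \<alpha>" using AE_stopped_real[OF y \<tau>] by eventually_elim (simp add: Z_def)
  have nn': "(\<integral>\<^sup>+\<omega>. ennreal (Z \<omega> - \<alpha>) \<partial>P y) = ennreal (v - \<alpha>)" using nn by (simp add: Z_def)
  have "integrable (P y) (\<lambda>\<omega>. Z \<omega> - \<alpha>)"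
    by (rule integrableI_nonneg) (use nn0 nn' in auto)
  then have int: "integrable (P y) Z" using Bochner_Integration.integrable_add[of "P y" "\<lambda>\<omega>. Z \<omega> - \<alpha>" "\<lambda>_. \<alpha>"] by simp
  have "integral\<^sup>L (P y) (\<lambda>\<omega>. Z \<omega> - \<alpha>) = enn2real (\<integral>\<^sup>+\<omega>. ennreal (Z \<omega> - \<alpha>) \<partial>P y)"
    by (rule integral_eq_nn_integral) (use nn0 in auto)
  then have "integral\<^sup>L (P y) (\<lambda>\<omega>. Z \<omega> - \<alpha>) = v - \<alpha>" using nn' v by simp
  then have "integral\<^sup>L (P y) Z = v" using int by (simp add: prob_space)
  then show ?thesis by (simp add: stopped_mean_def Z_def[abs_def])
qed

text \<open>Weak duality: the variance is at most the second moment about any \<open>c\<close>,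
  which the majorant and \<open>stopped_scale_le\<close> bound. The same bound gives square
  integrability, so the mean in the definition of the variance is a genuine one.\<close>

lemma stopped_variance_le:
  assumes y: "y \<in> I" and \<tau>: "stopping_time G \<tau>" and B: "0 \<le> B" and A0: "(\<alpha> - c)\<^sup>2 \<le> A"
    and dom: "\<And>v. v \<in> I \<Longrightarrow> (v - c)\<^sup>2 \<le> A + B * S v"
  shows "stopped_variance P X y \<tau> \<le> ennreal (A + B * S y)"
proof -
  interpret prob_space "P y" by (rule prob_space_P[OF y])
  define W where "W \<omega> = real_of_ereal (stopped X \<tau> \<omega>) - c" for \<omega>
  have mst: "stopped X \<tau> \<in> P y \<rightarrow>\<^sub>M borel" using stopped_measurable_M[OF \<tau>] by (simp add: measurable_P[OF y])
  then have [measurable]: "W \<in> borel_measurable (P y)" unfolding W_def by measurable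
  have A: "0 \<le> A" using A0 zero_le_power2[of "\<alpha> - c"] by linarith
  have bound: "(\<integral>\<^sup>+\<omega>. ennreal ((W \<omega>)\<^sup>2) \<partial>P y) \<le> ennreal (A + B * S y)"
  proof -
    have "(\<integral>\<^sup>+\<omega>. ennreal ((W \<omega>)\<^sup>2) \<partial>P y) \<le> (\<integral>\<^sup>+\<omega>. ennreal A + ennreal B * ext_scale (stopped X \<tau> \<omega>) \<partial>P y)"
    proof (rule nn_integral_mono_AE)
      show "AE \<omega> in P y. ennreal ((W \<omega>)\<^sup>2) \<le> ennreal A + ennreal B * ext_scale (stopped X \<tau> \<omega>)"
        using AE_stopped_real[OF y \<tau>]
      proof eventually_elim
        case (elim \<omega>)
        define v where "v = real_of_ereal (stopped X \<tau> \<omega>)"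
        have v: "stopped X \<tau> \<omega> = ereal v" "\<alpha> \<le> v" "ereal v < \<beta>" using elim by (auto simp: v_def)
        show ?case
        proof (cases "v = \<alpha>")
          case True
          then show ?thesis using v A0 A by (simp add: W_def ennreal_leI)
        next
          case False
          then have vI: "v \<in> I" using v by (simp add: interior_states_def)
          have "ennreal ((W \<omega>)\<^sup>2) \<le> ennreal (A + B * S v)" using dom[OF vI] v by (simp add: W_def ennreal_leI)
          also have "\<dots> = ennreal A + ennreal B * ennreal (S v)"
            using A B S_pos[OF vI] by (simp add: ennreal_mult)
          finally show ?thesis using v by (simp add: ext_scale_interior[OF vI])
        qed
      qed
    qed
    also have "\<dots> = ennreal A + ennreal B * (\<integral>\<^sup>+\<omega>. ext_scale (stopped X \<tau> \<omega>) \<partial>P y)"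
      using measurable_compose[OF mst ext_scale_measurable]
      by (subst nn_integral_add) (auto simp: nn_integral_cmult emeasure_space_1)
    also have "\<dots> \<le> ennreal A + ennreal B * ennreal (S y)"
      by (intro add_left_mono mult_left_mono stopped_scale_le[OF y \<tau>]) auto
    also have "\<dots> = ennreal (A + B * S y)" using A B S_pos[OF y] by (simp add: ennreal_mult)
    finally show ?thesis .
  qed
  have W2: "integrable (P y) (\<lambda>\<omega>. (W \<omega>)\<^sup>2)"
    by (rule integrableI_nonneg) (use le_less_trans[OF bound ennreal_less_infinity] in \<open>auto simp: infinity_ennreal_def\<close>)
  have W1: "integrable (P y) W" by (rule square_integrable_imp_integrable[OF _ W2]) measurable
  define \<mu> where "\<mu> = expectation W"
  have mean: "stopped_mean P X y \<tau> = c + \<mu>"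
  proof -
    have "stopped_mean P X y \<tau> = expectation (\<lambda>\<omega>. c + W \<omega>)" by (simp add: stopped_mean_def W_def)
    also have "\<dots> = c + \<mu>" using W1 by (simp add: \<mu>_def prob_space)
    finally show ?thesis .
  qed
  have "stopped_variance P X y \<tau> = (\<integral>\<^sup>+\<omega>. ennreal ((W \<omega> - \<mu>)\<^sup>2) \<partial>P y)"
    unfolding stopped_variance_def
  proof (rule nn_integral_cong_AE)
    show "AE \<omega> in P y. e2ennreal ((stopped X \<tau> \<omega> - ereal (stopped_mean P X y \<tau>))\<^sup>2) = ennreal ((W \<omega> - \<mu>)\<^sup>2)"
      using AE_stopped_real[OF y \<tau>]
    proof eventually_elim
      case (elim \<omega>)
      have "(stopped X \<tau> \<omega> - ereal (stopped_mean P X y \<tau>))\<^sup>2 = ereal ((W \<omega> - \<mu>)\<^sup>2)"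
        using elim by (cases "stopped X \<tau> \<omega>") (simp_all add: mean W_def algebra_simps)
      then show ?case by (simp add: e2ennreal_ereal)
    qed
  qed
  also have "\<dots> = ennreal (variance W)"
    unfolding \<mu>_def
  proof (rule nn_integral_eq_integral)
    show "integrable (P y) (\<lambda>\<omega>. (W \<omega> - expectation W)\<^sup>2)" unfolding power2_diff using W1 W2 by auto
  qed simp
  also have "\<dots> \<le> ennreal (expectation (\<lambda>\<omega>. (W \<omega>)\<^sup>2))"
    by (rule ennreal_leI) (use variance_eq[OF W1 W2] in simp)
  also have "\<dots> = (\<integral>\<^sup>+\<omega>. ennreal ((W \<omega>)\<^sup>2) \<partial>P y)"
    by (rule nn_integral_eq_integral[symmetric]) (use W2 in auto)
  finally show ?thesis using bound by simp
qed

definition law_mean :: "real \<Rightarrow> real \<Rightarrow> real \<Rightarrow> real" where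
  "law_mean a b q = (1 - q) * a + q * b"

lemma law_mean_ge: "\<alpha> \<le> a \<Longrightarrow> \<alpha> \<le> b \<Longrightarrow> 0 \<le> q \<Longrightarrow> q \<le> 1 \<Longrightarrow> \<alpha> \<le> law_mean a b q"
proof -
  assume *: "\<alpha> \<le> a" "\<alpha> \<le> b" "0 \<le> q" "q \<le> 1"
  have "(1 - q) * \<alpha> + q * \<alpha> \<le> law_mean a b q" unfolding law_mean_def using * by (intro add_mono mult_left_mono) auto
  then show ?thesis by (simp add: algebra_simps)
qed

lemma mix_mean:
  assumes y: "y \<in> I" and p: "0 \<le> p" "p \<le> 1"
    and T: "two_point_law y T1 a1 b1 q1" "two_point_law y T2 a2 b2 q2"
    and ge: "\<alpha> \<le> a1" "\<alpha> \<le> b1" "\<alpha> \<le> a2" "\<alpha> \<le> b2"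
  shows "stopped_mean P X y (mix_times U p T1 T2) = p * law_mean a1 b1 q1 + (1 - p) * law_mean a2 b2 q2"
proof -
  have st: "stopping_time F T1" "stopping_time F T2" and q: "0 \<le> q1" "q1 \<le> 1" "0 \<le> q2" "q2 \<le> 1"
    using T by (auto simp: two_point_law_def)
  define f :: "ereal \<Rightarrow> ennreal" where "f v = ennreal (real_of_ereal v - \<alpha>)" for v
  have [measurable]: "f \<in> borel_measurable borel" unfolding f_def by measurable
  have one: "(\<integral>\<^sup>+\<omega>. f (stopped X T \<omega>) \<partial>P y) = ennreal (law_mean a b q - \<alpha>)"
    if "two_point_law y T a b q" "\<alpha> \<le> a" "\<alpha> \<le> b" for T a b q
  proof -
    have "(\<integral>\<^sup>+\<omega>. f (stopped X T \<omega>) \<partial>P y) = ennreal (1 - q) * ennreal (a - \<alpha>) + ennreal q * ennreal (b - \<alpha>)"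
      using that(1) by (simp add: two_point_law_def f_def[symmetric]) (simp add: f_def)
    also have "\<dots> = ennreal ((1 - q) * (a - \<alpha>) + q * (b - \<alpha>))"
      using that by (simp add: ennreal_mult two_point_law_def)
    also have "(1 - q) * (a - \<alpha>) + q * (b - \<alpha>) = law_mean a b q - \<alpha>" by (simp add: law_mean_def algebra_simps)
    finally show ?thesis .
  qed
  have lm: "\<alpha> \<le> law_mean a1 b1 q1" "\<alpha> \<le> law_mean a2 b2 q2" using law_mean_ge ge q by auto
  have "(\<integral>\<^sup>+\<omega>. f (stopped X (mix_times U p T1 T2) \<omega>) \<partial>P y)
    = ennreal p * ennreal (law_mean a1 b1 q1 - \<alpha>) + ennreal (1 - p) * ennreal (law_mean a2 b2 q2 - \<alpha>)"
    using nn_integral_stopped_mix[OF y p st, of f] one[OF T(1) ge(1,2)] one[OF T(2) ge(3,4)] by simp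
  also have "\<dots> = ennreal (p * (law_mean a1 b1 q1 - \<alpha>) + (1 - p) * (law_mean a2 b2 q2 - \<alpha>))"
    using p lm by (simp add: ennreal_mult)
  also have "p * (law_mean a1 b1 q1 - \<alpha>) + (1 - p) * (law_mean a2 b2 q2 - \<alpha>) = (p * law_mean a1 b1 q1 + (1 - p) * law_mean a2 b2 q2) - \<alpha>"
    by (simp add: algebra_simps)
  finally have eq: "(\<integral>\<^sup>+\<omega>. f (stopped X (mix_times U p T1 T2) \<omega>) \<partial>P y) = ennreal (p * law_mean a1 b1 q1 + (1 - p) * law_mean a2 b2 q2 - \<alpha>)" .
  have "p * \<alpha> + (1 - p) * \<alpha> \<le> p * law_mean a1 b1 q1 + (1 - p) * law_mean a2 b2 q2"
    using p lm by (intro add_mono mult_left_mono) auto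
  then have "\<alpha> \<le> p * law_mean a1 b1 q1 + (1 - p) * law_mean a2 b2 q2" by (simp add: algebra_simps)
  then show ?thesis
    by (intro stopped_mean_eqI[OF y stopping_time_mix[OF st]]) (use eq in \<open>simp_all add: f_def\<close>)
qed

lemma mix_variance:
  assumes y: "y \<in> I" and p: "0 \<le> p" "p \<le> 1"
    and T: "two_point_law y T1 a1 b1 q1" "two_point_law y T2 a2 b2 q2"
    and c: "stopped_mean P X y (mix_times U p T1 T2) = c"
  shows "stopped_variance P X y (mix_times U p T1 T2) =
    ennreal (p * ((1 - q1) * (a1 - c)\<^sup>2 + q1 * (b1 - c)\<^sup>2) + (1 - p) * ((1 - q2) * (a2 - c)\<^sup>2 + q2 * (b2 - c)\<^sup>2))"
proof -
  have st: "stopping_time F T1" "stopping_time F T2" and q: "0 \<le> q1" "q1 \<le> 1" "0 \<le> q2" "q2 \<le> 1"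
    using T by (auto simp: two_point_law_def)
  define f :: "ereal \<Rightarrow> ennreal" where "f v = e2ennreal ((v - ereal c)\<^sup>2)" for v
  have fm [measurable]: "f \<in> borel_measurable borel" unfolding f_def power2_eq_square by measurable
  have f: "f (ereal v) = ennreal ((v - c)\<^sup>2)" for v by (simp add: f_def)
  have "stopped_variance P X y (mix_times U p T1 T2) = (\<integral>\<^sup>+\<omega>. f (stopped X (mix_times U p T1 T2) \<omega>) \<partial>P y)"
    by (simp add: stopped_variance_def c f_def)
  also have "\<dots> = ennreal p * (ennreal (1 - q1) * ennreal ((a1 - c)\<^sup>2) + ennreal q1 * ennreal ((b1 - c)\<^sup>2))
      + ennreal (1 - p) * (ennreal (1 - q2) * ennreal ((a2 - c)\<^sup>2) + ennreal q2 * ennreal ((b2 - c)\<^sup>2))"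
    using nn_integral_stopped_mix[OF y p st fm] T fm by (simp add: two_point_law_def f)
  also have "\<dots> = ennreal (p * ((1 - q1) * (a1 - c)\<^sup>2 + q1 * (b1 - c)\<^sup>2) + (1 - p) * ((1 - q2) * (a2 - c)\<^sup>2 + q2 * (b2 - c)\<^sup>2))"
    using p q by (simp add: ennreal_mult)
  finally show ?thesis .
qed

end

context lower_attracted_diffusion
begin

subsection \<open>The inverse of the scale function\<close>

text \<open>The inverse is prolonged linearly below \<open>0\<close> in order to have an open range.\<close>

definition state_of :: "real \<Rightarrow> real" where
  "state_of u = (if u \<le> 0 then \<alpha> + u else (THE y. y \<in> I \<and> S y = u))"

lemma state_of_0 [simp]: "state_of 0 = \<alpha>"
  by (simp add: state_of_def)

lemma state_of_S: "y \<in> I \<Longrightarrow> state_of (S y) = y"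
proof -
  assume y: "y \<in> I"
  have "(THE z. z \<in> I \<and> S z = S y) = y"
  proof (rule the_equality)
    fix z assume "z \<in> I \<and> S z = S y"
    then show "z = y" using S_le_iff[of y z] S_le_iff[of z y] y by simp
  qed (simp add: y)
  then show ?thesis using S_pos[OF y] by (simp add: state_of_def)
qed

lemma state_of_pos:
  assumes "0 < u"
  shows "state_of u \<in> I" "S (state_of u) = u"
proof -
  obtain y where "y \<in> I" "S y = u" using S_surj[OF assms] by blast
  then show "state_of u \<in> I" "S (state_of u) = u" using state_of_S by auto
qed

lemma state_of_less: "u < v \<Longrightarrow> state_of u < state_of v"
proof -
  assume uv: "u < v"
  consider "v \<le> 0" | "u \<le> 0" "0 < v" | "0 < u" "0 < v" using uv by linarith
  then show ?thesis
  proof cases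
    case 1
    then show ?thesis using uv by (simp add: state_of_def)
  next
    case 2
    have "\<alpha> < state_of v" using state_of_pos(1)[OF 2(2)] by (simp add: interior_states_def)
    then show ?thesis using 2 by (simp add: state_of_def[of u])
  next
    case 3
    then show ?thesis
      using S_le_iff[OF state_of_pos(1)[OF 3(2)] state_of_pos(1)[OF 3(1)]] state_of_pos(2)[OF 3(1)] state_of_pos(2)[OF 3(2)] uv
      by (simp add: not_le[symmetric])
  qed
qed

lemma state_of_continuous: "continuous_on UNIV state_of"
proof (rule continuous_onI_mono)
  have "y \<in> range state_of" if "ereal y < \<beta>" for y
  proof (cases "y \<le> \<alpha>")
    case True
    then have "y = state_of (y - \<alpha>)" by (simp add: state_of_def)
    then show ?thesis by blast
  next
    case False
    then have "y \<in> I" using that by (simp add: interior_states_def)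
    then have "y = state_of (S y)" by (simp add: state_of_S)
    then show ?thesis by blast
  qed
  moreover have "ereal (state_of u) < \<beta>" for u
  proof (cases "u \<le> 0")
    case True
    then have "ereal (state_of u) \<le> ereal \<alpha>" by (simp add: state_of_def)
    then show ?thesis using nonempty by (rule le_less_trans)
  next
    case False
    then show ?thesis using state_of_pos(1)[of u] by (simp add: interior_states_def)
  qed
  ultimately have "range state_of = {y. ereal y < \<beta>}" by auto
  moreover have "open {y. ereal y < \<beta>}"
    by (intro open_Collect_less continuous_intros)
  ultimately show "open (range state_of)" by simp
  show "state_of u \<le> state_of v" if "u \<le> v" for u v
    using that state_of_less[of u v] by (cases "u = v") auto
qed

section \<open>The growth hypothesis in terms of the scale, and the contact set\<close>

lemma prob_hit:
  assumes x: "x \<in> I" and b: "b \<in> I" and xb: "x < b"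
  shows "measure (P x) {\<omega>\<in>space M. hit_time X (ereal b) \<omega> < \<infinity>} = S x / S b"
proof -
  let ?H = "{\<omega>\<in>space M. hit_time X (ereal b) \<omega> < \<infinity>}"
  have H: "?H \<in> sets M" by (rule measure_pos_sets[OF x regular[OF x b]])
  have "measure (P x) ?H = measure (P x) (reach (-\<infinity>) b)"
  proof (rule measure_eq_AE)
    show "AE \<omega> in P x. \<omega> \<in> ?H \<longleftrightarrow> \<omega> \<in> reach (-\<infinity>) b"
      using start[OF x] AE_space
    proof eventually_elim
      case (elim \<omega>)
      then have \<omega>: "\<omega> \<in> space M" using x by simp
      have "hit_time X (ereal b) \<omega> < \<infinity> \<longleftrightarrow> reaches (-\<infinity>) b (\<lambda>t. X t \<omega>)"
      proof
        assume "hit_time X (ereal b) \<omega> < \<infinity>"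
        then obtain t where t: "0 \<le> t" "X t \<omega> \<in> {ereal b}"
          unfolding hit_time_eq by (rule entry_time_attained[OF continuous_paths[OF \<omega>] closed_singleton]) auto
        have "-\<infinity> < X u \<omega>" if "0 \<le> u" for u using X_ge_lower[OF \<omega> that] by (cases "X u \<omega>") auto
        then show "reaches (-\<infinity>) b (\<lambda>t. X t \<omega>)" unfolding reaches_def using t by (intro exI[of _ t]) auto
      next
        assume "reaches (-\<infinity>) b (\<lambda>t. X t \<omega>)"
        then obtain s where s: "0 \<le> s" "ereal b \<le> X s \<omega>" by (auto simp: reaches_def)
        have c: "continuous_on {0..s} (\<lambda>t. X t \<omega>)" by (rule continuous_on_subset[OF continuous_paths[OF \<omega>]]) auto
        have "X 0 \<omega> \<le> ereal b" using elim(1) xb by simp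
        from IVT'[OF this s(2,1) c] obtain u where u: "0 \<le> u" "X u \<omega> = ereal b" by blast
        then have "hit_time X (ereal b) \<omega> \<le> ennreal u" unfolding hit_time_eq by (intro entry_time_le) auto
        then show "hit_time X (ereal b) \<omega> < \<infinity>" by (rule le_less_trans) simp
      qed
      then show ?case using \<omega> by simp
    qed
  qed (use H reaches_event x in auto)
  then show ?thesis using prob_reaches[OF x b xb] by simp
qed

text \<open>The hitting probability of \<open>b\<close> is \<open>S x / S b\<close>, so the
  hypothesis says that \<open>b\<^sup>2 / S b\<close> tends to 0; then \<open>u = S b\<close> is
  substituted.\<close>

lemma state_of_growth:
  assumes x: "x \<in> I"
    and lim: "((\<lambda>b. measure (P x) {\<omega>\<in>space M. hit_time X b \<omega> < \<infinity>} * (real_of_ereal b)\<^sup>2) \<longlongrightarrow> 0) (at_left \<beta>)"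
  shows "((\<lambda>u. (state_of u)\<^sup>2 / (1 + u)) \<longlongrightarrow> 0) at_top"
proof (rule order_tendstoI)
  show "\<forall>\<^sub>F u in at_top. l < (state_of u)\<^sup>2 / (1 + u)" if "l < 0" for l
    by (intro eventually_at_top_linorderI[of 0]) (use that in \<open>auto intro: less_le_trans\<close>)
  fix e :: real assume e: "0 < e"
  have xb: "ereal x < \<beta>" using x by (simp add: interior_states_def)
  have "0 < e * S x" using e S_pos[OF x] by simp
  from order_tendstoD(2)[OF lim this] obtain b0 where b0: "b0 < \<beta>"
    "\<And>b. b0 < b \<Longrightarrow> b < \<beta> \<Longrightarrow> measure (P x) {\<omega>\<in>space M. hit_time X b \<omega> < \<infinity>} * (real_of_ereal b)\<^sup>2 < e * S x"
    unfolding eventually_at_left[OF xb] by blast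
  have "max b0 (ereal x) < \<beta>" using b0 xb by simp
  then obtain b1 where b1: "max b0 (ereal x) < ereal b1" "ereal b1 < \<beta>" using ereal_dense2 by blast
  then have xb1: "x < b1" by simp
  have b1I: "b1 \<in> I" using xb1 b1 x by (auto simp: interior_states_def intro: less_trans[of \<alpha> x b1])
  show "\<forall>\<^sub>F u in at_top. (state_of u)\<^sup>2 / (1 + u) < e"
  proof (rule eventually_mono[OF eventually_gt_at_top[of "S b1"]])
    fix u assume u: "S b1 < u"
    have u0: "0 < u" using S_pos[OF b1I] u by simp
    define b where "b = state_of u"
    have b: "b \<in> I" "S b = u" using state_of_pos[OF u0] by (auto simp: b_def)
    have "b1 < b" using S_le_iff[OF b(1) b1I] b u by (simp add: not_le[symmetric])
    then have "b0 < ereal b" using b1 less_trans[of b0 "ereal b1" "ereal b"] by simp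
    moreover have "ereal b < \<beta>" using b by (simp add: interior_states_def)
    ultimately have "measure (P x) {\<omega>\<in>space M. hit_time X (ereal b) \<omega> < \<infinity>} * (real_of_ereal (ereal b))\<^sup>2 < e * S x"
      by (rule b0(2))
    then have "S x / u * b\<^sup>2 < e * S x" using prob_hit[OF x b(1)] xb1 \<open>b1 < b\<close> b by simp
    then have "S x * (b\<^sup>2 / u) < S x * e" by (simp add: mult.commute)
    then have "b\<^sup>2 / u < e" by (rule mult_left_less_imp_less) (use S_pos[OF x] in simp)
    moreover have "b\<^sup>2 / (1 + u) \<le> b\<^sup>2 / u" using u0 by (intro divide_left_mono) auto
    ultimately show "(state_of u)\<^sup>2 / (1 + u) < e" by (simp add: b_def)
  qed
qed

definition contact :: "real \<Rightarrow> real \<Rightarrow> real \<Rightarrow> bool" where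
  "contact c B v \<longleftrightarrow> (v - c)\<^sup>2 = (\<alpha> - c)\<^sup>2 + B * scale0 v"

definition majorized :: "real \<Rightarrow> real \<Rightarrow> bool" where
  "majorized c B \<longleftrightarrow> 0 < B \<and> \<alpha> < c \<and> (\<forall>v\<in>I. (v - c)\<^sup>2 \<le> (\<alpha> - c)\<^sup>2 + B * S v)"

lemma scale0_I: "v \<in> I \<Longrightarrow> scale0 v = S v"
  by (auto simp: scale0_def interior_states_def)

lemma scale0_lower [simp]: "scale0 \<alpha> = 0"
  by (simp add: scale0_def)

lemma contact_lower [simp]: "contact c B \<alpha>"
  by (simp add: contact_def)

text \<open>Between \<alpha> and \<open>c\<close> the squared distance to \<open>c\<close> is
  smaller than at \<alpha>, while the majorant is larger than there.\<close>

lemma contact_gt: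
  assumes "majorized c B" "v \<in> I" "contact c B v"
  shows "c < v"
proof (rule ccontr)
  assume "\<not> c < v"
  moreover have "\<alpha> < v" using assms(2) by (simp add: interior_states_def)
  ultimately have "(c - v)\<^sup>2 < (c - \<alpha>)\<^sup>2" by (intro power_strict_mono) auto
  moreover have "0 < B * S v" using assms S_pos by (auto simp: majorized_def)
  ultimately show False using assms(3) scale0_I[OF assms(2)] by (simp add: contact_def power2_commute[of c])
qed

text \<open>The saddle point in the variable \<open>u = S v\<close>. The two inequalities compare
  \<open>c\<close> with \<open>\<alpha> + (z - \<alpha>) * S x / S z\<close>, for
  \<open>z > x\<close> the mean at the exit from \<open>(\<alpha>, z)\<close>.\<close>

lemma saddle_states:
  assumes x: "x \<in> I"
    and lim: "((\<lambda>b. measure (P x) {\<omega>\<in>space M. hit_time X b \<omega> < \<infinity>} * (real_of_ereal b)\<^sup>2) \<longlongrightarrow> 0) (at_left \<beta>)"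
  obtains c B z1 z2 where "majorized c B" "z1 \<in> I" "z2 \<in> I" "contact c B z1" "contact c B z2"
    "(z1 - \<alpha>) * S x \<le> (c - \<alpha>) * S z1" "(c - \<alpha>) * S z2 \<le> (z2 - \<alpha>) * S x" "x < z1"
proof -
  have "strict_mono_on {0..} state_of" by (intro strict_mono_onI state_of_less)
  from saddle_point[OF continuous_on_subset[OF state_of_continuous subset_UNIV] this state_of_growth[OF x lim] S_pos[OF x]]
  obtain c B u1 u2 where s: "0 < B" "\<And>u. 0 \<le> u \<Longrightarrow> (state_of u - c)\<^sup>2 \<le> (state_of 0 - c)\<^sup>2 + B * u"
    "(state_of u1 - c)\<^sup>2 = (state_of 0 - c)\<^sup>2 + B * u1" "(state_of u2 - c)\<^sup>2 = (state_of 0 - c)\<^sup>2 + B * u2"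
    "0 < u1" "0 < u2" "(state_of u1 - state_of 0) * S x \<le> (c - state_of 0) * u1"
    "(c - state_of 0) * u2 \<le> (state_of u2 - state_of 0) * S x" "state_of 0 < c" by metis
  define z1 where "z1 = state_of u1"
  define z2 where "z2 = state_of u2"
  have z: "z1 \<in> I" "S z1 = u1" "z2 \<in> I" "S z2 = u2" using state_of_pos s by (auto simp: z1_def z2_def)
  have maj: "majorized c B" unfolding majorized_def
  proof (intro conjI ballI)
    fix v assume v: "v \<in> I"
    show "(v - c)\<^sup>2 \<le> (\<alpha> - c)\<^sup>2 + B * S v"
      using s(2)[of "S v"] S_pos[OF v] state_of_S[OF v] by simp
  qed (use s in simp_all)
  have con: "contact c B z1" "contact c B z2"
    using s(3,4) z by (simp_all add: contact_def scale0_I) (simp_all add: z1_def z2_def)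
  have le1: "(z1 - \<alpha>) * S x \<le> (c - \<alpha>) * S z1" using s(7) z by (simp add: z1_def)
  have le2: "(c - \<alpha>) * S z2 \<le> (z2 - \<alpha>) * S x" using s(8) z by (simp add: z2_def)
  \<comment> \<open>A contact point at or below \<open>x\<close> would by \<open>le1\<close> be at
    most \<open>c\<close>. Nothing of the kind holds for \<open>z2\<close>, which may lie on either
    side of \<open>x\<close>.\<close>
  have "x < z1"
  proof (rule ccontr)
    assume "\<not> x < z1"
    then have "S z1 \<le> S x" using S_le_iff[OF z(1) x] by simp
    then have "(c - \<alpha>) * S z1 \<le> (c - \<alpha>) * S x" using s(9) by (intro mult_left_mono) auto
    then have "(z1 - \<alpha>) * S x \<le> (c - \<alpha>) * S x" using le1 by simp
    then have "z1 \<le> c" using S_pos[OF x] by simp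
    with contact_gt[OF maj z(1) con(1)] show False by simp
  qed
  with that maj z con le1 le2 show ?thesis by blast
qed

subsection \<open>Optimality of mixtures of laws on the contact set\<close>

text \<open>The conditions for equality in the weak duality bound, apart from the mean being
  \<open>c\<close>: support on the contact set and an active scale constraint.\<close>

definition contact_law :: "real \<Rightarrow> real \<Rightarrow> real \<Rightarrow> ('a \<Rightarrow> ennreal) \<Rightarrow> real \<Rightarrow> bool" where
  "contact_law c B x T \<mu> \<longleftrightarrow> (\<exists>a b q. two_point_law x T a b q \<and> \<alpha> \<le> a \<and> \<alpha> \<le> b \<and> contact c B a \<and> contact c B b \<and>
     (1 - q) * scale0 a + q * scale0 b = S x \<and> law_mean a b q = \<mu>)"

text \<open>Equality in the bound is preserved under mixing, and \<open>p\<close> is free to bring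
  the mean to \<open>c\<close>. The variance then equals the upper bound that holds for all
  randomized stopping times.\<close>

lemma mixture_optimal:
  assumes x: "x \<in> I" and maj: "majorized c B" and T1: "contact_law c B x T1 \<mu>1" and T2: "contact_law c B x T2 \<mu>2"
    and \<mu>: "\<mu>2 \<le> c" "c \<le> \<mu>1"
  obtains p where "0 \<le> p" "p \<le> 1" "optimal M P X U x (mix_times U p T1 T2)"
    "variance_value M P X U x = ennreal ((\<alpha> - c)\<^sup>2 + B * S x)"
proof -
  obtain a1 b1 q1 where l1: "two_point_law x T1 a1 b1 q1" "\<alpha> \<le> a1" "\<alpha> \<le> b1" "contact c B a1" "contact c B b1"
     "(1 - q1) * scale0 a1 + q1 * scale0 b1 = S x" "law_mean a1 b1 q1 = \<mu>1" using T1 unfolding contact_law_def by blast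
  obtain a2 b2 q2 where l2: "two_point_law x T2 a2 b2 q2" "\<alpha> \<le> a2" "\<alpha> \<le> b2" "contact c B a2" "contact c B b2"
     "(1 - q2) * scale0 a2 + q2 * scale0 b2 = S x" "law_mean a2 b2 q2 = \<mu>2" using T2 unfolding contact_law_def by blast
  \<comment> \<open>The weight that averages the two means to \<open>c\<close>. If they coincide,
    both equal \<open>c\<close> and any weight will do.\<close>
  define p where "p = (if \<mu>1 = \<mu>2 then 0 else (c - \<mu>2) / (\<mu>1 - \<mu>2))"
  have p: "0 \<le> p" "p \<le> 1" using \<mu> by (auto simp: p_def divide_simps)
  have mean: "p * \<mu>1 + (1 - p) * \<mu>2 = c"
  proof (cases "\<mu>1 = \<mu>2")
    case False
    have "p * \<mu>1 + (1 - p) * \<mu>2 = p * (\<mu>1 - \<mu>2) + \<mu>2" by (simp add: algebra_simps)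
    then show ?thesis using False by (simp add: p_def)
  qed (use \<mu> p_def in auto)
  let ?\<tau> = "mix_times U p T1 T2"
  have st: "stopping_time G ?\<tau>" using l1(1) l2(1) by (auto simp: two_point_law_def intro: stopping_time_mix)
  have m: "stopped_mean P X x ?\<tau> = c"
    using mix_mean[OF x p l1(1) l2(1) l1(2,3) l2(2,3)] l1(7) l2(7) mean by simp
  have val: "(1 - q) * (a - c)\<^sup>2 + q * (b - c)\<^sup>2 = (\<alpha> - c)\<^sup>2 + B * S x"
    if "contact c B a" "contact c B b" "(1 - q) * scale0 a + q * scale0 b = S x" for a b q
  proof -
    have "(1 - q) * (a - c)\<^sup>2 + q * (b - c)\<^sup>2 = (\<alpha> - c)\<^sup>2 + B * ((1 - q) * scale0 a + q * scale0 b)"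
      using that(1,2) unfolding contact_def by (simp add: algebra_simps)
    then show ?thesis using that(3) by simp
  qed
  have v: "stopped_variance P X x ?\<tau> = ennreal ((\<alpha> - c)\<^sup>2 + B * S x)"
    using mix_variance[OF x p l1(1) l2(1) m]
    unfolding val[OF l1(4,5,6)] val[OF l2(4,5,6)] by (simp add: algebra_simps)
  have le: "stopped_variance P X x \<tau> \<le> ennreal ((\<alpha> - c)\<^sup>2 + B * S x)" if "\<tau> \<in> randomized_stopping_times M X U" for \<tau>
    by (rule stopped_variance_le[OF x]) (use that maj in \<open>auto simp: randomized_stopping_times_def majorized_def\<close>)
  have mem: "?\<tau> \<in> randomized_stopping_times M X U" using st by (simp add: randomized_stopping_times_def)
  have "variance_value M P X U x = ennreal ((\<alpha> - c)\<^sup>2 + B * S x)" unfolding variance_value_def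
  proof (rule antisym)
    show "(SUP \<tau>\<in>randomized_stopping_times M X U. stopped_variance P X x \<tau>) \<le> ennreal ((\<alpha> - c)\<^sup>2 + B * S x)"
      by (rule SUP_least) (rule le)
    show "ennreal ((\<alpha> - c)\<^sup>2 + B * S x) \<le> (SUP \<tau>\<in>randomized_stopping_times M X U. stopped_variance P X x \<tau>)"
      using SUP_upper[OF mem, of "stopped_variance P X x"] v by simp
  qed
  then show ?thesis using that[OF p] v mem by (simp add: optimal_def)
qed

lemma contact_law_exit:
  assumes x: "x \<in> I" and b: "b \<in> I" and a: "\<alpha> \<le> a" "a < x" and xb: "x < b"
    and con: "contact c B a" "contact c B b"
  shows "contact_law c B x (exit_time X (ereal \<alpha>) (ereal a) (ereal b))
    (law_mean a b ((S x - scale0 a) / (S b - scale0 a)))"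
proof -
  let ?q = "(S x - scale0 a) / (S b - scale0 a)"
  have t: "two_point_law x (exit_time X (ereal \<alpha>) (ereal a) (ereal b)) a b ?q"
    by (rule two_point_law_exit[OF x b a xb])
  have "scale0 a < S b"
  proof (cases "a = \<alpha>")
    case True
    then show ?thesis using S_pos[OF b] by simp
  next
    case False
    then have "a \<in> I" using a x by (auto simp: interior_states_def intro: less_trans[of "ereal a" "ereal x"])
    then show ?thesis using S_less[of a b] b a xb by (simp add: scale0_I)
  qed
  then have "?q * (S b - scale0 a) = S x - scale0 a" by simp
  moreover have "(1 - r) * s + r * t = u" if "r * (t - s) = u - s" for r s t u :: real
    using that by (simp add: algebra_simps)
  ultimately have "(1 - ?q) * scale0 a + ?q * scale0 b = S x" unfolding scale0_I[OF b] by blast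
  moreover have "\<alpha> \<le> b" using a xb by simp
  ultimately show ?thesis unfolding contact_law_def using t a con by blast
qed

lemma contact_law_trivial:
  assumes x: "x \<in> I" and con: "contact c B x"
  shows "contact_law c B x (exit_time X (ereal \<alpha>) (ereal a) (ereal x)) x"
proof -
  have "\<alpha> \<le> x" using x by (simp add: interior_states_def)
  moreover have "(1 - 0) * scale0 x + 0 * scale0 x = S x" by (simp add: scale0_I[OF x])
  moreover have "law_mean x x 0 = x" by (simp add: law_mean_def)
  ultimately show ?thesis unfolding contact_law_def using two_point_law_exit_trivial[OF x, of a] con by blast
qed

lemma contact_law_lower:
  assumes x: "x \<in> I" and z: "z \<in> I" and xz: "x < z" and con: "contact c B z"
  shows "contact_law c B x (exit_time X (ereal \<alpha>) (ereal \<alpha>) (ereal z)) (\<alpha> + (z - \<alpha>) * S x / S z)"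
proof -
  have "law_mean \<alpha> z ((S x - scale0 \<alpha>) / (S z - scale0 \<alpha>)) = \<alpha> + (z - \<alpha>) * S x / S z"
    using S_pos[OF z] by (simp add: law_mean_def field_simps)
  moreover have "\<alpha> < x" using x by (simp add: interior_states_def)
  ultimately show ?thesis using contact_law_exit[OF x z _ _ xz contact_lower con] by simp
qed

lemma mix_times_same: "mix_times U p T T = T"
  by (auto simp: mix_times_def)

text \<open>A degenerate mixture with \<open>p = 1\<close> reduces this to \<open>mix_mean\<close>.
  It serves to evaluate the condition on the maximizers, where the process starts elsewhere than at
  \<open>x\<close>.\<close>

lemma stopped_mean_lower:
  assumes y: "y \<in> I" and z: "z \<in> I" and yz: "y < z"
  shows "stopped_mean P X y (exit_time X (ereal \<alpha>) (ereal \<alpha>) (ereal z)) = \<alpha> + (z - \<alpha>) * S y / S z"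
proof -
  have \<alpha>: "\<alpha> < y" "\<alpha> < z" using y z by (auto simp: interior_states_def)
  note t = two_point_law_exit[OF y z order_refl \<alpha>(1) yz]
  have "stopped_mean P X y (mix_times U 1 (exit_time X (ereal \<alpha>) (ereal \<alpha>) (ereal z)) (exit_time X (ereal \<alpha>) (ereal \<alpha>) (ereal z)))
    = 1 * law_mean \<alpha> z ((S y - scale0 \<alpha>) / (S z - scale0 \<alpha>)) + (1 - 1) * law_mean \<alpha> z ((S y - scale0 \<alpha>) / (S z - scale0 \<alpha>))"
    by (rule mix_mean[OF y _ _ t t]) (use \<alpha> in auto)
  then show ?thesis using S_pos[OF z] by (simp add: mix_times_same law_mean_def field_simps)
qed

text \<open>The numerator equals \<open>(v - c)\<^sup>2 - (\<alpha> - c)\<^sup>2\<close>, so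
  majorization bounds the quotient by \<open>B\<close>, with equality exactly at contact points; as
  one exists, \<open>B\<close> is the maximum.\<close>

lemma maximizers_eq_contact:
  assumes maj: "majorized c B" and z: "z \<in> I" "contact c B z"
  shows "maximizers S \<alpha> \<beta> c = {v \<in> I. contact c B v}"
proof -
  define f where "f v = (v\<^sup>2 - \<alpha>\<^sup>2 - 2 * c * (v - \<alpha>)) / S v" for v
  have num: "v\<^sup>2 - \<alpha>\<^sup>2 - 2 * c * (v - \<alpha>) = (v - c)\<^sup>2 - (\<alpha> - c)\<^sup>2" for v
    by (simp add: power2_diff algebra_simps)
  have le: "f v \<le> B" if "v \<in> I" for v
  proof -
    have "(v - c)\<^sup>2 \<le> (\<alpha> - c)\<^sup>2 + B * S v" using maj that by (simp add: majorized_def)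
    then show ?thesis using S_pos[OF that] by (simp add: f_def num pos_divide_le_eq)
  qed
  have eq: "f v = B \<longleftrightarrow> contact c B v" if "v \<in> I" for v
    using S_pos[OF that] by (auto simp: f_def num contact_def scale0_I[OF that] divide_eq_eq)
  have "f z = B" using eq z by simp
  then have "v \<in> I \<and> (\<forall>w\<in>I. f w \<le> f v) \<longleftrightarrow> v \<in> I \<and> f v = B" for v
    using le z(1) by (metis order_antisym)
  then show ?thesis using eq unfolding maximizers_def f_def by (auto simp: Let_def)
qed

text \<open>In the scale variable the contact condition is closed, and it is bounded because squares
  grow more slowly than the scale whereas contact makes them grow at rate \<open>B\<close>.\<close>

lemma greatest_contact:
  assumes maj: "majorized c B" and z: "z \<in> I" "contact c B z"
    and growth: "((\<lambda>u. (state_of u)\<^sup>2 / (1 + u)) \<longlongrightarrow> 0) at_top"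
  obtains zs where "zs \<in> I" "contact c B zs" "\<And>v. v \<in> I \<Longrightarrow> contact c B v \<Longrightarrow> v \<le> zs"
proof -
  have B: "0 < B" using maj by (simp add: majorized_def)
  define W where "W = {u. 0 \<le> u \<and> (state_of u - c)\<^sup>2 = (\<alpha> - c)\<^sup>2 + B * u}"
  have "W = {0..} \<inter> {u. (state_of u - c)\<^sup>2 = (\<alpha> - c)\<^sup>2 + B * u}" by (auto simp: W_def)
  also have "closed \<dots>"
    by (intro closed_Int closed_atLeast closed_Collect_eq continuous_intros state_of_continuous)
  finally have cl: "closed W" .
  \<comment> \<open>With \<open>(v - c)\<^sup>2 \<le> 2 * v\<^sup>2 + 2 * c\<^sup>2\<close> this
    share yields the rate \<open>B / 4\<close>, which leaves \<open>3 / 4 * B * u\<close>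
    bounded.\<close>
  have "0 < B / 8" using B by simp
  from order_tendstoD(2)[OF growth this] obtain K where K: "\<And>u. K \<le> u \<Longrightarrow> (state_of u)\<^sup>2 / (1 + u) < B / 8"
    by (auto simp: eventually_at_top_linorder)
  have "u \<le> max K ((B + 8 * c\<^sup>2) / (3 * B))" if "u \<in> W" for u
  proof (cases "K \<le> u")
    case True
    have u: "0 \<le> u" "(state_of u - c)\<^sup>2 = (\<alpha> - c)\<^sup>2 + B * u" using that by (auto simp: W_def)
    have 1: "(state_of u)\<^sup>2 \<le> B / 8 * (1 + u)" using K[OF True] u(1) by (simp add: divide_less_eq)
    have 2: "(state_of u - c)\<^sup>2 \<le> 2 * (state_of u)\<^sup>2 + 2 * c\<^sup>2"
      using zero_le_power2[of "state_of u + c"] by (simp add: power2_sum power2_diff)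
    have "B * u \<le> (state_of u - c)\<^sup>2" using u(2) by simp
    also have "\<dots> \<le> 2 * (B / 8 * (1 + u)) + 2 * c\<^sup>2" using 1 2 by linarith
    finally have "3 * (B * u) \<le> B + 8 * c\<^sup>2" by (simp add: field_simps)
    then have "u \<le> (B + 8 * c\<^sup>2) / (3 * B)" using B by (simp add: pos_le_divide_eq mult_ac)
    then show ?thesis by simp
  qed simp
  then have bdd: "bdd_above W" by (rule bdd_aboveI)
  have SW: "S v \<in> W" if "v \<in> I" "contact c B v" for v
    using that S_pos[OF that(1)] by (simp add: W_def state_of_S contact_def scale0_I)
  have ne: "W \<noteq> {}" using SW[OF z] by blast
  define us where "us = Sup W"
  have us: "us \<in> W" unfolding us_def by (rule closed_contains_Sup[OF ne bdd cl])
  have up: "S v \<le> us" if "v \<in> I" "contact c B v" for v unfolding us_def by (rule cSup_upper[OF SW[OF that] bdd])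
  have us0: "0 < us" using up[OF z] S_pos[OF z(1)] by simp
  show ?thesis
  proof (rule that[of "state_of us"])
    show sI: "state_of us \<in> I" by (rule state_of_pos(1)[OF us0])
    show "contact c B (state_of us)" using us state_of_pos[OF us0] by (simp add: contact_def scale0_I W_def)
    show "v \<le> state_of us" if "v \<in> I" "contact c B v" for v
      using up[OF that] S_le_iff[OF that(1) sI] state_of_pos(2)[OF us0] by simp
  qed
qed

subsection \<open>The differentiable case\<close>

lemma open_I: "open I"
proof -
  have "I = {y. ereal \<alpha> < ereal y} \<inter> {y. ereal y < \<beta>}" by (auto simp: interior_states_def)
  moreover have "open \<dots>" by (intro open_Int open_Collect_less continuous_intros)
  ultimately show ?thesis by simp
qed

text \<open>A contact point maximizes \<open>(v - c)\<^sup>2 - B * S v\<close> over the open set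
  \<open>I\<close>, so \<open>B * deriv S z = 2 * (z - c)\<close>. Dividing by the contact equation,
  which factors as \<open>(z - \<alpha>) * (z - \<alpha> - 2 * (c - \<alpha>)) = B * S z\<close>,
  eliminates \<open>B\<close>.\<close>

lemma contact_derivative:
  assumes maj: "majorized c B" and z: "z \<in> I" "contact c B z" and diff: "S differentiable (at z)"
  shows "0 < z - \<alpha> - 2 * (c - \<alpha>)"
    and "deriv S z / S z * (z - \<alpha>) = 2 * (z - c) / (z - \<alpha> - 2 * (c - \<alpha>))"
proof -
  have B: "0 < B" and z\<alpha>: "\<alpha> < z" using maj z(1) by (auto simp: majorized_def interior_states_def)
  have con: "(z - c)\<^sup>2 = (\<alpha> - c)\<^sup>2 + B * S z" using z by (simp add: contact_def scale0_I)
  then have fac: "(z - \<alpha>) * (z - \<alpha> - 2 * (c - \<alpha>)) = B * S z" by (simp add: power2_eq_square algebra_simps)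
  then have "0 < (z - \<alpha>) * (z - \<alpha> - 2 * (c - \<alpha>))" using B S_pos[OF z(1)] by simp
  then show pos: "0 < z - \<alpha> - 2 * (c - \<alpha>)" using z\<alpha> by (simp add: zero_less_mult_iff)
  define f where "f v = (v - c)\<^sup>2 - B * S v" for v
  have dS: "(S has_real_derivative deriv S z) (at z)"
    using diff by (simp add: DERIV_deriv_iff_real_differentiable)
  have "(f has_real_derivative (2 * (z - c) - B * deriv S z)) (at z)"
    unfolding f_def by (rule derivative_eq_intros dS refl | simp)+
  moreover obtain e where e: "0 < e" "ball z e \<subseteq> I" using open_I z(1) open_contains_ball by blast
  have "f v \<le> f z" if "\<bar>z - v\<bar> < e" for v
  proof -
    have "v \<in> I" using e(2) that by (auto simp: dist_real_def)
    then have "(v - c)\<^sup>2 \<le> (\<alpha> - c)\<^sup>2 + B * S v" using maj by (simp add: majorized_def)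
    then show ?thesis using con by (simp add: f_def)
  qed
  ultimately have "2 * (z - c) - B * deriv S z = 0" by (intro DERIV_local_max[of f _ z e]) (use e in auto)
  then have d: "B * deriv S z = 2 * (z - c)" by simp
  have "deriv S z / S z * (z - \<alpha>) = (B * deriv S z) * (z - \<alpha>) / (B * S z)" using B by simp
  also have "\<dots> = 2 * (z - c) * (z - \<alpha>) / ((z - \<alpha>) * (z - \<alpha> - 2 * (c - \<alpha>)))" unfolding d fac ..
  also have "\<dots> = 2 * (z - c) / (z - \<alpha> - 2 * (c - \<alpha>))" using z\<alpha> by simp
  finally show "deriv S z / S z * (z - \<alpha>) = 2 * (z - c) / (z - \<alpha> - 2 * (c - \<alpha>))" .
qed

text \<open>The right-hand side in \<open>contact_derivative\<close> is
  \<open>2 + 2 * (c - \<alpha>) / (z - \<alpha> - 2 * (c - \<alpha>))\<close> and strictly decreases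
  where its denominator is positive, whereas the left-hand side is non-decreasing.\<close>

lemma contact_unique:
  assumes maj: "majorized c B" and diff: "\<And>z. z \<in> I \<Longrightarrow> S differentiable (at z)"
    and mono: "mono_on I (\<lambda>z. deriv S z / S z * (z - \<alpha>))"
    and z: "z \<in> I" "contact c B z" and w: "w \<in> I" "contact c B w"
  shows "z = w"
proof -
  have False if zw: "z \<in> I" "contact c B z" "w \<in> I" "contact c B w" "z < w" for z w
  proof -
    note dz = contact_derivative[OF maj zw(1,2) diff[OF zw(1)]]
    note dw = contact_derivative[OF maj zw(3,4) diff[OF zw(3)]]
    have "2 * (z - c) / (z - \<alpha> - 2 * (c - \<alpha>)) \<le> 2 * (w - c) / (w - \<alpha> - 2 * (c - \<alpha>))"
      using mono_onD[OF mono zw(1,3)] zw(5) dz(2) dw(2) by simp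
    then have "2 * (z - c) * (w - \<alpha> - 2 * (c - \<alpha>)) \<le> 2 * (w - c) * (z - \<alpha> - 2 * (c - \<alpha>))"
      using dz(1) dw(1) by (simp add: divide_simps split: if_splits)
    then have "(c - \<alpha>) * w \<le> (c - \<alpha>) * z" by (simp add: algebra_simps)
    then show False using maj zw(5) by (simp add: majorized_def)
  qed
  then show ?thesis using z w by (metis linorder_neqE_linordered_idom)
qed

lemma cross_le:
  fixes a b c d :: real
  assumes "a / b \<le> c / d" "0 < b" "0 < d"
  shows "a * d \<le> c * b"
  using assms by (simp add: field_simps)

text \<open>The right-hand side is nonnegative because \<open>S\<close> increases, which forces
  \<open>1 / 2 * S z > S x\<close>. In that range the left-hand side strictly decreases with
  \<open>S z\<close>, against a non-decreasing right-hand side.\<close>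

lemma stationarity_unique:
  assumes x: "x \<in> I" and diff: "\<And>z. z \<in> I \<Longrightarrow> S differentiable (at z)"
    and mono: "mono_on I (\<lambda>z. deriv S z / S z * (z - \<alpha>))"
    and z: "z \<in> I" "x < z" "1 / 2 * S z - S x \<noteq> 0" "(S z - S x) / (1 / 2 * S z - S x) = deriv S z / S z * (z - \<alpha>)"
    and w: "w \<in> I" "x < w" "1 / 2 * S w - S x \<noteq> 0" "(S w - S x) / (1 / 2 * S w - S x) = deriv S w / S w * (w - \<alpha>)"
  shows "z = w"
proof -
  have pos: "0 < 1 / 2 * S z - S x"
    if z: "z \<in> I" "x < z" "1 / 2 * S z - S x \<noteq> 0" "(S z - S x) / (1 / 2 * S z - S x) = deriv S z / S z * (z - \<alpha>)" for z
  proof (rule ccontr)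
    assume n: "\<not> 0 < 1 / 2 * S z - S x"
    have "0 \<le> deriv S z"
    proof (rule mono_on_imp_deriv_nonneg[of I S])
      show "mono_on I S" using scale_mono by (rule strict_mono_on_imp_mono_on)
      show "(S has_real_derivative deriv S z) (at z)"
        using diff[OF z(1)] by (simp add: DERIV_deriv_iff_real_differentiable)
      show "z \<in> interior I" using z(1) open_I by (simp add: interior_open)
    qed
    moreover have "\<alpha> < z" using z(1) by (simp add: interior_states_def)
    ultimately have "0 \<le> deriv S z / S z * (z - \<alpha>)" using S_pos[OF z(1)] by simp
    moreover have "(S z - S x) / (1 / 2 * S z - S x) < 0"
      using S_less[OF x z(1,2)] n z(3) by (intro divide_pos_neg) auto
    ultimately show False using z(4) by simp
  qed
  have False if zw: "z < w"
    and z: "z \<in> I" "x < z" "1 / 2 * S z - S x \<noteq> 0" "(S z - S x) / (1 / 2 * S z - S x) = deriv S z / S z * (z - \<alpha>)"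
    and w: "w \<in> I" "x < w" "1 / 2 * S w - S x \<noteq> 0" "(S w - S x) / (1 / 2 * S w - S x) = deriv S w / S w * (w - \<alpha>)"
    for z w
  proof -
    have "(S z - S x) / (1 / 2 * S z - S x) \<le> (S w - S x) / (1 / 2 * S w - S x)"
      unfolding z(4) w(4) using mono_onD[OF mono z(1) w(1)] zw by simp
    then have "(S z - S x) * (1 / 2 * S w - S x) \<le> (S w - S x) * (1 / 2 * S z - S x)"
      using pos[OF z] pos[OF w] by (intro cross_le)
    moreover have "S x * S w - S x * S z
      = 2 * ((S z - S x) * (1 / 2 * S w - S x) - (S w - S x) * (1 / 2 * S z - S x))"
      by (simp add: field_simps)
    ultimately have "S x * S w \<le> S x * S z" by simp
    then show False using S_pos[OF x] S_less[OF z(1) w(1) zw] by simp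
  qed
  then show ?thesis using z w by (metis linorder_neqE_linordered_idom)
qed

end

section \<open>Optimal stopping times for the variance problem\<close>

theorem theorem3p1:
  fixes M :: "'a measure"
    and P :: "real \<Rightarrow> 'a measure"
    and X :: "real \<Rightarrow> 'a \<Rightarrow> ereal"
    and U :: "'a \<Rightarrow> real"
    and S :: "real \<Rightarrow> real"
    and m :: "real measure"
    and \<alpha> x :: real
    and \<beta> :: ereal
  assumes "linear_diffusion M P X U S m (ereal \<alpha>) \<beta>"
    and "x \<in> interior_states (ereal \<alpha>) \<beta>"
    and "attractive M P X (ereal \<alpha>) \<beta> (ereal \<alpha>)"
    and "\<not> attractive M P X (ereal \<alpha>) \<beta> \<beta>"
    and "scale_lower (ereal \<alpha>) S = 0"
    and "scale_upper \<beta> S = \<infinity>"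
    and "((\<lambda>b. measure (P x) {\<omega>\<in>space M. hit_time X b \<omega> < \<infinity>} * (real_of_ereal b)\<^sup>2) \<longlongrightarrow> 0)
           (at_left \<beta>)"
  shows
    "variance_value M P X U x < \<infinity> \<and>
     (\<exists>a b z p. \<alpha> \<le> a \<and> a \<le> x \<and> x \<le> b \<and> ereal b < \<beta> \<and> x \<le> z \<and> ereal z < \<beta> \<and> 0 \<le> p \<and> p \<le> 1 \<and>
        optimal M P X U x
          (mix_times U p (exit_time X (ereal \<alpha>) (ereal a) (ereal b))
                         (exit_time X (ereal \<alpha>) (ereal \<alpha>) (ereal z)))) \<and>
     ((\<forall>c\<in>interior_states (ereal \<alpha>) \<beta>.
         (\<exists>z\<in>maximizers S \<alpha> \<beta> c. \<exists>w\<in>maximizers S \<alpha> \<beta> c. z \<noteq> w) \<longrightarrow>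
         stopped_mean P X (Inf (maximizers S \<alpha> \<beta> c))
           (exit_time X (ereal \<alpha>) (ereal \<alpha>) (ereal (Sup (maximizers S \<alpha> \<beta> c)))) > c) \<longrightarrow>
      (\<exists>z1 z2 p. x \<le> z1 \<and> ereal z1 < \<beta> \<and> x \<le> z2 \<and> ereal z2 < \<beta> \<and> 0 \<le> p \<and> p \<le> 1 \<and>
         optimal M P X U x
           (mix_times U p (exit_time X (ereal \<alpha>) (ereal \<alpha>) (ereal z1))
                          (exit_time X (ereal \<alpha>) (ereal \<alpha>) (ereal z2))))) \<and>
     ((\<forall>z\<in>interior_states (ereal \<alpha>) \<beta>. S differentiable (at z)) \<and>
      mono_on (interior_states (ereal \<alpha>) \<beta>) (\<lambda>z. deriv S z / S z * (z - \<alpha>)) \<longrightarrow>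
      (\<exists>z. {w. x < w \<and> ereal w < \<beta> \<and> 1 / 2 * S w - S x \<noteq> 0 \<and>
              (S w - S x) / (1 / 2 * S w - S x) = deriv S w / S w * (w - \<alpha>)} = {z} \<and>
         optimal M P X U x (exit_time X (ereal \<alpha>) (ereal \<alpha>) (ereal z)) \<and>
         variance_value M P X U x = ennreal ((z - \<alpha>)\<^sup>2 * (S x / S z) * (1 - S x / S z))))"
proof -
  interpret linear_diffusion M P X U S m "ereal \<alpha>" \<beta> by fact
  interpret lower_attracted_diffusion M P X U S m \<alpha> \<beta> by unfold_locales fact+
  note x = assms(2)
  obtain c B z1 z2 where maj: "majorized c B" and z: "z1 \<in> I" "z2 \<in> I" "contact c B z1" "contact c B z2"
    and le: "(z1 - \<alpha>) * S x \<le> (c - \<alpha>) * S z1" "(c - \<alpha>) * S z2 \<le> (z2 - \<alpha>) * S x" and xz1: "x < z1"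
    using saddle_states[OF x assms(7)] by metis
  have gt: "c < z1" "c < z2" using contact_gt[OF maj] z by auto
  have \<alpha>x: "\<alpha> < x" "ereal x < \<beta>" and z1: "ereal z1 < \<beta>" and z2: "\<alpha> < z2" "ereal z2 < \<beta>" and \<alpha>c: "\<alpha> < c"
    using x z maj by (auto simp: interior_states_def majorized_def)
  let ?T = "\<lambda>a b. exit_time X (ereal \<alpha>) (ereal a) (ereal b)"
  have T1: "contact_law c B x (?T \<alpha> z1) (\<alpha> + (z1 - \<alpha>) * S x / S z1)"
    by (rule contact_law_lower[OF x z(1) xz1 z(3)])
  have T1_le: "\<alpha> + (z1 - \<alpha>) * S x / S z1 \<le> c"
    using le(1) S_pos[OF z(1)] pos_divide_le_eq[of "S z1" "(z1 - \<alpha>) * S x" "c - \<alpha>"] by simp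
  have T2: "contact_law c B x (?T \<alpha> z2) (\<alpha> + (z2 - \<alpha>) * S x / S z2)" if "x < z2"
    by (rule contact_law_lower[OF x z(2) that z(4)])
  have T2_ge: "c \<le> \<alpha> + (z2 - \<alpha>) * S x / S z2"
    using le(2) S_pos[OF z(2)] pos_le_divide_eq[of "S z2" "c - \<alpha>" "(z2 - \<alpha>) * S x"] by simp
  have "variance_value M P X U x < \<infinity> \<and> (\<exists>a b z p. \<alpha> \<le> a \<and> a \<le> x \<and> x \<le> b \<and> ereal b < \<beta> \<and> x \<le> z \<and> ereal z < \<beta> \<and> 0 \<le> p \<and> p \<le> 1 \<and>
        optimal M P X U x (mix_times U p (?T a b) (?T \<alpha> z)))"
  proof -
    \<comment> \<open>The exit from \<open>(\<alpha>, z1)\<close> has mean at most \<open>c\<close>;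
      a partner of mean at least \<open>c\<close> is sought. It is the exit from
      \<open>(\<alpha>, z2)\<close>, immediate stopping, or the exit from \<open>(z2, z1)\<close>,
      according to the position of \<open>z2\<close>.\<close>
    have "\<exists>a b \<mu>. \<alpha> \<le> a \<and> a \<le> x \<and> x \<le> b \<and> ereal b < \<beta> \<and> contact_law c B x (?T a b) \<mu> \<and> c \<le> \<mu>"
    proof (cases x z2 rule: linorder_cases)
      case less
      then show ?thesis using T2 T2_ge \<alpha>x z2
        by - (rule exI[of _ \<alpha>], rule exI[of _ z2], rule exI[of _ "\<alpha> + (z2 - \<alpha>) * S x / S z2"], simp)
    next
      case equal
      have "contact_law c B x (?T x x) x" by (rule contact_law_trivial[OF x]) (use equal z in simp)
      then show ?thesis using equal gt \<alpha>x by (intro exI[of _ x]) auto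
    next
      case greater
      \<comment> \<open>Now \<open>z2 < x < z1\<close>, and both points exceed \<open>c\<close>, so
        every law on them has mean above \<open>c\<close>.\<close>
      let ?q = "(S x - scale0 z2) / (S z1 - scale0 z2)"
      have "contact_law c B x (?T z2 z1) (law_mean z2 z1 ?q)"
        using contact_law_exit[OF x z(1) _ greater xz1 z(4,3)] z2 by simp
      moreover have "c \<le> law_mean z2 z1 ?q"
      proof -
        have "0 \<le> ?q \<and> ?q \<le> 1"
          using S_less[OF z(2) x greater] S_less[OF x z(1) xz1] by (simp add: scale0_I[OF z(2)])
        then have "(1 - ?q) * c + ?q * c \<le> law_mean z2 z1 ?q"
          unfolding law_mean_def using gt by (intro add_mono mult_left_mono) auto
        then show ?thesis by (simp add: algebra_simps)
      qed
      ultimately show ?thesis using greater xz1 z1 z2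
        by - (rule exI[of _ z2], rule exI[of _ z1], rule exI[of _ "law_mean z2 z1 ?q"], simp)
    qed
    then obtain a b \<mu> where ab: "\<alpha> \<le> a" "a \<le> x" "x \<le> b" "ereal b < \<beta>" "contact_law c B x (?T a b) \<mu>" "c \<le> \<mu>" by blast
    obtain p where p: "0 \<le> p" "p \<le> 1" "optimal M P X U x (mix_times U p (?T a b) (?T \<alpha> z1))"
      "variance_value M P X U x = ennreal ((\<alpha> - c)\<^sup>2 + B * S x)"
      by (rule mixture_optimal[OF x maj ab(5) T1 T1_le ab(6)])
    have "variance_value M P X U x < \<infinity>" unfolding p(4) by simp
    moreover have "x \<le> z1" using xz1 by simp
    ultimately show ?thesis using ab p z1 by blast
  qed
  moreover have "\<exists>z1 z2 p. x \<le> z1 \<and> ereal z1 < \<beta> \<and> x \<le> z2 \<and> ereal z2 < \<beta> \<and> 0 \<le> p \<and> p \<le> 1 \<and>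
         optimal M P X U x (mix_times U p (?T \<alpha> z1) (?T \<alpha> z2))"
    if H: "\<forall>c\<in>I. (\<exists>z\<in>maximizers S \<alpha> \<beta> c. \<exists>w\<in>maximizers S \<alpha> \<beta> c. z \<noteq> w) \<longrightarrow>
         stopped_mean P X (Inf (maximizers S \<alpha> \<beta> c)) (?T \<alpha> (Sup (maximizers S \<alpha> \<beta> c))) > c"
  proof -
    have "\<exists>b \<mu>. x \<le> b \<and> ereal b < \<beta> \<and> contact_law c B x (?T \<alpha> b) \<mu> \<and> c \<le> \<mu>"
    proof (cases x z2 rule: linorder_cases)
      case less
      then show ?thesis using T2 T2_ge z2
        by - (rule exI[of _ z2], rule exI[of _ "\<alpha> + (z2 - \<alpha>) * S x / S z2"], simp)
    next
      case equal
      have "contact_law c B x (?T \<alpha> x) x" by (rule contact_law_trivial[OF x]) (use equal z in simp)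
      then show ?thesis using equal gt \<alpha>x by (intro exI[of _ x]) auto
    next
      case greater
      \<comment> \<open>The maximizers include \<open>z2 < x < z1\<close>, so the additional
        assumption applies. It concerns the start at the smallest one, which is at most
        \<open>z2\<close> and hence below \<open>x\<close>; the mean at the exit from
        \<open>(\<alpha>, zs)\<close> increases with the start, so it exceeds \<open>c\<close> from
        \<open>x\<close> as well.\<close>
      let ?Z = "maximizers S \<alpha> \<beta> c"
      have Z: "?Z = {v \<in> I. contact c B v}" by (rule maximizers_eq_contact[OF maj z(1,3)])
      obtain zs where zs: "zs \<in> I" "contact c B zs" "\<And>v. v \<in> I \<Longrightarrow> contact c B v \<Longrightarrow> v \<le> zs"
        using greatest_contact[OF maj z(1,3) state_of_growth[OF x assms(7)]] by metis
      have Sup: "Sup ?Z = zs" by (rule cSup_eq_maximum) (use zs Z in auto)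
      define zi where "zi = Inf ?Z"
      have "c \<le> zi" unfolding zi_def
        by (rule cInf_greatest) (use Z z contact_gt[OF maj] in \<open>auto intro: less_imp_le\<close>)
      moreover have zi_le: "zi \<le> z2" unfolding zi_def
        by (rule cInf_lower) (use Z z contact_gt[OF maj] in \<open>auto intro!: bdd_belowI[of _ c] less_imp_le\<close>)
      ultimately have ziI: "zi \<in> I" using \<alpha>c z2 le_less_trans[of "ereal zi" "ereal z2" \<beta>] by (auto simp: interior_states_def)
      have "c \<in> I" using \<alpha>c gt(2) z2 less_trans[of "ereal c" "ereal z2" \<beta>] by (auto simp: interior_states_def)
      moreover have "\<exists>z\<in>?Z. \<exists>w\<in>?Z. z \<noteq> w" using Z z greater xz1 by (intro bexI[of _ z1] bexI[of _ z2]) auto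
      ultimately have "c < stopped_mean P X zi (?T \<alpha> zs)" using H unfolding zi_def Sup[symmetric] by blast
      moreover have xzs: "x < zs" using zs(3)[OF z(1,3)] xz1 by simp
      ultimately have "c < \<alpha> + (zs - \<alpha>) * S zi / S zs"
        using stopped_mean_lower[OF ziI zs(1)] zi_le greater by simp
      also have "\<dots> \<le> \<alpha> + (zs - \<alpha>) * S x / S zs"
        using S_le_iff[OF ziI x] zi_le greater S_pos[OF zs(1)] xzs \<alpha>x
        by (intro add_left_mono divide_right_mono mult_left_mono) auto
      finally have "c \<le> \<alpha> + (zs - \<alpha>) * S x / S zs" by simp
      moreover have "ereal zs < \<beta>" using zs(1) by (simp add: interior_states_def)
      ultimately show ?thesis using contact_law_lower[OF x zs(1) xzs zs(2)] xzs
        by - (rule exI[of _ zs], rule exI[of _ "\<alpha> + (zs - \<alpha>) * S x / S zs"], simp)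
    qed
    then obtain b \<mu> where b: "x \<le> b" "ereal b < \<beta>" "contact_law c B x (?T \<alpha> b) \<mu>" "c \<le> \<mu>" by blast
    obtain p where p: "0 \<le> p" "p \<le> 1" "optimal M P X U x (mix_times U p (?T \<alpha> b) (?T \<alpha> z1))"
      by (rule mixture_optimal[OF x maj b(3) T1 T1_le b(4)])
    moreover have "x \<le> z1" using xz1 by simp
    ultimately show ?thesis using b z1 by blast
  qed
  moreover have "\<exists>z. {w. x < w \<and> ereal w < \<beta> \<and> 1 / 2 * S w - S x \<noteq> 0 \<and>
              (S w - S x) / (1 / 2 * S w - S x) = deriv S w / S w * (w - \<alpha>)} = {z} \<and>
         optimal M P X U x (?T \<alpha> z) \<and>
         variance_value M P X U x = ennreal ((z - \<alpha>)\<^sup>2 * (S x / S z) * (1 - S x / S z))"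
    if diff: "\<forall>z\<in>I. S differentiable (at z)" and mono: "mono_on I (\<lambda>z. deriv S z / S z * (z - \<alpha>))"
  proof -
    have diff': "z \<in> I \<Longrightarrow> S differentiable (at z)" for z using diff by blast
    \<comment> \<open>With a single contact point besides \<alpha> the two mean inequalities become
      an equality, and no mixing remains.\<close>
    have "z2 = z1" by (rule contact_unique[OF maj diff' mono z(2,4,1,3)])
    then have eq: "(z1 - \<alpha>) * S x = (c - \<alpha>) * S z1" using le by simp
    \<comment> \<open>The probability of reaching \<open>z1\<close> from \<open>x\<close>; the
      optimal law puts \<open>q\<close> on \<open>z1\<close> and \<open>1 - q\<close> on
      \<alpha>.\<close>
    define q where "q = S x / S z1"
    have Sz: "0 < S z1" "S x < S z1" using S_pos[OF z(1)] S_less[OF x z(1) xz1] by auto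
    have d: "c - \<alpha> = (z1 - \<alpha>) * q" using eq Sz by (simp add: q_def field_simps)
    have mean: "\<alpha> + (z1 - \<alpha>) * S x / S z1 = c" using d by (simp add: q_def)
    obtain p where p: "optimal M P X U x (mix_times U p (?T \<alpha> z1) (?T \<alpha> z1))"
      "variance_value M P X U x = ennreal ((\<alpha> - c)\<^sup>2 + B * S x)"
      by (rule mixture_optimal[OF x maj T1 T1]) (use mean in auto)
    have "(z1 - c)\<^sup>2 = (\<alpha> - c)\<^sup>2 + B * S z1" using z(3) by (simp add: contact_def scale0_I[OF z(1)])
    then have "B * S z1 = (z1 - \<alpha>) * (z1 - \<alpha> - 2 * (c - \<alpha>))" by (simp add: power2_eq_square algebra_simps)
    then have Bq: "B * S z1 = (z1 - \<alpha>)\<^sup>2 * (1 - 2 * q)" unfolding d by (simp add: power2_eq_square algebra_simps)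
    have "(\<alpha> - c)\<^sup>2 + B * S x = (c - \<alpha>)\<^sup>2 + q * (B * S z1)"
      using Sz by (simp add: q_def power2_commute[of \<alpha>])
    also have "\<dots> = (z1 - \<alpha>)\<^sup>2 * q * (1 - q)" unfolding d Bq by (simp add: power2_eq_square algebra_simps)
    finally have val: "variance_value M P X U x = ennreal ((z1 - \<alpha>)\<^sup>2 * (S x / S z1) * (1 - S x / S z1))"
      using p(2) by (simp add: q_def)
    note dz = contact_derivative[OF maj z(1,3) diff'[OF z(1)]]
    have z1\<alpha>: "0 < z1 - \<alpha>" using \<alpha>x xz1 by simp
    \<comment> \<open>Positivity in \<open>contact_derivative\<close> means
      \<open>q < 1 / 2\<close>, so the denominator in the equation for \<open>z\<close> is positive
      at \<open>z1\<close>.\<close>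
    have "0 < (z1 - \<alpha>) * (1 - 2 * q)" using dz(1) unfolding d by (simp add: algebra_simps)
    then have q2: "0 < 1 - 2 * q" using z1\<alpha> by (simp add: zero_less_mult_iff)
    then have half: "0 < 1 / 2 * S z1 - S x" using Sz by (simp add: q_def field_simps)
    have "deriv S z1 / S z1 * (z1 - \<alpha>) = 2 * ((z1 - \<alpha>) * (1 - q)) / ((z1 - \<alpha>) * (1 - 2 * q))"
    proof -
      have "z1 - c = (z1 - \<alpha>) * (1 - q)" "z1 - \<alpha> - 2 * (c - \<alpha>) = (z1 - \<alpha>) * (1 - 2 * q)"
        using d by (simp_all add: algebra_simps)
      then show ?thesis using dz(2) by simp
    qed
    also have "\<dots> = 2 * (1 - q) / (1 - 2 * q)" using z1\<alpha> by simp
    also have "\<dots> = (S z1 - S x) / (1 / 2 * S z1 - S x)"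
      using Sz half q2 by (simp add: q_def field_simps)
    finally have sol: "(S z1 - S x) / (1 / 2 * S z1 - S x) = deriv S z1 / S z1 * (z1 - \<alpha>)" ..
    have uniq: "w = z1" if w: "x < w" "ereal w < \<beta>" "1 / 2 * S w - S x \<noteq> 0"
      "(S w - S x) / (1 / 2 * S w - S x) = deriv S w / S w * (w - \<alpha>)" for w
    proof (rule stationarity_unique[OF x diff' mono])
      show "w \<in> I" using w \<alpha>x by (simp add: interior_states_def)
    qed (use w z xz1 half sol in auto)
    have "1 / 2 * S z1 - S x \<noteq> 0" using half by simp
    then have "{w. x < w \<and> ereal w < \<beta> \<and> 1 / 2 * S w - S x \<noteq> 0 \<and>
              (S w - S x) / (1 / 2 * S w - S x) = deriv S w / S w * (w - \<alpha>)} = {z1}"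
      using uniq xz1 z1 sol by blast
    moreover have "optimal M P X U x (?T \<alpha> z1)" using p(1) by (simp only: mix_times_same)
    ultimately show ?thesis using val by blast
  qed
  ultimately show ?thesis by blast
qed

end
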